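(* Let $\mathscr{C}$ be a combinatorial category of type $\mathbb{N}^{\infty}$ and let $k$ be a field. If the endomorphism group $G_{\mathbf{x}} = \mathscr{C}(\mathbf{x},\mathbf{x})$ is finite for each $\mathbf{x} \in \mathrm{Ob}(\mathscr{C})$, then the category of finitely presented $\mathscr{C}$-modules (the full subcategory of the category $\mathscr{C}\text{-Mod}$ of $\mathscr{C}$-modules over $k$ on the finitely presented ones) is abelian.
   Context: $\mathbb{N}^{\infty}$ denotes the poset of sequences $\mathbf{x}=(x_1,x_2,\ldots)$ of natural numbers (including $0$) with all but finitely many entries equal to $0$, ordered by $\mathbf{x}\leqslant\mathbf{y}$ iff $x_i\leqslant y_i$ for all $i$; it is viewed as a category with exactly one morphism $\mathbf{x}\to\mathbf{y}$ when $\mathbf{x}\leqslant\mathbf{y}$ and none otherwise. An EI category is a category in which every endomorphism is an isomorphism. A combinatorial category of type $\mathbb{N}^{\infty}$ is a small skeletal EI category $\mathscr{C}$ such that: (1) there is a functor $\iota:\mathbb{N}^{\infty}\to\mathscr{C}$ which is a bijection on objects; via $\iota$ objects of $\mathscr{C}$ are identified with elements of $\mathbb{N}^\infty$, and $\mathscr{C}(\mathbf{x},\mathbf{y})\neq\emptyset$ iff $\mathbf{x}\leqslant\mathbf{y}$; (2) whenever $\mathscr{C}(\mathbf{x},\mathbf{y})\neq\emptyset$, the group $G_{\mathbf{x}}=\mathscr{C}(\mathbf{x},\mathbf{x})$ acts freely and transitively on $\mathscr{C}(\mathbf{x},\mathbf{y})$ from the right by composition; (3) the group $G_{\mathbf{y}}$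 acts transitively on $\mathscr{C}(\mathbf{x},\mathbf{y})$ from the left by composition. A $\mathscr{C}$-module over $k$ is a covariant functor $V:\mathscr{C}\to k\text{-Mod}$. For $\mathbf{x}\in\mathrm{Ob}(\mathscr{C})$, $P(\mathbf{x})=k\mathscr{C}(\mathbf{x},-)$ is the $k$-linearization of the representable functor. A $\mathscr{C}$-module is finitely presented if it is the cokernel of a morphism between finite direct sums of modules of the form $P(\mathbf{x})$ (equivalently, it is finitely generated with a finitely generated module of relations). *)

theory Defs
  imports "HOL-Algebra.Module" "HOL-Algebra.AbelCoset"
begin

section \<open>Categories\<close>

record ('o, 'a) cat =
  Ob :: "'o set"
  Arr :: "'a set"
  Dom :: "'a \<Rightarrow> 'o"
  Cod :: "'a \<Rightarrow> 'o"
  Ide :: "'o \<Rightarrow> 'a"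
  Cmp :: "'a \<Rightarrow> 'a \<Rightarrow> 'a"  (infixr \<open>\<cdot>\<index>\<close> 70)

definition hom_set :: "('o, 'a, 'z) cat_scheme \<Rightarrow> 'o \<Rightarrow> 'o \<Rightarrow> 'a set" where
  "hom_set C x y = {f \<in> Arr C. Dom C f = x \<and> Cod C f = y}"

locale category =
  fixes C :: "('o, 'a, 'z) cat_scheme" (structure)
  assumes Dom_in_Ob: "f \<in> Arr C \<Longrightarrow> Dom C f \<in> Ob C"
    and Cod_in_Ob: "f \<in> Arr C \<Longrightarrow> Cod C f \<in> Ob C"
    and Ide_in_hom: "x \<in> Ob C \<Longrightarrow> Ide C x \<in> hom_set C x x"
    and Cmp_in_hom: "f \<in> hom_set C x y \<Longrightarrow> g \<in> hom_set C y z \<Longrightarrow> g \<cdot> f \<in> hom_set C x z"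
    and Cmp_Ide: "f \<in> hom_set C x y \<Longrightarrow> f \<cdot> Ide C x = f"
    and Ide_Cmp: "f \<in> hom_set C x y \<Longrightarrow> Ide C y \<cdot> f = f"
    and Cmp_assoc: "f \<in> hom_set C w x \<Longrightarrow> g \<in> hom_set C x y \<Longrightarrow> h \<in> hom_set C y z
      \<Longrightarrow> (h \<cdot> g) \<cdot> f = h \<cdot> (g \<cdot> f)"

definition iso_arrow :: "('o, 'a, 'z) cat_scheme \<Rightarrow> 'a \<Rightarrow> bool" where
  "iso_arrow C f \<longleftrightarrow> f \<in> Arr C \<and>
     (\<exists>g \<in> hom_set C (Cod C f) (Dom C f).
        g \<cdot>\<^bsub>C\<^esub> f = Ide C (Dom C f) \<and> f \<cdot>\<^bsub>C\<^esub> g = Ide C (Cod C f))"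

definition EI_category :: "('o, 'a, 'z) cat_scheme \<Rightarrow> bool" where
  "EI_category C \<longleftrightarrow> category C \<and> (\<forall>x \<in> Ob C. \<forall>f \<in> hom_set C x x. iso_arrow C f)"

definition skeletal :: "('o, 'a, 'z) cat_scheme \<Rightarrow> bool" where
  "skeletal C \<longleftrightarrow>
     (\<forall>x \<in> Ob C. \<forall>y \<in> Ob C. (\<exists>f \<in> hom_set C x y. iso_arrow C f) \<longrightarrow> x = y)"

definition is_functor ::
  "('o, 'a, 'y) cat_scheme \<Rightarrow> ('p, 'b, 'z) cat_scheme \<Rightarrow> ('o \<Rightarrow> 'p) \<Rightarrow> ('a \<Rightarrow> 'b) \<Rightarrow> bool" where
  "is_functor C D Fo Fa \<longleftrightarrow> category C \<and> category D \<and>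
     (\<forall>x \<in> Ob C. Fo x \<in> Ob D) \<and>
     (\<forall>f \<in> Arr C. Fa f \<in> hom_set D (Fo (Dom C f)) (Fo (Cod C f))) \<and>
     (\<forall>x \<in> Ob C. Fa (Ide C x) = Ide D (Fo x)) \<and>
     (\<forall>f \<in> Arr C. \<forall>g \<in> Arr C. Cod C f = Dom C g \<longrightarrow> Fa (g \<cdot>\<^bsub>C\<^esub> f) = Fa g \<cdot>\<^bsub>D\<^esub> Fa f)"

definition full_subcategory :: "('o, 'a) cat \<Rightarrow> ('o \<Rightarrow> bool) \<Rightarrow> ('o, 'a) cat" where
  "full_subcategory C S =
     C\<lparr>Ob := {x \<in> Ob C. S x}, Arr := {f \<in> Arr C. S (Dom C f) \<and> S (Cod C f)}\<rparr>"


section \<open>Abelian categories\<close>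

definition zero_object :: "('o, 'a, 'z) cat_scheme \<Rightarrow> 'o \<Rightarrow> bool" where
  "zero_object C z \<longleftrightarrow> z \<in> Ob C \<and>
     (\<forall>x \<in> Ob C. (\<exists>!f. f \<in> hom_set C x z) \<and> (\<exists>!f. f \<in> hom_set C z x))"

definition zero_arrow :: "('o, 'a, 'z) cat_scheme \<Rightarrow> 'a \<Rightarrow> bool" where
  "zero_arrow C f \<longleftrightarrow> f \<in> Arr C \<and>
     (\<exists>z g h. zero_object C z \<and> g \<in> hom_set C (Dom C f) z \<and> h \<in> hom_set C z (Cod C f) \<and>
        f = h \<cdot>\<^bsub>C\<^esub> g)"

definition monomorphism :: "('o, 'a, 'z) cat_scheme \<Rightarrow> 'a \<Rightarrow> bool" where
  "monomorphism C f \<longleftrightarrow> f \<in> Arr C \<and>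
     (\<forall>x \<in> Ob C. \<forall>g \<in> hom_set C x (Dom C f). \<forall>h \<in> hom_set C x (Dom C f).
        f \<cdot>\<^bsub>C\<^esub> g = f \<cdot>\<^bsub>C\<^esub> h \<longrightarrow> g = h)"

definition epimorphism :: "('o, 'a, 'z) cat_scheme \<Rightarrow> 'a \<Rightarrow> bool" where
  "epimorphism C f \<longleftrightarrow> f \<in> Arr C \<and>
     (\<forall>x \<in> Ob C. \<forall>g \<in> hom_set C (Cod C f) x. \<forall>h \<in> hom_set C (Cod C f) x.
        g \<cdot>\<^bsub>C\<^esub> f = h \<cdot>\<^bsub>C\<^esub> f \<longrightarrow> g = h)"

definition is_kernel :: "('o, 'a, 'z) cat_scheme \<Rightarrow> 'a \<Rightarrow> 'a \<Rightarrow> bool" where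
  "is_kernel C f i \<longleftrightarrow> f \<in> Arr C \<and> i \<in> Arr C \<and> Cod C i = Dom C f \<and>
     zero_arrow C (f \<cdot>\<^bsub>C\<^esub> i) \<and>
     (\<forall>x \<in> Ob C. \<forall>g \<in> hom_set C x (Dom C f). zero_arrow C (f \<cdot>\<^bsub>C\<^esub> g) \<longrightarrow>
        (\<exists>!u. u \<in> hom_set C x (Dom C i) \<and> i \<cdot>\<^bsub>C\<^esub> u = g))"

definition is_cokernel :: "('o, 'a, 'z) cat_scheme \<Rightarrow> 'a \<Rightarrow> 'a \<Rightarrow> bool" where
  "is_cokernel C f q \<longleftrightarrow> f \<in> Arr C \<and> q \<in> Arr C \<and> Dom C q = Cod C f \<and>
     zero_arrow C (q \<cdot>\<^bsub>C\<^esub> f) \<and>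
     (\<forall>x \<in> Ob C. \<forall>g \<in> hom_set C (Cod C f) x. zero_arrow C (g \<cdot>\<^bsub>C\<^esub> f) \<longrightarrow>
        (\<exists>!u. u \<in> hom_set C (Cod C q) x \<and> u \<cdot>\<^bsub>C\<^esub> q = g))"

definition preadditive ::
  "('o, 'a, 'z) cat_scheme \<Rightarrow> ('a \<Rightarrow> 'a \<Rightarrow> 'a) \<Rightarrow> bool" where
  "preadditive C pl \<longleftrightarrow> category C \<and>
     (\<forall>x \<in> Ob C. \<forall>y \<in> Ob C.
        \<exists>z. comm_group \<lparr>carrier = hom_set C x y, monoid.mult = pl, one = z\<rparr>) \<and>
     (\<forall>x \<in> Ob C. \<forall>y \<in> Ob C. \<forall>z \<in> Ob C.
        \<forall>f \<in> hom_set C x y. \<forall>f' \<in> hom_set C x y. \<forall>g \<in> hom_set C y z. \<forall>g' \<in> hom_set C y z.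
          g \<cdot>\<^bsub>C\<^esub> pl f f' = pl (g \<cdot>\<^bsub>C\<^esub> f) (g \<cdot>\<^bsub>C\<^esub> f') \<and>
          pl g g' \<cdot>\<^bsub>C\<^esub> f = pl (g \<cdot>\<^bsub>C\<^esub> f) (g' \<cdot>\<^bsub>C\<^esub> f))"

definition has_biproduct ::
  "('o, 'a, 'z) cat_scheme \<Rightarrow> ('a \<Rightarrow> 'a \<Rightarrow> 'a) \<Rightarrow> 'o \<Rightarrow> 'o \<Rightarrow> bool" where
  "has_biproduct C pl x y \<longleftrightarrow>
     (\<exists>s \<in> Ob C. \<exists>p \<in> hom_set C s x. \<exists>q \<in> hom_set C s y.
        \<exists>i \<in> hom_set C x s. \<exists>j \<in> hom_set C y s.
          p \<cdot>\<^bsub>C\<^esub> i = Ide C x \<and> q \<cdot>\<^bsub>C\<^esub> j = Ide C y \<and>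
          pl (i \<cdot>\<^bsub>C\<^esub> p) (j \<cdot>\<^bsub>C\<^esub> q) = Ide C s)"

text \<open>Abelian categories as in Mac Lane, \<^emph>\<open>Categories for the Working Mathematician\<close>,
  Section VIII.3.\<close>

definition abelian_category :: "('o, 'a, 'z) cat_scheme \<Rightarrow> bool" where
  "abelian_category C \<longleftrightarrow> category C \<and>
     (\<exists>pl. preadditive C pl \<and> (\<forall>x \<in> Ob C. \<forall>y \<in> Ob C. has_biproduct C pl x y)) \<and>
     (\<exists>z. zero_object C z) \<and>
     (\<forall>f \<in> Arr C. \<exists>i. is_kernel C f i) \<and>
     (\<forall>f \<in> Arr C. \<exists>q. is_cokernel C f q) \<and>
     (\<forall>f. monomorphism C f \<longrightarrow> (\<exists>g \<in> Arr C. is_kernel C g f)) \<and>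
     (\<forall>f. epimorphism C f \<longrightarrow> (\<exists>g \<in> Arr C. is_cokernel C g f))"


section \<open>Combinatorial categories of type \<open>\<nat>\<^sup>\<infinity>\<close>\<close>

text \<open>The order \<open>\<le>\<close> on functions is pointwise.  (The order on the type of finitely
  supported functions in \<open>HOL-Library.Poly_Mapping\<close> is lexicographic and is not the one meant.)\<close>

definition Ninf :: "(nat \<Rightarrow> nat) set" where
  "Ninf = {x. finite {i. x i \<noteq> 0}}"

definition Ninf_cat :: "(nat \<Rightarrow> nat, (nat \<Rightarrow> nat) \<times> (nat \<Rightarrow> nat)) cat" where
  "Ninf_cat = \<lparr>Ob = Ninf, Arr = {(x, y). x \<in> Ninf \<and> y \<in> Ninf \<and> x \<le> y},
     Dom = fst, Cod = snd, Ide = (\<lambda>x. (x, x)), Cmp = (\<lambda>g f. (fst f, snd g))\<rparr>"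

definition combinatorial_category :: "('o, 'a, 'z) cat_scheme \<Rightarrow> bool" where
  "combinatorial_category C \<longleftrightarrow> EI_category C \<and> skeletal C \<and>
     (\<exists>\<iota>o \<iota>a. is_functor Ninf_cat C \<iota>o \<iota>a \<and> bij_betw \<iota>o Ninf (Ob C) \<and>
        (\<forall>x \<in> Ninf. \<forall>y \<in> Ninf. hom_set C (\<iota>o x) (\<iota>o y) \<noteq> {} \<longleftrightarrow> x \<le> y)) \<and>
     (\<forall>x \<in> Ob C. \<forall>y \<in> Ob C. hom_set C x y \<noteq> {} \<longrightarrow>
        (\<forall>f \<in> hom_set C x y. \<forall>g \<in> hom_set C x x. f \<cdot>\<^bsub>C\<^esub> g = f \<longrightarrow> g = Ide C x) \<and>
        (\<forall>f \<in> hom_set C x y. \<forall>f' \<in> hom_set C x y. \<exists>g \<in> hom_set C x x. f' = f \<cdot>\<^bsub>C\<^esub> g)) \<and>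
     (\<forall>x \<in> Ob C. \<forall>y \<in> Ob C.
        \<forall>f \<in> hom_set C x y. \<forall>f' \<in> hom_set C x y. \<exists>g \<in> hom_set C y y. f' = g \<cdot>\<^bsub>C\<^esub> f)"


section \<open>Modules over a category\<close>

text \<open>The fields \<open>mult\<close> and \<open>one\<close> which \<open>module\<close> records inherit from rings play no role in
  modules.\<close>

definition linear_maps ::
  "('k, 'r) ring_scheme \<Rightarrow> ('k, 'm) module \<Rightarrow> ('k, 'n) module \<Rightarrow> ('m \<Rightarrow> 'n) set" where
  "linear_maps k M N = {h \<in> carrier M \<rightarrow> carrier N.
     (\<forall>u \<in> carrier M. \<forall>v \<in> carrier M. h (u \<oplus>\<^bsub>M\<^esub> v) = h u \<oplus>\<^bsub>N\<^esub> h v) \<and>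
     (\<forall>c \<in> carrier k. \<forall>u \<in> carrier M. h (c \<odot>\<^bsub>M\<^esub> u) = c \<odot>\<^bsub>N\<^esub> h u)}"

record ('o, 'a, 'k, 'm) cmodule =
  mod_at :: "'o \<Rightarrow> ('k, 'm) module"
  act :: "'a \<Rightarrow> 'm \<Rightarrow> 'm"

text \<open>A covariant functor from \<open>C\<close> to \<open>k\<close>-modules.  Values of \<open>mod_at V\<close>, \<open>act V f\<close> outside
  their mathematical domains are left unconstrained; this only adds isomorphic copies of objects.
  Morphisms (below) are extensional, so that they are determined by their values on the carriers.\<close>

definition is_cmodule ::
  "('o, 'a) cat \<Rightarrow> ('k, 'r) ring_scheme \<Rightarrow> ('o, 'a, 'k, 'm) cmodule \<Rightarrow> bool" where
  "is_cmodule C k V \<longleftrightarrow>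
     (\<forall>x \<in> Ob C. module k (mod_at V x)) \<and>
     (\<forall>f \<in> Arr C. act V f \<in> linear_maps k (mod_at V (Dom C f)) (mod_at V (Cod C f))) \<and>
     (\<forall>x \<in> Ob C. \<forall>u \<in> carrier (mod_at V x). act V (Ide C x) u = u) \<and>
     (\<forall>f \<in> Arr C. \<forall>g \<in> Arr C. Cod C f = Dom C g \<longrightarrow>
        (\<forall>u \<in> carrier (mod_at V (Dom C f)). act V (g \<cdot>\<^bsub>C\<^esub> f) u = act V g (act V f u)))"

definition cmodule_homs ::
  "('o, 'a) cat \<Rightarrow> ('k, 'r) ring_scheme \<Rightarrow> ('o, 'a, 'k, 'm) cmodule \<Rightarrow> ('o, 'a, 'k, 'n) cmodule
     \<Rightarrow> ('o \<Rightarrow> 'm \<Rightarrow> 'n) set" where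
  "cmodule_homs C k V W =
     {\<eta> \<in> \<Pi>\<^sub>E x \<in> Ob C. linear_maps k (mod_at V x) (mod_at W x) \<inter> extensional (carrier (mod_at V x)).
        \<forall>f \<in> Arr C. \<forall>u \<in> carrier (mod_at V (Dom C f)).
          \<eta> (Cod C f) (act V f u) = act W f (\<eta> (Dom C f) u)}"

definition cmodule_isomorphic ::
  "('o, 'a) cat \<Rightarrow> ('k, 'r) ring_scheme \<Rightarrow> ('o, 'a, 'k, 'm) cmodule \<Rightarrow> ('o, 'a, 'k, 'n) cmodule
     \<Rightarrow> bool" where
  "cmodule_isomorphic C k V W \<longleftrightarrow>
     (\<exists>\<eta> \<in> cmodule_homs C k V W.
        \<forall>x \<in> Ob C. bij_betw (\<eta> x) (carrier (mod_at V x)) (carrier (mod_at W x)))"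

text \<open>The category of \<open>C\<close>-modules over \<open>k\<close> all of whose elements are taken from the type \<open>'m\<close>,
  which plays the role of the universe; an arrow is a triple of source, natural transformation and
  target.  If all endomorphism groups of a combinatorial category are finite, a finitely presented
  module is finite dimensional at each object, so every one of them is isomorphic to one with
  elements in \<open>'m\<close> as soon as \<open>'m\<close> is infinite and at least as large as \<open>k\<close>.\<close>

definition cmodule_cat ::
  "('o, 'a) cat \<Rightarrow> ('k, 'r) ring_scheme \<Rightarrow>
     (('o, 'a, 'k, 'm) cmodule,
      ('o, 'a, 'k, 'm) cmodule \<times> ('o \<Rightarrow> 'm \<Rightarrow> 'm) \<times> ('o, 'a, 'k, 'm) cmodule) cat" where
  "cmodule_cat C k = \<lparr>
     Ob = {V. is_cmodule C k V},
     Arr = {(V, \<eta>, W). is_cmodule C k V \<and> is_cmodule C k W \<and> \<eta> \<in> cmodule_homs C k V W},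
     Dom = (\<lambda>(V, \<eta>, W). V),
     Cod = (\<lambda>(V, \<eta>, W). W),
     Ide = (\<lambda>V. (V, \<lambda>x \<in> Ob C. \<lambda>u \<in> carrier (mod_at V x). u, V)),
     Cmp = (\<lambda>(V', \<theta>, W) (V, \<eta>, W').
       (V, \<lambda>x \<in> Ob C. compose (carrier (mod_at V x)) (\<theta> x) (\<eta> x), W))\<rparr>"



section \<open>Finitely presented modules\<close>

text \<open>The free module on a set \<open>S\<close>: finitely supported functions from \<open>S\<close> to \<open>k\<close>, extended by
  zero.\<close>

definition free_module :: "('k, 'r) ring_scheme \<Rightarrow> 'a set \<Rightarrow> ('k, 'a \<Rightarrow> 'k) module" where
  "free_module k S = \<lparr>
     carrier = {v. (\<forall>s \<in> S. v s \<in> carrier k) \<and> (\<forall>s. s \<notin> S \<longrightarrow> v s = \<zero>\<^bsub>k\<^esub>) \<and>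
                   finite {s. v s \<noteq> \<zero>\<^bsub>k\<^esub>}},
     monoid.mult = undefined, one = undefined,
     zero = (\<lambda>_. \<zero>\<^bsub>k\<^esub>),
     add = (\<lambda>u v s. u s \<oplus>\<^bsub>k\<^esub> v s),
     smult = (\<lambda>c v s. c \<otimes>\<^bsub>k\<^esub> v s)\<rparr>"

text \<open>\<open>P(x) = kC(x, -)\<close>, on which \<open>f\<close> acts by linear extension of \<open>g \<mapsto> f \<cdot> g\<close>.  The summation
  ranges over the support of \<open>v\<close> because \<open>finsum\<close> over an infinite set is \<open>0\<close>.\<close>

definition principal_cmodule ::
  "('o, 'a) cat \<Rightarrow> ('k, 'r) ring_scheme \<Rightarrow> 'o \<Rightarrow> ('o, 'a, 'k, 'a \<Rightarrow> 'k) cmodule" where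
  "principal_cmodule C k x = \<lparr>
     mod_at = (\<lambda>y. free_module k (hom_set C x y)),
     act = (\<lambda>f v h. \<Oplus>\<^bsub>k\<^esub>g \<in> {g \<in> hom_set C x (Dom C f). v g \<noteq> \<zero>\<^bsub>k\<^esub> \<and> f \<cdot>\<^bsub>C\<^esub> g = h}. v g)\<rparr>"

definition dsum_module :: "nat \<Rightarrow> (nat \<Rightarrow> ('k, 'm) module) \<Rightarrow> ('k, nat \<Rightarrow> 'm) module" where
  "dsum_module n M = \<lparr>
     carrier = (\<Pi>\<^sub>E i \<in> {..<n}. carrier (M i)),
     monoid.mult = undefined, one = undefined,
     zero = (\<lambda>i \<in> {..<n}. \<zero>\<^bsub>M i\<^esub>),
     add = (\<lambda>u v. \<lambda>i \<in> {..<n}. u i \<oplus>\<^bsub>M i\<^esub> v i),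
     smult = (\<lambda>c u. \<lambda>i \<in> {..<n}. c \<odot>\<^bsub>M i\<^esub> u i)\<rparr>"

definition dsum_cmodule ::
  "nat \<Rightarrow> (nat \<Rightarrow> ('o, 'a, 'k, 'm) cmodule) \<Rightarrow> ('o, 'a, 'k, nat \<Rightarrow> 'm) cmodule" where
  "dsum_cmodule n V = \<lparr>
     mod_at = (\<lambda>x. dsum_module n (\<lambda>i. mod_at (V i) x)),
     act = (\<lambda>f u. \<lambda>i \<in> {..<n}. act (V i) f (u i))\<rparr>"

text \<open>The quotient of a module by a submodule, with cosets as elements.\<close>

definition quotient_module :: "('k, 'm) module \<Rightarrow> 'm set \<Rightarrow> ('k, 'm set) module" where
  "quotient_module M N = \<lparr>
     carrier = a_rcosets\<^bsub>M\<^esub> N,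
     monoid.mult = undefined, one = undefined,
     zero = N,
     add = set_add M,
     smult = (\<lambda>c S. \<Union>u \<in> S. N +>\<^bsub>M\<^esub> (c \<odot>\<^bsub>M\<^esub> u))\<rparr>"

text \<open>The cokernel of \<open>\<phi> : W \<rightarrow> V\<close> is the objectwise quotient of \<open>V\<close> by the image of \<open>\<phi>\<close>, with
  the induced action.\<close>

definition coker_cmodule ::
  "('o, 'a) cat \<Rightarrow> ('o, 'a, 'k, 'n) cmodule \<Rightarrow> ('o, 'a, 'k, 'm) cmodule \<Rightarrow> ('o \<Rightarrow> 'n \<Rightarrow> 'm)
     \<Rightarrow> ('o, 'a, 'k, 'm set) cmodule" where
  "coker_cmodule C W V \<phi> =
     (let im = (\<lambda>x. \<phi> x ` carrier (mod_at W x)) in \<lparr>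
        mod_at = (\<lambda>x. quotient_module (mod_at V x) (im x)),
        act = (\<lambda>f S. \<Union>u \<in> S. im (Cod C f) +>\<^bsub>mod_at V (Cod C f)\<^esub> act V f u)\<rparr>)"

definition finitely_presented ::
  "('o, 'a) cat \<Rightarrow> ('k, 'r) ring_scheme \<Rightarrow> ('o, 'a, 'k, 'm) cmodule \<Rightarrow> bool" where
  "finitely_presented C k V \<longleftrightarrow> is_cmodule C k V \<and>
     (\<exists>m n X Y \<phi>. X \<in> {..<n} \<rightarrow> Ob C \<and> Y \<in> {..<m} \<rightarrow> Ob C \<and>
        (let P = dsum_cmodule n (\<lambda>i. principal_cmodule C k (X i));
             Q = dsum_cmodule m (\<lambda>j. principal_cmodule C k (Y j))
         in \<phi> \<in> cmodule_homs C k Q P \<and> cmodule_isomorphic C k V (coker_cmodule C Q P \<phi>)))"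

definition fp_cmodule_cat ::
  "('o, 'a) cat \<Rightarrow> ('k, 'r) ring_scheme \<Rightarrow>
     (('o, 'a, 'k, 'm) cmodule,
      ('o, 'a, 'k, 'm) cmodule \<times> ('o \<Rightarrow> 'm \<Rightarrow> 'm) \<times> ('o, 'a, 'k, 'm) cmodule) cat" where
  "fp_cmodule_cat C k = full_subcategory (cmodule_cat C k) (finitely_presented C k)"

end

theory Submission
  imports Defs
begin

text \<open>Call a \<open>C\<close>-module \<open>V\<close> tame if it is finite dimensional at each object and there is a finite
  set \<open>A\<close> of objects such that \<open>V(f)\<close> is bijective for every \<open>f : y \<rightarrow> z\<close> for which \<open>y\<close> and \<open>z\<close> lie
  above the same elements of \<open>A\<close>.  Diagram chases show that kernels, cokernels and finite direct
  sums of tame modules are tame.  By the free and transitive right action of \<open>G\<^sub>x\<close>, composition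
  with \<open>f : y \<rightarrow> z\<close> is a bijection \<open>C(x, y) \<rightarrow> C(x, z)\<close> whenever \<open>x \<le> y\<close>, so \<open>P(x)\<close> is tame with
  \<open>A = {x}\<close>; hence finitely presented modules are tame.  Conversely, a tame \<open>V\<close> is generated by its
  finite dimensional values at the finitely many joins of subsets of \<open>A\<close>, so it is a quotient of a
  finite sum of modules \<open>P(x)\<close>; the kernel of this quotient map is again tame, hence finitely
  generated, and \<open>V\<close> is finitely presented.  So the finitely presented modules are closed under
  kernels, cokernels and finite direct sums of all \<open>C\<close>-modules.\<close>

section \<open>Finitely generated vector spaces\<close>

text \<open>The obstacle is that \<open>C\<close>-modules are not locally noetherian: in the
  principal module at the zero sequence, the values at nonzero objects form a submodule that needs a
  generator at each of the infinitely many unit vectors. Finite generation is thus not inherited by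
  kernels, and presentations cannot be chased directly. Tameness is a condition on the values of
  \<open>V\<close> and the maps \<open>V(f)\<close> alone, which diagram chases can handle: two
  finite threshold sets are merged by union, since stability at \<open>A \<union> B\<close> is
  stability at both. Finite joins then turn a threshold set back into finitely many generating
  objects. A second matter is size. All objects of the final category have elements in one type
  \<open>'m\<close>, while cokernels and sums are naturally built from sets and functions.
  Constructions are made in a convenient type and carried back to \<open>'m\<close> by injections:
  coset representatives for cokernels, and an injection of \<open>'m \<times> 'm\<close> into
  \<open>'m\<close>, available as \<open>'m\<close> is infinite, for biproducts.\<close>

lemma linear_mapsI:
  assumes "\<And>u. u \<in> carrier M \<Longrightarrow> h u \<in> carrier N"
    and "\<And>u v. u \<in> carrier M \<Longrightarrow> v \<in> carrier M \<Longrightarrow> h (u \<oplus>\<^bsub>M\<^esub> v) = h u \<oplus>\<^bsub>N\<^esub> h v"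
    and "\<And>c u. c \<in> carrier k \<Longrightarrow> u \<in> carrier M \<Longrightarrow> h (c \<odot>\<^bsub>M\<^esub> u) = c \<odot>\<^bsub>N\<^esub> h u"
  shows "h \<in> linear_maps k M N"
  using assms by (auto simp: linear_maps_def)

lemma linear_mapsD:
  assumes "h \<in> linear_maps k M N"
  shows linear_maps_closed: "u \<in> carrier M \<Longrightarrow> h u \<in> carrier N"
    and linear_maps_add:
      "u \<in> carrier M \<Longrightarrow> v \<in> carrier M \<Longrightarrow> h (u \<oplus>\<^bsub>M\<^esub> v) = h u \<oplus>\<^bsub>N\<^esub> h v"
    and linear_maps_smult:
      "c \<in> carrier k \<Longrightarrow> u \<in> carrier M \<Longrightarrow> h (c \<odot>\<^bsub>M\<^esub> u) = c \<odot>\<^bsub>N\<^esub> h u"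
  using assms by (auto simp: linear_maps_def)

lemma linear_maps_cong:
  assumes "h \<in> linear_maps k M N" "module k M"
    and "\<And>u. u \<in> carrier M \<Longrightarrow> h' u = h u"
  shows "h' \<in> linear_maps k M N"
proof -
  interpret module k M by fact
  show ?thesis using assms by (auto simp: linear_maps_def)
qed

lemma linear_maps_compose:
  assumes "h \<in> linear_maps k M N" "g \<in> linear_maps k N P"
  shows "(\<lambda>u. g (h u)) \<in> linear_maps k M P"
  using assms by (auto simp: linear_maps_def Pi_iff)

locale module_hom = M: module k M + N: module k N
  for k :: "('k, 'r) ring_scheme" and M :: "('k, 'm) module" and N :: "('k, 'n) module"
    and h :: "'m \<Rightarrow> 'n" +
  assumes linear: "h \<in> linear_maps k M N"
begin

lemmas closed [simp] = linear_maps_closed [OF linear]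
lemmas add = linear_maps_add [OF linear]
lemmas smult = linear_maps_smult [OF linear]

lemma zero [simp]: "h \<zero>\<^bsub>M\<^esub> = \<zero>\<^bsub>N\<^esub>"
  using smult [of "\<zero>\<^bsub>k\<^esub>" "\<zero>\<^bsub>M\<^esub>"] by simp

lemma minus: "u \<in> carrier M \<Longrightarrow> h (\<ominus>\<^bsub>M\<^esub> u) = \<ominus>\<^bsub>N\<^esub> h u"
  by (metis M.M.a_inv_closed M.M.r_neg N.M.minus_equality N.M.a_comm add closed zero)

lemma diff: "u \<in> carrier M \<Longrightarrow> v \<in> carrier M \<Longrightarrow> h (u \<ominus>\<^bsub>M\<^esub> v) = h u \<ominus>\<^bsub>N\<^esub> h v"
  by (simp add: a_minus_def add minus)

lemma finsum:
  "finite A \<Longrightarrow> f \<in> A \<rightarrow> carrier M \<Longrightarrow> h (finsum M f A) = (\<Oplus>\<^bsub>N\<^esub>i \<in> A. h (f i))"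
  by (induction rule: finite_induct) (auto simp: add Pi_iff)

lemma preimage_submodule:
  assumes "submodule L k N"
  shows "submodule {u \<in> carrier M. h u \<in> L} k M"
  using N.submoduleE [OF assms] subgroup.one_closed [OF submodule.axioms(1) [OF assms]]
  by (intro M.submoduleI) (auto simp: add smult minus)

lemma kernel_submodule: "submodule {u \<in> carrier M. h u = \<zero>\<^bsub>N\<^esub>} k M"
  by (intro M.submoduleI) (auto simp: add smult minus)

lemma image_submodule:
  assumes "submodule L k M"
  shows "submodule (h ` L) k N"
proof -
  note L = M.submoduleE [OF assms] 
  have "\<zero>\<^bsub>M\<^esub> \<in> L" using subgroup.one_closed [OF submodule.axioms(1) [OF assms]] by simp
  note lin_simps = add [symmetric] smult [symmetric] minus [symmetric]
  show ?thesis
  proof (rule N.submoduleI)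
    show "h ` L \<subseteq> carrier N" using L(1) by auto
    show "\<zero>\<^bsub>N\<^esub> \<in> h ` L" using \<open>\<zero>\<^bsub>M\<^esub> \<in> L\<close> zero by (metis imageI)
    show "\<ominus>\<^bsub>N\<^esub> a \<in> h ` L" if "a \<in> h ` L" for a
      using that L(1,3) by (auto simp: lin_simps subset_iff)
    show "a \<oplus>\<^bsub>N\<^esub> b \<in> h ` L" if "a \<in> h ` L" "b \<in> h ` L" for a b
      using that L(1,5) by (auto simp: lin_simps subset_iff)
    show "c \<odot>\<^bsub>N\<^esub> a \<in> h ` L" if "c \<in> carrier k" "a \<in> h ` L" for c a
      using that L(1,4) by (auto simp: lin_simps subset_iff)
  qed
qed

lemma inj_on_iff: "inj_on h (carrier M) \<longleftrightarrow> (\<forall>u \<in> carrier M. h u = \<zero>\<^bsub>N\<^esub> \<longrightarrow> u = \<zero>\<^bsub>M\<^esub>)"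
proof
  assume "inj_on h (carrier M)"
  then show "\<forall>u \<in> carrier M. h u = \<zero>\<^bsub>N\<^esub> \<longrightarrow> u = \<zero>\<^bsub>M\<^esub>"
    using zero by (metis M.M.zero_closed inj_onD)
next
  assume *: "\<forall>u \<in> carrier M. h u = \<zero>\<^bsub>N\<^esub> \<longrightarrow> u = \<zero>\<^bsub>M\<^esub>"
  show "inj_on h (carrier M)"
  proof (rule inj_onI)
    fix u v assume "u \<in> carrier M" "v \<in> carrier M" "h u = h v"
    then have "h (u \<ominus>\<^bsub>M\<^esub> v) = \<zero>\<^bsub>N\<^esub>" "u \<ominus>\<^bsub>M\<^esub> v \<in> carrier M"
      by (auto simp: diff) (simp add: a_minus_def N.M.r_neg)
    with * have "u \<oplus>\<^bsub>M\<^esub> \<ominus>\<^bsub>M\<^esub> v = \<zero>\<^bsub>M\<^esub>" by (simp add: a_minus_def)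
    then show "u = v" using \<open>u \<in> carrier M\<close> \<open>v \<in> carrier M\<close>
      by (metis M.M.a_inv_closed M.M.minus_equality M.M.minus_minus)
  qed
qed

end

text \<open>Every module axiom for \<open>N\<close> is an identity between images of elements of
  \<open>M\<close>. As \<open>N\<close> is not yet known to be a module, preservation of zero cannot
  be deduced from linearity and has to be assumed. The lemma serves structures given only as
  records, such as quotients and relabelled copies.\<close>

lemma module_image:
  assumes "module k M" and lin: "h \<in> linear_maps k M N"
    and surj: "h ` carrier M = carrier N" and zero: "h \<zero>\<^bsub>M\<^esub> = \<zero>\<^bsub>N\<^esub>"
  shows "module k N"
proof -
  interpret M: module k M by fact
  note lin_simps = linear_maps_add [OF lin, symmetric] linear_maps_smult [OF lin, symmetric]
  show ?thesis
  proof (intro moduleI abelian_groupI M.R.cring_axioms)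
    show "\<zero>\<^bsub>N\<^esub> \<in> carrier N" using surj zero M.M.zero_closed by (metis imageI)
    show "\<exists>y\<in>carrier N. y \<oplus>\<^bsub>N\<^esub> x = \<zero>\<^bsub>N\<^esub>" if x: "x \<in> carrier N" for x
    proof -
      obtain u where "u \<in> carrier M" "x = h u" using x surj by blast
      then have "h (\<ominus>\<^bsub>M\<^esub> u) \<oplus>\<^bsub>N\<^esub> x = \<zero>\<^bsub>N\<^esub>" "h (\<ominus>\<^bsub>M\<^esub> u) \<in> carrier N"
        using zero linear_maps_closed [OF lin] by (auto simp: lin_simps M.M.l_neg)
      then show ?thesis by blast
    qed
    show "\<zero>\<^bsub>N\<^esub> \<oplus>\<^bsub>N\<^esub> x = x" if "x \<in> carrier N" for x
      using that M.M.zero_closed by (auto simp: surj [symmetric] zero [symmetric] lin_simps)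
    show "x \<oplus>\<^bsub>N\<^esub> y = y \<oplus>\<^bsub>N\<^esub> x" if "x \<in> carrier N" "y \<in> carrier N" for x y
      using that by (auto simp: surj [symmetric] lin_simps M.M.a_comm)
  qed (auto simp: surj [symmetric] lin_simps M.M.a_assoc M.smult_l_distr M.smult_r_distr
      M.smult_assoc1)
qed

section \<open>Spans and finite generation\<close>

definition span :: "('k, 'r) ring_scheme \<Rightarrow> ('k, 'm, 'z) module_scheme \<Rightarrow> 'm set \<Rightarrow> 'm set" where
  "span k M B = \<Inter>{N. submodule N k M \<and> B \<subseteq> N}"

text \<open>The inclusion \<open>B \<subseteq> carrier M\<close> excludes a degenerate case: if it
  fails, no submodule contains \<open>B\<close>, and \<open>span\<close> is the intersection of the
  empty family, that is, \<open>UNIV\<close>.\<close>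

definition fin_gen :: "('k, 'r) ring_scheme \<Rightarrow> ('k, 'm, 'z) module_scheme \<Rightarrow> bool" where
  "fin_gen k M \<longleftrightarrow> (\<exists>B. finite B \<and> B \<subseteq> carrier M \<and> carrier M \<subseteq> span k M B)"

lemma fin_genE:
  assumes "fin_gen k M"
  obtains B where "finite B" "B \<subseteq> carrier M" "carrier M \<subseteq> span k M B"
  using assms unfolding fin_gen_def by blast

context module
begin

lemma span_submodule:
  assumes "B \<subseteq> carrier M"
  shows "submodule (span R M B) R M"
proof -
  have "\<zero>\<^bsub>M\<^esub> \<in> N" if "submodule N R M" for N
    using subgroup.one_closed [OF submodule.axioms(1) [OF that]] by simp
  moreover have "carrier M \<in> {N. submodule N R M \<and> B \<subseteq> N}"
    using carrier_is_submodule assms by simp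
  ultimately show ?thesis
    by (intro submoduleI) (auto simp: span_def intro: submoduleE(3-5))
qed

lemma span_superset: "B \<subseteq> span R M B"
  by (auto simp: span_def)

lemma span_minimal: "submodule N R M \<Longrightarrow> B \<subseteq> N \<Longrightarrow> span R M B \<subseteq> N"
  by (auto simp: span_def)

lemma submodule_zero: "submodule N R M \<Longrightarrow> \<zero>\<^bsub>M\<^esub> \<in> N"
  using subgroup.one_closed [OF submodule.axioms(1)] by fastforce

lemma submodule_diff:
  "submodule N R M \<Longrightarrow> u \<in> N \<Longrightarrow> v \<in> N \<Longrightarrow> u \<ominus>\<^bsub>M\<^esub> v \<in> N"
  by (simp add: a_minus_def submoduleE)

lemma span_mono:
  assumes "B \<subseteq> B'" shows "span R M B \<subseteq> span R M B'"
  using assms by (auto simp: span_def)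

text \<open>The elements \<open>c \<odot> b \<oplus> t\<close> with \<open>t\<close> in the span of
  \<open>B\<close> form a submodule containing \<open>insert b B\<close>, so minimality of the span
  puts \<open>x\<close> among them.\<close>

lemma span_insert:
  assumes b: "b \<in> carrier M" and B: "B \<subseteq> carrier M" and x: "x \<in> span R M (insert b B)"
  obtains c t where "c \<in> carrier R" "t \<in> span R M B" "x = c \<odot>\<^bsub>M\<^esub> b \<oplus>\<^bsub>M\<^esub> t"
proof -
  let ?L = "span R M B"
  let ?N = "{c \<odot>\<^bsub>M\<^esub> b \<oplus>\<^bsub>M\<^esub> t | c t. c \<in> carrier R \<and> t \<in> ?L}"
  have L: "submodule ?L R M" using span_submodule B .
  note L' = submoduleE [OF L]
  have Lc: "t \<in> carrier M" if "t \<in> ?L" for t using that L'(1) by blast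
  have "submodule ?N R M"
  proof (rule submoduleI)
    show "?N \<subseteq> carrier M" using b Lc by auto
    show "\<zero>\<^bsub>M\<^esub> \<in> ?N"
      using b submodule_zero [OF L] by (intro CollectI exI [of _ \<zero>] exI [of _ "\<zero>\<^bsub>M\<^esub>"]) auto
  next
    fix a assume "a \<in> ?N"
    then obtain c t where "c \<in> carrier R" "t \<in> ?L" "a = c \<odot>\<^bsub>M\<^esub> b \<oplus>\<^bsub>M\<^esub> t" by blast
    then show "\<ominus>\<^bsub>M\<^esub> a \<in> ?N"
      using b Lc L'(3)
      by (intro CollectI exI [of _ "\<ominus> c"] exI [of _ "\<ominus>\<^bsub>M\<^esub> t"])
         (auto simp: smult_l_minus M.minus_add)
  next
    fix a a' assume "a \<in> ?N" "a' \<in> ?N"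
    then obtain c t c' t' where *: "c \<in> carrier R" "t \<in> ?L" "a = c \<odot>\<^bsub>M\<^esub> b \<oplus>\<^bsub>M\<^esub> t"
      "c' \<in> carrier R" "t' \<in> ?L" "a' = c' \<odot>\<^bsub>M\<^esub> b \<oplus>\<^bsub>M\<^esub> t'" by blast
    then have "a \<oplus>\<^bsub>M\<^esub> a' = (c \<oplus> c') \<odot>\<^bsub>M\<^esub> b \<oplus>\<^bsub>M\<^esub> (t \<oplus>\<^bsub>M\<^esub> t')"
      using b Lc by (simp add: smult_l_distr M.a_ac)
    then show "a \<oplus>\<^bsub>M\<^esub> a' \<in> ?N" using * L'(5) by blast
  next
    fix c' a assume c': "c' \<in> carrier R" "a \<in> ?N"
    then obtain c t where *: "c \<in> carrier R" "t \<in> ?L" "a = c \<odot>\<^bsub>M\<^esub> b \<oplus>\<^bsub>M\<^esub> t" by blast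
    then have "c' \<odot>\<^bsub>M\<^esub> a = (c' \<otimes> c) \<odot>\<^bsub>M\<^esub> b \<oplus>\<^bsub>M\<^esub> c' \<odot>\<^bsub>M\<^esub> t"
      using b c' Lc by (simp add: smult_assoc1 smult_r_distr)
    then show "c' \<odot>\<^bsub>M\<^esub> a \<in> ?N" using * c' L'(4) by blast
  qed
  moreover have "insert b B \<subseteq> ?N"
  proof
    fix y assume "y \<in> insert b B"
    then show "y \<in> ?N"
    proof
      assume "y = b"
      then show ?thesis using b submodule_zero [OF L]
        by (intro CollectI exI [of _ \<one>] exI [of _ "\<zero>\<^bsub>M\<^esub>"]) auto
    next
      assume "y \<in> B"
      then show ?thesis using b B span_superset
        by (intro CollectI exI [of _ \<zero>] exI [of _ y]) auto
    qed
  qed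
  ultimately have "x \<in> ?N" using span_minimal x by blast
  then show thesis using that by blast
qed

text \<open>Subspaces of finite dimensional spaces are finite dimensional. Induction on
  \<open>B\<close>: \<open>N \<inter> span R M B\<close> is finitely generated by the induction
  hypothesis. If \<open>N\<close> is not contained in \<open>span R M B\<close>, one further vector
  \<open>w \<in> N\<close> suffices, because its coefficient \<open>c\<close> at \<open>b\<close> is
  nonzero and hence invertible in the field.\<close>

lemma submodule_fin_gen:
  assumes "field R" "finite B" "B \<subseteq> carrier M" "submodule N R M" "N \<subseteq> span R M B"
  shows "\<exists>B'. finite B' \<and> B' \<subseteq> N \<and> N \<subseteq> span R M B'"
  using assms(2-)
proof (induction B arbitrary: N rule: finite_induct)
  case empty
  then show ?case by blast
next
  case (insert b B)
  interpret F: field R by fact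
  let ?L = "span R M B"
  have b: "b \<in> carrier M" and B: "B \<subseteq> carrier M" using insert.prems by auto
  have L: "submodule ?L R M" using span_submodule B .
  note L' = submoduleE [OF L] and N' = submoduleE [OF insert.prems(2)]
  have Lc: "t \<in> carrier M" if "t \<in> ?L" for t using that L'(1) by blast
  have Nc: "t \<in> carrier M" if "t \<in> N" for t using that N'(1) by blast
  have "submodule (N \<inter> ?L) R M"
    using L' N' submodule_zero [OF L] submodule_zero [OF insert.prems(2)]
    by (intro submoduleI) auto
  then obtain B' where B': "finite B'" "B' \<subseteq> N \<inter> ?L" "N \<inter> ?L \<subseteq> span R M B'"
    using insert.IH [of "N \<inter> ?L"] B by blast
  show ?case
  proof (cases "N \<subseteq> ?L")
    case True
    then show ?thesis using B' by blast
  next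
    case False
    then obtain w where w: "w \<in> N" "w \<notin> ?L" by blast
    then obtain c t where c: "c \<in> carrier R" "t \<in> ?L" "w = c \<odot>\<^bsub>M\<^esub> b \<oplus>\<^bsub>M\<^esub> t"
      using span_insert [OF b B] insert.prems(3) by blast
    have "c \<noteq> \<zero>" using w c b Lc by auto
    then have unit: "inv c \<in> carrier R" "inv c \<otimes> c = \<one>"
      using c F.field_Units by auto
    let ?S = "span R M (insert w B')"
    have S: "submodule ?S R M" using w B' Nc by (intro span_submodule) auto
    note S' = submoduleE [OF S]
    have "v \<in> ?S" if v: "v \<in> N" for v
    proof -
      obtain d s where d: "d \<in> carrier R" "s \<in> ?L" "v = d \<odot>\<^bsub>M\<^esub> b \<oplus>\<^bsub>M\<^esub> s"
        using span_insert [OF b B] insert.prems(3) v by blast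
      \<comment> \<open>The multiple of \<open>w\<close> by \<open>e\<close> has the same
        coefficient at \<open>b\<close> as \<open>v\<close>, so subtracting it from \<open>v\<close>
        leaves an element of \<open>N \<inter> ?L\<close>.\<close>
      define e where "e = d \<otimes> inv c"
      have e: "e \<in> carrier R" "e \<otimes> c = d"
        using d unit c by (auto simp: e_def R.m_assoc)
      have ew: "e \<odot>\<^bsub>M\<^esub> w = d \<odot>\<^bsub>M\<^esub> b \<oplus>\<^bsub>M\<^esub> e \<odot>\<^bsub>M\<^esub> t"
        using e c b Lc by (simp add: smult_r_distr smult_assoc1 [symmetric])
      have "v \<ominus>\<^bsub>M\<^esub> e \<odot>\<^bsub>M\<^esub> w = s \<ominus>\<^bsub>M\<^esub> e \<odot>\<^bsub>M\<^esub> t"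
      proof -
        have *: "d \<odot>\<^bsub>M\<^esub> b \<in> carrier M" "s \<in> carrier M" "e \<odot>\<^bsub>M\<^esub> t \<in> carrier M"
          using d e c b Lc by auto
        then show ?thesis
          unfolding ew d(3) a_minus_def by (simp add: M.minus_add M.a_ac M.r_neg2)
      qed
      then have "v \<ominus>\<^bsub>M\<^esub> e \<odot>\<^bsub>M\<^esub> w \<in> N \<inter> ?L"
        using submodule_diff [OF L, of s "e \<odot>\<^bsub>M\<^esub> t"]
          submodule_diff [OF insert.prems(2), of v "e \<odot>\<^bsub>M\<^esub> w"] d c e v w N'(4) L'(4) by simp
      then have "v \<ominus>\<^bsub>M\<^esub> e \<odot>\<^bsub>M\<^esub> w \<in> ?S"
        using B' span_mono [of B' "insert w B'"] by blast
      moreover have "e \<odot>\<^bsub>M\<^esub> w \<in> ?S" using S'(4) e span_superset by blast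
      ultimately have "(v \<ominus>\<^bsub>M\<^esub> e \<odot>\<^bsub>M\<^esub> w) \<oplus>\<^bsub>M\<^esub> e \<odot>\<^bsub>M\<^esub> w \<in> ?S" using S'(5) by blast
      then show ?thesis using v w e Nc by (simp add: a_minus_def M.a_assoc M.l_neg)
    qed
    then show ?thesis using B' w by (intro exI [of _ "insert w B'"]) auto
  qed
qed

end

context module_hom
begin

lemma fin_gen_surj:
  assumes "fin_gen k M" "h ` carrier M = carrier N"
  shows "fin_gen k N"
proof -
  obtain B where B: "finite B" "B \<subseteq> carrier M" "carrier M \<subseteq> span k M B"
    using assms(1) by (rule fin_genE)
  have "carrier N \<subseteq> L" if L: "submodule L k N" "h ` B \<subseteq> L" for L
  proof -
    have "span k M B \<subseteq> {u \<in> carrier M. h u \<in> L}"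
      using L(2) B(2) by (intro M.span_minimal [OF preimage_submodule [OF L(1)]]) auto
    with B(3) have "h ` carrier M \<subseteq> L" by auto
    then show ?thesis using assms(2) by simp
  qed
  then have "carrier N \<subseteq> span k N (h ` B)" by (auto simp: span_def)
  then show ?thesis using B unfolding fin_gen_def by (intro exI [of _ "h ` B"]) auto
qed

text \<open>The image of \<open>h\<close> is a subspace of \<open>N\<close>, hence finitely
  generated over the field; its generators are pulled back to a finite set \<open>D\<close>, and
  injectivity makes \<open>D\<close> generate \<open>M\<close>.\<close>

lemma fin_gen_inj:
  assumes "field k" "fin_gen k N" "inj_on h (carrier M)"
  shows "fin_gen k M"
proof -
  obtain B where B: "finite B" "B \<subseteq> carrier N" "carrier N \<subseteq> span k N B"
    using assms(2) by (rule fin_genE)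
  have sub: "submodule (h ` carrier M) k N" by (rule image_submodule [OF M.carrier_is_submodule])
  have "h ` carrier M \<subseteq> span k N B" using B(3) by auto
  from N.submodule_fin_gen [OF assms(1) B(1,2) sub this]
  obtain B' where B': "finite B'" "B' \<subseteq> h ` carrier M" "h ` carrier M \<subseteq> span k N B'" by blast
  then obtain D where D: "D \<subseteq> carrier M" "finite D" "B' = h ` D"
    using finite_subset_image by metis
  have "carrier M \<subseteq> L" if L: "submodule L k M" "D \<subseteq> L" for L
  proof
    fix u assume u: "u \<in> carrier M"
    have "span k N B' \<subseteq> h ` L"
      using D(3) L(2) by (intro N.span_minimal [OF image_submodule [OF L(1)]]) auto
    then have "h u \<in> h ` L" using B'(3) u by blast
    then show "u \<in> L"
      using inj_on_image_mem_iff [OF assms(3) u M.submoduleE(1) [OF L(1)]] by simp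
  qed
  then have "carrier M \<subseteq> span k M D" by (auto simp: span_def)
  then show ?thesis using D unfolding fin_gen_def by blast
qed

end


section \<open>Natural transformations of \<open>C\<close>-modules\<close>

text \<open>These are the conditions of \<open>cmodule_homs\<close> without extensionality, so that
  composites, sums and zero maps can be written as plain functions; \<open>trim\<close> restores
  extensionality when an actual arrow is wanted.\<close>

definition natural ::
  "('o, 'a) cat \<Rightarrow> ('k, 'r) ring_scheme \<Rightarrow> ('o, 'a, 'k, 'm) cmodule \<Rightarrow> ('o, 'a, 'k, 'n) cmodule
     \<Rightarrow> ('o \<Rightarrow> 'm \<Rightarrow> 'n) \<Rightarrow> bool" where
  "natural C k V W \<eta> \<longleftrightarrow>
     (\<forall>x \<in> Ob C. \<eta> x \<in> linear_maps k (mod_at V x) (mod_at W x)) \<and>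
     (\<forall>f \<in> Arr C. \<forall>u \<in> carrier (mod_at V (Dom C f)).
        \<eta> (Cod C f) (act V f u) = act W f (\<eta> (Dom C f) u))"

definition trim :: "('o, 'a) cat \<Rightarrow> ('o, 'a, 'k, 'm) cmodule \<Rightarrow> ('o \<Rightarrow> 'm \<Rightarrow> 'n) \<Rightarrow> 'o \<Rightarrow> 'm \<Rightarrow> 'n"
  where "trim C V \<eta> = (\<lambda>x \<in> Ob C. \<lambda>u \<in> carrier (mod_at V x). \<eta> x u)"

lemma trim_apply [simp]:
  "x \<in> Ob C \<Longrightarrow> u \<in> carrier (mod_at V x) \<Longrightarrow> trim C V \<eta> x u = \<eta> x u"
  by (simp add: trim_def)

lemma cmodule_homs_eqI:
  assumes "\<eta> \<in> cmodule_homs C k V W" "\<theta> \<in> cmodule_homs C k V W'"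
    and "\<And>x u. x \<in> Ob C \<Longrightarrow> u \<in> carrier (mod_at V x) \<Longrightarrow> \<eta> x u = \<theta> x u"
  shows "\<eta> = \<theta>"
proof (rule extensionalityI)
  show "\<eta> \<in> extensional (Ob C)" "\<theta> \<in> extensional (Ob C)"
    using assms(1,2) by (auto simp: cmodule_homs_def PiE_def)
  fix x assume x: "x \<in> Ob C"
  show "\<eta> x = \<theta> x"
    using assms(1,2) x by (intro extensionalityI [of _ "carrier (mod_at V x)"] assms(3))
      (auto simp: cmodule_homs_def PiE_def Pi_def)
qed

lemma cmodule_homs_natural: "\<eta> \<in> cmodule_homs C k V W \<Longrightarrow> natural C k V W \<eta>"
  by (auto simp: cmodule_homs_def natural_def)

locale cmods = category C + k: field k
  for C :: "('o, 'a) cat" (structure) and k :: "('k, 'r) ring_scheme"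
begin

lemma Dom_Ob [simp, intro]: "f \<in> Arr C \<Longrightarrow> Dom C f \<in> Ob C"
  and Cod_Ob [simp, intro]: "f \<in> Arr C \<Longrightarrow> Cod C f \<in> Ob C"
  by (auto intro: Dom_in_Ob Cod_in_Ob)

lemma Ide_arr [simp]: "x \<in> Ob C \<Longrightarrow> Ide C x \<in> Arr C"
  and Dom_Ide [simp]: "x \<in> Ob C \<Longrightarrow> Dom C (Ide C x) = x"
  and Cod_Ide [simp]: "x \<in> Ob C \<Longrightarrow> Cod C (Ide C x) = x"
  using Ide_in_hom by (auto simp: hom_set_def)

lemma Cmp_arr [simp]:
  assumes "f \<in> Arr C" "g \<in> Arr C" "Cod C f = Dom C g"
  shows "g \<cdot> f \<in> Arr C" "Dom C (g \<cdot> f) = Dom C f" "Cod C (g \<cdot> f) = Cod C g"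
  using Cmp_in_hom [of f "Dom C f" "Cod C f" g "Cod C g"] assms by (auto simp: hom_set_def)

lemma module_at: "is_cmodule C k V \<Longrightarrow> x \<in> Ob C \<Longrightarrow> module k (mod_at V x)"
  by (auto simp: is_cmodule_def)

lemma act_hom:
  assumes "is_cmodule C k V" "f \<in> Arr C"
  shows "module_hom k (mod_at V (Dom C f)) (mod_at V (Cod C f)) (act V f)"
  using assms by (auto simp: is_cmodule_def module_hom_def module_hom_axioms_def)

lemma act_closed:
  assumes "is_cmodule C k V" "f \<in> Arr C" "u \<in> carrier (mod_at V (Dom C f))"
  shows "act V f u \<in> carrier (mod_at V (Cod C f))"
proof -
  interpret module_hom k "mod_at V (Dom C f)" "mod_at V (Cod C f)" "act V f"
    by (rule act_hom) fact+
  show ?thesis using assms by simp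
qed

lemma act_Ide:
  "is_cmodule C k V \<Longrightarrow> x \<in> Ob C \<Longrightarrow> u \<in> carrier (mod_at V x) \<Longrightarrow> act V (Ide C x) u = u"
  by (auto simp: is_cmodule_def)

lemma act_Cmp:
  "is_cmodule C k V \<Longrightarrow> f \<in> Arr C \<Longrightarrow> g \<in> Arr C \<Longrightarrow> Cod C f = Dom C g \<Longrightarrow>
   u \<in> carrier (mod_at V (Dom C f)) \<Longrightarrow> act V (g \<cdot> f) u = act V g (act V f u)"
  by (auto simp: is_cmodule_def)

lemma natural_cong:
  assumes V: "is_cmodule C k V" and nat: "natural C k V W \<eta>"
    and eq: "\<And>x u. x \<in> Ob C \<Longrightarrow> u \<in> carrier (mod_at V x) \<Longrightarrow> \<theta> x u = \<eta> x u"
  shows "natural C k V W \<theta>"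
  using nat by (auto simp: natural_def eq act_closed [OF V] module_at [OF V]
      intro: linear_maps_cong)

lemma trim_in_homs:
  assumes V: "is_cmodule C k V" and nat: "natural C k V W \<eta>"
  shows "trim C V \<eta> \<in> cmodule_homs C k V W"
proof -
  have "natural C k V W (trim C V \<eta>)"
    by (rule natural_cong [OF assms]) simp
  then show ?thesis
    by (auto simp: cmodule_homs_def natural_def PiE_def Pi_def) (auto simp: trim_def)
qed

text \<open>The counterpart of \<open>module_image\<close> for functors: a record \<open>W\<close>
  onto which a module maps compatibly with all operations is itself a module, since each law can be
  checked on preimages. It is applied to cokernels and to relabelled modules.\<close>

lemma is_cmodule_image:
  assumes V: "is_cmodule C k V"
    and lin: "\<And>x. x \<in> Ob C \<Longrightarrow> \<eta> x \<in> linear_maps k (mod_at V x) (mod_at W x)"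
    and surj: "\<And>x. x \<in> Ob C \<Longrightarrow> \<eta> x ` carrier (mod_at V x) = carrier (mod_at W x)"
    and zero: "\<And>x. x \<in> Ob C \<Longrightarrow> \<eta> x \<zero>\<^bsub>mod_at V x\<^esub> = \<zero>\<^bsub>mod_at W x\<^esub>"
    and act: "\<And>f u. f \<in> Arr C \<Longrightarrow> u \<in> carrier (mod_at V (Dom C f)) \<Longrightarrow>
      act W f (\<eta> (Dom C f) u) = \<eta> (Cod C f) (act V f u)"
  shows "is_cmodule C k W"
  unfolding is_cmodule_def
proof (intro conjI ballI impI)
  fix x assume x: "x \<in> Ob C"
  show "module k (mod_at W x)"
    by (rule module_image [OF module_at [OF V x] lin surj zero]) (fact x)+
  show "act W (Ide C x) u = u" if "u \<in> carrier (mod_at W x)" for u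
    using that act [of "Ide C x"] x by (auto simp: act_Ide [OF V] simp flip: surj [OF x])
next
  fix f assume f: "f \<in> Arr C"
  interpret module_hom k "mod_at V (Dom C f)" "mod_at V (Cod C f)" "act V f"
    by (rule act_hom) fact+
  note D = lin [of "Dom C f"] and C = lin [of "Cod C f"]
  note D_simps = linear_maps_add [OF D, symmetric] linear_maps_smult [OF D, symmetric]
  show "act W f \<in> linear_maps k (mod_at W (Dom C f)) (mod_at W (Cod C f))"
    using f
    by (intro linear_mapsI)
       (auto simp: act D_simps add smult linear_maps_add [OF C] linear_maps_smult [OF C]
          simp flip: surj [of "Dom C f"] surj [of "Cod C f"])
  fix g u assume g: "g \<in> Arr C" "Cod C f = Dom C g" and u: "u \<in> carrier (mod_at W (Dom C f))"
  then obtain v where v: "v \<in> carrier (mod_at V (Dom C f))" "u = \<eta> (Dom C f) v"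
    using surj [of "Dom C f"] f by auto
  then show "act W (g \<cdot> f) u = act W g (act W f u)"
    using act [of f v] act [of "g \<cdot> f" v] act [of g "act V f v"] f g act_closed [OF V f]
    by (simp add: act_Cmp [OF V])
qed

end

text \<open>Source and target may have different element types: principal modules consist of
  functions, sums of families and cokernels of cosets, and maps between these and modules over
  \<open>'m\<close> are needed throughout.\<close>

locale cmap = cmods C k
  for C :: "('o, 'a) cat" (structure) and k :: "('k, 'r) ring_scheme"
    and V :: "('o, 'a, 'k, 'm) cmodule" and W :: "('o, 'a, 'k, 'n) cmodule"
    and \<eta> :: "'o \<Rightarrow> 'm \<Rightarrow> 'n" +
  assumes source: "is_cmodule C k V" and target: "is_cmodule C k W"
    and nat: "natural C k V W \<eta>"
begin

lemma hom_at: "x \<in> Ob C \<Longrightarrow> module_hom k (mod_at V x) (mod_at W x) (\<eta> x)"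
  using source target nat by (auto simp: is_cmodule_def module_hom_def module_hom_axioms_def natural_def)

lemma closed: "x \<in> Ob C \<Longrightarrow> u \<in> carrier (mod_at V x) \<Longrightarrow> \<eta> x u \<in> carrier (mod_at W x)"
  by (rule module_hom.closed [OF hom_at])

lemma naturality: "f \<in> Arr C \<Longrightarrow> u \<in> carrier (mod_at V (Dom C f)) \<Longrightarrow>
   \<eta> (Cod C f) (act V f u) = act W f (\<eta> (Dom C f) u)"
  using nat by (auto simp: natural_def)

lemma zero_at: "x \<in> Ob C \<Longrightarrow> \<eta> x \<zero>\<^bsub>mod_at V x\<^esub> = \<zero>\<^bsub>mod_at W x\<^esub>"
  by (rule module_hom.zero [OF hom_at])

text \<open>Only the carriers shrink, so the elements remain in the type of \<open>V\<close> and the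
  inclusion is the identity function.\<close>

definition kernel_cmodule :: "('o, 'a, 'k, 'm) cmodule" where
  "kernel_cmodule = V\<lparr>mod_at :=
     (\<lambda>x. (mod_at V x)\<lparr>carrier := {u \<in> carrier (mod_at V x). \<eta> x u = \<zero>\<^bsub>mod_at W x\<^esub>}\<rparr>)\<rparr>"

lemma kernel_cmodule: "cmap C k kernel_cmodule V (\<lambda>x u. u)"
proof (unfold_locales)
  show "is_cmodule C k kernel_cmodule"
    unfolding is_cmodule_def
  proof (intro conjI ballI impI)
    fix x assume x: "x \<in> Ob C"
    interpret module_hom k "mod_at V x" "mod_at W x" "\<eta> x" by (rule hom_at [OF x])
    show "module k (mod_at kernel_cmodule x)"
      unfolding kernel_cmodule_def
      using submodule.submodule_is_module [OF kernel_submodule M.module_axioms] by simp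
    show "act kernel_cmodule (Ide C x) u = u" if "u \<in> carrier (mod_at kernel_cmodule x)" for u
      using that x by (auto simp: kernel_cmodule_def act_Ide [OF source])
  next
    fix f assume f: "f \<in> Arr C"
    interpret A: module_hom k "mod_at V (Dom C f)" "mod_at V (Cod C f)" "act V f"
      by (rule act_hom [OF source f])
    interpret B: module_hom k "mod_at W (Dom C f)" "mod_at W (Cod C f)" "act W f"
      by (rule act_hom [OF target f])
    show "act kernel_cmodule f
        \<in> linear_maps k (mod_at kernel_cmodule (Dom C f)) (mod_at kernel_cmodule (Cod C f))"
      using f by (intro linear_mapsI) (auto simp: kernel_cmodule_def A.add A.smult naturality)
    fix g u assume "g \<in> Arr C" "Cod C f = Dom C g"
      "u \<in> carrier (mod_at kernel_cmodule (Dom C f))"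
    then show "act kernel_cmodule (g \<cdot> f) u = act kernel_cmodule g (act kernel_cmodule f u)"
      using f by (auto simp: kernel_cmodule_def act_Cmp [OF source])
  qed
qed (auto simp: source natural_def kernel_cmodule_def linear_maps_def)

lemma kernel_carrier:
  "carrier (mod_at kernel_cmodule x) = {u \<in> carrier (mod_at V x). \<eta> x u = \<zero>\<^bsub>mod_at W x\<^esub>}"
  by (simp add: kernel_cmodule_def)

end

section \<open>Operations on natural transformations, factorization and transport of
  structure\<close>

context cmods
begin

lemma cmap_compose:
  assumes "cmap C k V W \<eta>" "cmap C k W X \<theta>"
  shows "cmap C k V X (\<lambda>x u. \<theta> x (\<eta> x u))"
proof -
  interpret f: cmap C k V W \<eta> by fact
  interpret g: cmap C k W X \<theta> by fact
  show ?thesis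
    using f.nat g.nat
    by unfold_locales
       (auto simp: f.source g.target natural_def f.closed intro: linear_maps_compose)
qed

lemma cmap_id: "is_cmodule C k V \<Longrightarrow> cmap C k V V (\<lambda>x u. u)"
  by unfold_locales (auto simp: natural_def linear_maps_def)

lemma cmap_zero:
  assumes V: "is_cmodule C k V" and W: "is_cmodule C k W"
  shows "cmap C k V W (\<lambda>x u. \<zero>\<^bsub>mod_at W x\<^esub>)"
proof (unfold_locales, fact V, fact W, unfold natural_def, intro conjI ballI)
  fix x assume "x \<in> Ob C"
  then interpret N: module k "mod_at W x" by (rule module_at [OF W])
  show "(\<lambda>u. \<zero>\<^bsub>mod_at W x\<^esub>) \<in> linear_maps k (mod_at V x) (mod_at W x)"
    by (intro linear_mapsI) auto
next
  fix f assume "f \<in> Arr C"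
  then show "\<zero>\<^bsub>mod_at W (Cod C f)\<^esub> = act W f \<zero>\<^bsub>mod_at W (Dom C f)\<^esub>"
    using module_hom.zero [OF act_hom [OF W]] by simp
qed

lemma cmap_add:
  assumes "cmap C k V W \<eta>" "cmap C k V W \<theta>"
  shows "cmap C k V W (\<lambda>x u. \<eta> x u \<oplus>\<^bsub>mod_at W x\<^esub> \<theta> x u)"
proof -
  interpret f: cmap C k V W \<eta> by fact
  interpret g: cmap C k V W \<theta> by fact
  show ?thesis
  proof (unfold_locales, rule f.source, rule f.target, unfold natural_def, intro conjI ballI)
    fix x assume x: "x \<in> Ob C"
    interpret fx: module_hom k "mod_at V x" "mod_at W x" "\<eta> x" by (rule f.hom_at [OF x])
    interpret gx: module_hom k "mod_at V x" "mod_at W x" "\<theta> x" by (rule g.hom_at [OF x])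
    show "(\<lambda>u. \<eta> x u \<oplus>\<^bsub>mod_at W x\<^esub> \<theta> x u) \<in> linear_maps k (mod_at V x) (mod_at W x)"
      by (intro linear_mapsI)
         (auto simp: fx.add gx.add fx.smult gx.smult fx.N.M.a_ac fx.N.smult_r_distr)
  next
    fix h u assume h: "h \<in> Arr C" "u \<in> carrier (mod_at V (Dom C h))"
    interpret A: module_hom k "mod_at W (Dom C h)" "mod_at W (Cod C h)" "act W h"
      by (rule act_hom [OF f.target h(1)])
    show "\<eta> (Cod C h) (act V h u) \<oplus>\<^bsub>mod_at W (Cod C h)\<^esub> \<theta> (Cod C h) (act V h u) =
        act W h (\<eta> (Dom C h) u \<oplus>\<^bsub>mod_at W (Dom C h)\<^esub> \<theta> (Dom C h) u)"
      using h by (simp add: f.naturality g.naturality A.add f.closed g.closed)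
  qed
qed

lemma cmap_minus:
  assumes "cmap C k V W \<eta>"
  shows "cmap C k V W (\<lambda>x u. \<ominus>\<^bsub>mod_at W x\<^esub> \<eta> x u)"
proof -
  interpret f: cmap C k V W \<eta> by fact
  show ?thesis
  proof (unfold_locales, rule f.source, rule f.target, unfold natural_def, intro conjI ballI)
    fix x assume x: "x \<in> Ob C"
    interpret fx: module_hom k "mod_at V x" "mod_at W x" "\<eta> x" by (rule f.hom_at [OF x])
    show "(\<lambda>u. \<ominus>\<^bsub>mod_at W x\<^esub> \<eta> x u) \<in> linear_maps k (mod_at V x) (mod_at W x)"
      by (intro linear_mapsI)
         (auto simp: fx.add fx.smult fx.N.M.minus_add fx.N.smult_r_minus)
  next
    fix h u assume h: "h \<in> Arr C" "u \<in> carrier (mod_at V (Dom C h))"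
    interpret A: module_hom k "mod_at W (Dom C h)" "mod_at W (Cod C h)" "act W h"
      by (rule act_hom [OF f.target h(1)])
    show "\<ominus>\<^bsub>mod_at W (Cod C h)\<^esub> \<eta> (Cod C h) (act V h u) =
        act W h (\<ominus>\<^bsub>mod_at W (Dom C h)\<^esub> \<eta> (Dom C h) u)"
      using h by (simp add: f.naturality A.minus f.closed)
  qed
qed

text \<open>The existence half of the universal property of a kernel. At each object
  \<open>h\<close> is \<open>g\<close> followed by the inverse of \<open>j\<close> on its image;
  linearity and naturality hold after applying \<open>j\<close>, and injectivity cancels
  \<open>j\<close>.\<close>

lemma lift_through_injective:
  assumes j: "cmap C k V W j" and g: "cmap C k X W g"
    and inj: "\<And>x. x \<in> Ob C \<Longrightarrow> inj_on (j x) (carrier (mod_at V x))"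
    and im: "\<And>x u. x \<in> Ob C \<Longrightarrow> u \<in> carrier (mod_at X x) \<Longrightarrow> g x u \<in> j x ` carrier (mod_at V x)"
  obtains h where "cmap C k X V h"
    "\<And>x u. x \<in> Ob C \<Longrightarrow> u \<in> carrier (mod_at X x) \<Longrightarrow> j x (h x u) = g x u"
proof -
  interpret j: cmap C k V W j by fact
  interpret g: cmap C k X W g by fact
  define h where "h = (\<lambda>x u. inv_into (carrier (mod_at V x)) (j x) (g x u))"
  have jh: "j x (h x u) = g x u" and hc: "h x u \<in> carrier (mod_at V x)"
    if "x \<in> Ob C" "u \<in> carrier (mod_at X x)" for x u
    using im [OF that] by (auto simp: h_def f_inv_into_f inv_into_into)
  have eq: "h x u = v"
    if "x \<in> Ob C" "u \<in> carrier (mod_at X x)" "v \<in> carrier (mod_at V x)" "j x v = g x u" for x u v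
    using inj_onD [OF inj [OF that(1)]] jh hc that by metis
  have "cmap C k X V h"
  proof (unfold_locales, rule g.source, rule j.source, unfold natural_def, intro conjI ballI)
    fix x assume x: "x \<in> Ob C"
    interpret jx: module_hom k "mod_at V x" "mod_at W x" "j x" by (rule j.hom_at [OF x])
    interpret gx: module_hom k "mod_at X x" "mod_at W x" "g x" by (rule g.hom_at [OF x])
    show "h x \<in> linear_maps k (mod_at X x) (mod_at V x)"
      using x by (intro linear_mapsI)
        (auto simp: hc jh jx.add gx.add jx.smult gx.smult intro!: eq)
  next
    fix f u assume f: "f \<in> Arr C" "u \<in> carrier (mod_at X (Dom C f))"
    then show "h (Cod C f) (act X f u) = act V f (h (Dom C f) u)"
      by (intro eq) (auto simp: act_closed [OF g.source] act_closed [OF j.source] hc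
          j.naturality g.naturality jh)
  qed
  then show thesis using jh that by blast
qed

text \<open>The existence half of the universal property of a cokernel. The value of
  \<open>h\<close> at \<open>w\<close> is that of \<open>g\<close> at a chosen preimage; two
  preimages differ by an element of the kernel of \<open>q\<close>, where \<open>g\<close> vanishes,
  so \<open>h\<close> does not depend on the choice.\<close>

lemma factor_through_surjective:
  assumes q: "cmap C k V W q" and g: "cmap C k V X g"
    and surj: "\<And>x. x \<in> Ob C \<Longrightarrow> q x ` carrier (mod_at V x) = carrier (mod_at W x)"
    and ker: "\<And>x u. x \<in> Ob C \<Longrightarrow> u \<in> carrier (mod_at V x) \<Longrightarrow> q x u = \<zero>\<^bsub>mod_at W x\<^esub> \<Longrightarrow>
      g x u = \<zero>\<^bsub>mod_at X x\<^esub>"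
  obtains h where "cmap C k W X h"
    "\<And>x u. x \<in> Ob C \<Longrightarrow> u \<in> carrier (mod_at V x) \<Longrightarrow> h x (q x u) = g x u"
proof -
  interpret q: cmap C k V W q by fact
  interpret g: cmap C k V X g by fact
  define h where "h = (\<lambda>x w. g x (inv_into (carrier (mod_at V x)) (q x) w))"
  have hq: "h x (q x u) = g x u" if x: "x \<in> Ob C" and u: "u \<in> carrier (mod_at V x)" for x u
  proof -
    interpret qx: module_hom k "mod_at V x" "mod_at W x" "q x" by (rule q.hom_at [OF x])
    interpret gx: module_hom k "mod_at V x" "mod_at X x" "g x" by (rule g.hom_at [OF x])
    define v where "v = inv_into (carrier (mod_at V x)) (q x) (q x u)"
    have v: "v \<in> carrier (mod_at V x)" "q x v = q x u"
      using u by (auto simp: v_def inv_into_into f_inv_into_f)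
    then have "q x (v \<ominus>\<^bsub>mod_at V x\<^esub> u) = \<zero>\<^bsub>mod_at W x\<^esub>" using u
      by (simp add: qx.diff) (simp add: a_minus_def qx.N.M.r_neg)
    then have "g x v \<ominus>\<^bsub>mod_at X x\<^esub> g x u = \<zero>\<^bsub>mod_at X x\<^esub>"
      using ker x u v gx.diff [OF v(1) u] by simp
    then have "g x v = g x u"
      using u v by (metis a_minus_def gx.N.M.a_inv_closed gx.N.M.minus_equality gx.N.M.minus_minus
          gx.closed)
    then show ?thesis by (simp add: h_def v_def)
  qed
  have "cmap C k W X h"
  proof (unfold_locales, rule q.target, rule g.target, unfold natural_def, intro conjI ballI)
    fix x assume x: "x \<in> Ob C"
    interpret qx: module_hom k "mod_at V x" "mod_at W x" "q x" by (rule q.hom_at [OF x])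
    interpret gx: module_hom k "mod_at V x" "mod_at X x" "g x" by (rule g.hom_at [OF x])
    show "h x \<in> linear_maps k (mod_at W x) (mod_at X x)"
      using x by (intro linear_mapsI)
        (auto simp: hq gx.add gx.smult simp flip: surj [OF x] qx.add qx.smult)
  next
    fix f u assume f: "f \<in> Arr C" "u \<in> carrier (mod_at W (Dom C f))"
    then obtain v where v: "v \<in> carrier (mod_at V (Dom C f))" "u = q (Dom C f) v"
      using surj [of "Dom C f"] by blast
    then show "h (Cod C f) (act W f u) = act X f (h (Dom C f) u)"
      using f by (simp add: hq act_closed [OF q.source] g.naturality flip: q.naturality)
  qed
  then show thesis using hq that by blast
qed

text \<open>Transport of structure: operations and action are carried to the images of the carriers
  under \<open>e\<close>. This brings cokernels and sums, whose elements are sets or functions, back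
  to the prescribed element type.\<close>

lemma relabel:
  fixes V :: "('o, 'a, 'k, 'm) cmodule" and e :: "'o \<Rightarrow> 'm \<Rightarrow> 'n"
  assumes V: "is_cmodule C k V" and inj: "\<And>x. x \<in> Ob C \<Longrightarrow> inj_on (e x) (carrier (mod_at V x))"
  obtains W where "cmap C k V W e"
    "\<And>x. x \<in> Ob C \<Longrightarrow> bij_betw (e x) (carrier (mod_at V x)) (carrier (mod_at W x))"
proof -
  define d where "d = (\<lambda>x. inv_into (carrier (mod_at V x)) (e x))"
  have de: "d x (e x u) = u" if "x \<in> Ob C" "u \<in> carrier (mod_at V x)" for x u
    using inj that by (simp add: d_def inv_into_f_f)
  define W :: "('o, 'a, 'k, 'n) cmodule" where "W = \<lparr>mod_at = (\<lambda>x.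
      \<lparr>carrier = e x ` carrier (mod_at V x), monoid.mult = undefined, one = undefined,
       zero = e x \<zero>\<^bsub>mod_at V x\<^esub>, add = (\<lambda>u v. e x (d x u \<oplus>\<^bsub>mod_at V x\<^esub> d x v)),
       smult = (\<lambda>c u. e x (c \<odot>\<^bsub>mod_at V x\<^esub> d x u))\<rparr>),
     act = (\<lambda>f u. e (Cod C f) (act V f (d (Dom C f) u)))\<rparr>"
  have lin: "e x \<in> linear_maps k (mod_at V x) (mod_at W x)" if "x \<in> Ob C" for x
    using that by (intro linear_mapsI) (auto simp: W_def de)
  have W: "is_cmodule C k W"
    by (rule is_cmodule_image [OF V lin]) (auto simp: W_def de)
  have "cmap C k V W e"
    by unfold_locales (auto simp: V W natural_def lin, simp add: W_def de)
  moreover have "bij_betw (e x) (carrier (mod_at V x)) (carrier (mod_at W x))" if "x \<in> Ob C" for x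
    using inj [OF that] by (simp add: bij_betw_def W_def)
  ultimately show thesis using that by blast
qed

end


section \<open>Cokernels and tame modules\<close>

locale quotient = module k M for k :: "('k, 'r) ring_scheme" and M :: "('k, 'm) module" +
  fixes N :: "'m set"
  assumes N: "submodule N k M"
begin

sublocale Q: abelian_subgroup N M
  using N by (intro abelian_subgroupI3 additive_subgroupI M.abelian_group_axioms)
    (auto simp: submodule_def)

lemma rep: "u' \<in> N +>\<^bsub>M\<^esub> u \<longleftrightarrow> (\<exists>n \<in> N. u' = n \<oplus>\<^bsub>M\<^esub> u)"
  by (auto simp: a_r_coset_def')

lemma N_carrier: "n \<in> N \<Longrightarrow> n \<in> carrier M"
  using Q.a_subset by blast

lemma coset_absorb:
  assumes "n \<in> N" "u \<in> carrier M"
  shows "N +>\<^bsub>M\<^esub> (n \<oplus>\<^bsub>M\<^esub> u) = N +>\<^bsub>M\<^esub> u"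
  using M.a_repr_independence [of "n \<oplus>\<^bsub>M\<^esub> u" N u] assms rep Q.a_subgroup by auto

lemma coset_eq_zero:
  assumes "u \<in> carrier M"
  shows "N +>\<^bsub>M\<^esub> u = N \<longleftrightarrow> u \<in> N"
  using M.a_coset_join1 [OF _ assms Q.a_subgroup] M.a_coset_join2 [OF assms Q.a_subgroup] by blast

text \<open>\<open>quotient_module\<close> and \<open>coker_cmodule\<close> define scalar multiplication and action on a coset as a
  union over all its elements; this evaluates such a union on a single representative.\<close>

lemma collect_cosets:
  assumes u: "u \<in> carrier M" and M': "quotient k M' N'"
    and h: "h \<in> carrier M \<rightarrow> carrier M'"
    and add: "\<And>v w. v \<in> carrier M \<Longrightarrow> w \<in> carrier M \<Longrightarrow> h (v \<oplus>\<^bsub>M\<^esub> w) = h v \<oplus>\<^bsub>M'\<^esub> h w"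
    and sub: "h ` N \<subseteq> N'"
  shows "(\<Union>v \<in> N +>\<^bsub>M\<^esub> u. N' +>\<^bsub>M'\<^esub> h v) = N' +>\<^bsub>M'\<^esub> h u"
proof -
  interpret M': quotient k M' N' by fact
  have eq: "N' +>\<^bsub>M'\<^esub> h v = N' +>\<^bsub>M'\<^esub> h u" if v: "v \<in> N +>\<^bsub>M\<^esub> u" for v
  proof -
    obtain n where "n \<in> N" "v = n \<oplus>\<^bsub>M\<^esub> u" using v rep by blast
    moreover have "h n \<in> N'" "h u \<in> carrier M'" using sub h u \<open>n \<in> N\<close> by auto
    ultimately show ?thesis
      using M'.coset_absorb [of "h n" "h u"] u N_carrier by (simp add: add)
  qed
  have "(\<Union>v \<in> N +>\<^bsub>M\<^esub> u. N' +>\<^bsub>M'\<^esub> h v) = (\<Union>v \<in> N +>\<^bsub>M\<^esub> u. N' +>\<^bsub>M'\<^esub> h u)"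
    by (rule SUP_cong [OF refl eq])
  also have "\<dots> = N' +>\<^bsub>M'\<^esub> h u" using Q.a_rcos_self [OF u] by (subst UN_constant) auto
  finally show ?thesis .
qed

text \<open>Linearity is established while the quotient is only a record; together with surjectivity
  it is what yields the module axioms for the quotient.\<close>

lemma projection_linear: "(\<lambda>u. N +>\<^bsub>M\<^esub> u) \<in> linear_maps k M (quotient_module M N)"
proof (rule linear_mapsI)
  fix c u assume *: "c \<in> carrier k" "u \<in> carrier M"
  have "(\<Union>v \<in> N +>\<^bsub>M\<^esub> u. N +>\<^bsub>M\<^esub> (c \<odot>\<^bsub>M\<^esub> v)) = N +>\<^bsub>M\<^esub> (c \<odot>\<^bsub>M\<^esub> u)"
    using * submoduleE(4) [OF N]
    by (intro collect_cosets) (auto simp: smult_r_distr quotient_axioms)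
  then show "N +>\<^bsub>M\<^esub> (c \<odot>\<^bsub>M\<^esub> u) = c \<odot>\<^bsub>quotient_module M N\<^esub> (N +>\<^bsub>M\<^esub> u)"
    by (simp add: quotient_module_def)
qed (auto simp: quotient_module_def A_RCOSETS_def' Q.a_rcos_sum)

lemma projection_surj: "(\<lambda>u. N +>\<^bsub>M\<^esub> u) ` carrier M = carrier (quotient_module M N)"
  by (auto simp: quotient_module_def A_RCOSETS_def')

end

context cmap
begin

abbreviation coset :: "'o \<Rightarrow> 'n \<Rightarrow> 'n set" where
  "coset x u \<equiv> \<eta> x ` carrier (mod_at V x) +>\<^bsub>mod_at W x\<^esub> u"

lemma quotient_at:
  assumes x: "x \<in> Ob C"
  shows "quotient k (mod_at W x) (\<eta> x ` carrier (mod_at V x))"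
proof -
  interpret module_hom k "mod_at V x" "mod_at W x" "\<eta> x" by (rule hom_at [OF x])
  show ?thesis
    by (intro quotient.intro quotient_axioms.intro N.module_axioms
        image_submodule [OF M.carrier_is_submodule])
qed

lemma coker_carrier:
  "x \<in> Ob C \<Longrightarrow> coset x ` carrier (mod_at W x) = carrier (mod_at (coker_cmodule C V W \<eta>) x)"
  using quotient.projection_surj [OF quotient_at] by (simp add: coker_cmodule_def)

lemma coker_eq_zero:
  assumes "x \<in> Ob C" "u \<in> carrier (mod_at W x)"
  shows "coset x u = \<zero>\<^bsub>mod_at (coker_cmodule C V W \<eta>) x\<^esub> \<longleftrightarrow> u \<in> \<eta> x ` carrier (mod_at V x)"
  using quotient.coset_eq_zero [OF quotient_at] assms
  by (simp add: coker_cmodule_def quotient_module_def)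

lemma coker_projection: "cmap C k W (coker_cmodule C V W \<eta>) coset"
proof -
  let ?Q = "coker_cmodule C V W \<eta>"
  have lin: "coset x \<in> linear_maps k (mod_at W x) (mod_at ?Q x)" if "x \<in> Ob C" for x
    using quotient.projection_linear [OF quotient_at [OF that]] by (simp add: coker_cmodule_def)
  have act: "act ?Q f (coset (Dom C f) u) = coset (Cod C f) (act W f u)"
    if f: "f \<in> Arr C" and u: "u \<in> carrier (mod_at W (Dom C f))" for f u
  proof -
    interpret A: module_hom k "mod_at W (Dom C f)" "mod_at W (Cod C f)" "act W f"
      by (rule act_hom [OF target f])
    \<comment> \<open>By naturality the action maps the image of \<open>\<eta>\<close> at
      \<open>Dom C f\<close> into the image at \<open>Cod C f\<close>, so the union defining the
      action on a coset collapses to a single coset.\<close>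
    have "act W f ` \<eta> (Dom C f) ` carrier (mod_at V (Dom C f))
        \<subseteq> \<eta> (Cod C f) ` carrier (mod_at V (Cod C f))"
      using f act_closed [OF source f] by (auto simp flip: naturality)
    then show ?thesis
      using quotient.collect_cosets [OF quotient_at u quotient_at, of "Cod C f" "act W f"] f
      by (simp add: coker_cmodule_def A.add Pi_def)
  qed
  have zero: "coset x \<zero>\<^bsub>mod_at W x\<^esub> = \<zero>\<^bsub>mod_at ?Q x\<^esub>" if x: "x \<in> Ob C" for x
  proof -
    interpret module_hom k "mod_at V x" "mod_at W x" "\<eta> x" by (rule hom_at [OF x])
    have "\<zero>\<^bsub>mod_at W x\<^esub> \<in> \<eta> x ` carrier (mod_at V x)"
      using zero M.M.zero_closed by (metis imageI)
    then show ?thesis using coker_eq_zero x by simp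
  qed
  have "is_cmodule C k ?Q"
    by (rule is_cmodule_image [OF target lin coker_carrier zero act])
  then show ?thesis
    by unfold_locales (auto simp: target natural_def lin act)
qed

end

section \<open>Tame modules and their closure properties\<close>

definition stable_at :: "('o, 'a) cat \<Rightarrow> 'o set \<Rightarrow> 'a \<Rightarrow> bool" where
  "stable_at C A f \<longleftrightarrow> f \<in> Arr C \<and>
     (\<forall>a \<in> A. hom_set C a (Cod C f) \<noteq> {} \<longrightarrow> hom_set C a (Dom C f) \<noteq> {})"

text \<open>When \<open>C(x, y) \<noteq> \<emptyset>\<close> means \<open>x \<le> y\<close>, an arrow \<open>f : y \<rightarrow> z\<close> is stable at \<open>A\<close> iff \<open>y\<close> and \<open>z\<close> lie
  above the same elements of \<open>A\<close>; a tame module is locally constant off finitely many thresholds.\<close>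

definition tame ::
  "('o, 'a) cat \<Rightarrow> ('k, 'r) ring_scheme \<Rightarrow> ('o, 'a, 'k, 'm) cmodule \<Rightarrow> bool" where
  "tame C k V \<longleftrightarrow> (\<forall>x \<in> Ob C. fin_gen k (mod_at V x)) \<and>
     (\<exists>A. finite A \<and> A \<subseteq> Ob C \<and> (\<forall>f. stable_at C A f \<longrightarrow>
        bij_betw (act V f) (carrier (mod_at V (Dom C f))) (carrier (mod_at V (Cod C f)))))"

lemma tameE:
  assumes "tame C k V"
  obtains A where "finite A" "A \<subseteq> Ob C" "\<And>f. stable_at C A f \<Longrightarrow>
    bij_betw (act V f) (carrier (mod_at V (Dom C f))) (carrier (mod_at V (Cod C f)))"
  using assms unfolding tame_def by blast

lemma tameI:
  assumes "\<And>x. x \<in> Ob C \<Longrightarrow> fin_gen k (mod_at V x)"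
    and "finite A" "A \<subseteq> Ob C" "\<And>f. stable_at C A f \<Longrightarrow>
      bij_betw (act V f) (carrier (mod_at V (Dom C f))) (carrier (mod_at V (Cod C f)))"
  shows "tame C k V"
  using assms unfolding tame_def by blast

context cmods
begin

lemma act_inj_iff:
  assumes "is_cmodule C k V" "f \<in> Arr C"
  shows "inj_on (act V f) (carrier (mod_at V (Dom C f))) \<longleftrightarrow>
    (\<forall>u \<in> carrier (mod_at V (Dom C f)).
       act V f u = \<zero>\<^bsub>mod_at V (Cod C f)\<^esub> \<longrightarrow> u = \<zero>\<^bsub>mod_at V (Dom C f)\<^esub>)"
  by (rule module_hom.inj_on_iff [OF act_hom [OF assms]])

lemma act_bijI:
  assumes V: "is_cmodule C k V" and f: "f \<in> Arr C"
    and inj: "\<And>u. u \<in> carrier (mod_at V (Dom C f)) \<Longrightarrow>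
      act V f u = \<zero>\<^bsub>mod_at V (Cod C f)\<^esub> \<Longrightarrow> u = \<zero>\<^bsub>mod_at V (Dom C f)\<^esub>"
    and surj: "\<And>w. w \<in> carrier (mod_at V (Cod C f)) \<Longrightarrow>
      \<exists>u \<in> carrier (mod_at V (Dom C f)). act V f u = w"
  shows "bij_betw (act V f) (carrier (mod_at V (Dom C f))) (carrier (mod_at V (Cod C f)))"
  unfolding bij_betw_def act_inj_iff [OF V f]
  using inj surj act_closed [OF V f] by (auto simp: image_iff)

text \<open>For \<open>f\<close> stable at \<open>A \<union> B\<close>, injectivity of
  \<open>K(f)\<close> is inherited from \<open>V(f)\<close>. For surjectivity, an element of
  \<open>K(Cod f)\<close> is pulled back along the bijection \<open>V(f)\<close>; injectivity of
  \<open>W(f)\<close> shows that the result is killed by \<open>g\<close>, so it comes from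
  \<open>K(Dom f)\<close>. Finite dimension of the values uses that \<open>k\<close> is a
  field.\<close>

lemma tame_kernel:
  assumes i: "cmap C k K V i" and g: "cmap C k V W g"
    and inj: "\<And>x. x \<in> Ob C \<Longrightarrow> inj_on (i x) (carrier (mod_at K x))"
    and ex: "\<And>x. x \<in> Ob C \<Longrightarrow>
      i x ` carrier (mod_at K x) = {u \<in> carrier (mod_at V x). g x u = \<zero>\<^bsub>mod_at W x\<^esub>}"
    and V: "tame C k V" and W: "tame C k W"
  shows "tame C k K"
proof -
  interpret i: cmap C k K V i by fact
  interpret g: cmap C k V W g by fact
  obtain A where A: "finite A" "A \<subseteq> Ob C" "\<And>f. stable_at C A f \<Longrightarrow>
    bij_betw (act V f) (carrier (mod_at V (Dom C f))) (carrier (mod_at V (Cod C f)))"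
    using V by (rule tameE) blast
  obtain B where B: "finite B" "B \<subseteq> Ob C" "\<And>f. stable_at C B f \<Longrightarrow>
    bij_betw (act W f) (carrier (mod_at W (Dom C f))) (carrier (mod_at W (Cod C f)))"
    using W by (rule tameE) blast
  show ?thesis
  proof (rule tameI)
    show "fin_gen k (mod_at K x)" if x: "x \<in> Ob C" for x
      using V x inj [OF x]
      by (intro module_hom.fin_gen_inj [OF i.hom_at [OF x] k.field_axioms]) (auto simp: tame_def)
    show "finite (A \<union> B)" "A \<union> B \<subseteq> Ob C" using A B by auto
    fix f assume "stable_at C (A \<union> B) f"
    then have f: "f \<in> Arr C" "stable_at C A f" "stable_at C B f" by (auto simp: stable_at_def)
    note bV = A(3) [OF f(2)] and bW = B(3) [OF f(3)]
    show "bij_betw (act K f) (carrier (mod_at K (Dom C f))) (carrier (mod_at K (Cod C f)))"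
    proof (rule act_bijI [OF i.source f(1)])
      fix u assume u: "u \<in> carrier (mod_at K (Dom C f))" "act K f u = \<zero>\<^bsub>mod_at K (Cod C f)\<^esub>"
      then have "act V f (i (Dom C f) u) = \<zero>\<^bsub>mod_at V (Cod C f)\<^esub>"
        using i.naturality [OF f(1) u(1)] i.zero_at f by simp
      then have "i (Dom C f) u = \<zero>\<^bsub>mod_at V (Dom C f)\<^esub>"
        using bV act_inj_iff [OF i.target f(1)] i.closed u f by (auto simp: bij_betw_def)
      then show "u = \<zero>\<^bsub>mod_at K (Dom C f)\<^esub>"
        using inj [of "Dom C f"] module_hom.inj_on_iff [OF i.hom_at] u f by blast
    next
      fix w assume w: "w \<in> carrier (mod_at K (Cod C f))"
      then obtain v where v: "v \<in> carrier (mod_at V (Dom C f))" "act V f v = i (Cod C f) w"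
        using bV i.closed f by (auto simp: bij_betw_def) (metis Cod_Ob imageE)
      have "g (Cod C f) (i (Cod C f) w) = \<zero>\<^bsub>mod_at W (Cod C f)\<^esub>"
        using ex [of "Cod C f"] f w by blast
      then have "act W f (g (Dom C f) v) = \<zero>\<^bsub>mod_at W (Cod C f)\<^esub>"
        using g.naturality [OF f(1) v(1)] v by simp
      then have "g (Dom C f) v = \<zero>\<^bsub>mod_at W (Dom C f)\<^esub>"
        using bW act_inj_iff [OF g.target f(1)] g.closed v f by (auto simp: bij_betw_def)
      then obtain u where u: "u \<in> carrier (mod_at K (Dom C f))" "v = i (Dom C f) u"
        using ex [of "Dom C f"] f v by blast
      then have "i (Cod C f) (act K f u) = i (Cod C f) w"
        using i.naturality [OF f(1) u(1)] v by simp
      then have "act K f u = w"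
        using inj [of "Cod C f"] f u w act_closed [OF i.source f(1)] by (auto dest: inj_onD)
      then show "\<exists>u \<in> carrier (mod_at K (Dom C f)). act K f u = w" using u by blast
    qed
  qed
qed

text \<open>A module mapping bijectively to \<open>V\<close> is a kernel of the zero map from
  \<open>V\<close> to itself, so \<open>tame_kernel\<close> applies.\<close>

lemma tame_iso:
  assumes i: "cmap C k K V i" and V: "tame C k V"
    and bij: "\<And>x. x \<in> Ob C \<Longrightarrow> bij_betw (i x) (carrier (mod_at K x)) (carrier (mod_at V x))"
  shows "tame C k K"
  using bij cmap.target [OF i]
  by (intro tame_kernel [OF i cmap_zero [of V V]]) (auto simp: V bij_betw_def)

text \<open>Surjectivity of \<open>W(f)\<close> is inherited from \<open>V(f)\<close>. For
  injectivity, represent an element killed by \<open>W(f)\<close> by \<open>v\<close>; then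
  \<open>V(f) v\<close> is in the image of \<open>\<phi>\<close>, surjectivity of
  \<open>U(f)\<close> moves the witness back to \<open>Dom f\<close>, and injectivity of
  \<open>V(f)\<close> puts \<open>v\<close> itself in the image of \<open>\<phi>\<close>.\<close>

lemma tame_cokernel:
  assumes f: "cmap C k U V \<phi>" and q: "cmap C k V W q"
    and surj: "\<And>x. x \<in> Ob C \<Longrightarrow> q x ` carrier (mod_at V x) = carrier (mod_at W x)"
    and ex: "\<And>x. x \<in> Ob C \<Longrightarrow>
      \<phi> x ` carrier (mod_at U x) = {u \<in> carrier (mod_at V x). q x u = \<zero>\<^bsub>mod_at W x\<^esub>}"
    and U: "tame C k U" and V: "tame C k V"
  shows "tame C k W"
proof -
  interpret \<phi>: cmap C k U V \<phi> by fact
  interpret q: cmap C k V W q by fact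
  obtain A where A: "finite A" "A \<subseteq> Ob C" "\<And>f. stable_at C A f \<Longrightarrow>
    bij_betw (act U f) (carrier (mod_at U (Dom C f))) (carrier (mod_at U (Cod C f)))"
    using U by (rule tameE) blast
  obtain B where B: "finite B" "B \<subseteq> Ob C" "\<And>f. stable_at C B f \<Longrightarrow>
    bij_betw (act V f) (carrier (mod_at V (Dom C f))) (carrier (mod_at V (Cod C f)))"
    using V by (rule tameE) blast
  show ?thesis
  proof (rule tameI)
    show "fin_gen k (mod_at W x)" if x: "x \<in> Ob C" for x
      using V x surj [OF x]
      by (intro module_hom.fin_gen_surj [OF q.hom_at [OF x]]) (auto simp: tame_def)
    show "finite (A \<union> B)" "A \<union> B \<subseteq> Ob C" using A B by auto
    fix f assume "stable_at C (A \<union> B) f"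
    then have f: "f \<in> Arr C" "stable_at C A f" "stable_at C B f" by (auto simp: stable_at_def)
    note bU = A(3) [OF f(2)] and bV = B(3) [OF f(3)]
    show "bij_betw (act W f) (carrier (mod_at W (Dom C f))) (carrier (mod_at W (Cod C f)))"
    proof (rule act_bijI [OF q.target f(1)])
      fix w assume w: "w \<in> carrier (mod_at W (Dom C f))" "act W f w = \<zero>\<^bsub>mod_at W (Cod C f)\<^esub>"
      then obtain v where v: "v \<in> carrier (mod_at V (Dom C f))" "w = q (Dom C f) v"
        using surj [of "Dom C f"] f by blast
      then have "q (Cod C f) (act V f v) = \<zero>\<^bsub>mod_at W (Cod C f)\<^esub>"
        using q.naturality [OF f(1) v(1)] w by simp
      then have "act V f v \<in> \<phi> (Cod C f) ` carrier (mod_at U (Cod C f))"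
        using ex [of "Cod C f"] act_closed [OF q.source f(1) v(1)] f by simp
      then obtain u where u: "u \<in> carrier (mod_at U (Dom C f))"
          "act V f v = \<phi> (Cod C f) (act U f u)"
        using bU by (auto simp: bij_betw_def simp flip: bU [unfolded bij_betw_def, THEN conjunct2])
      then have "act V f v = act V f (\<phi> (Dom C f) u)"
        using \<phi>.naturality [OF f(1)] by simp
      then have "v = \<phi> (Dom C f) u"
        using bV v u \<phi>.closed f by (auto simp: bij_betw_def dest: inj_onD)
      then have "q (Dom C f) v = \<zero>\<^bsub>mod_at W (Dom C f)\<^esub>"
        using ex [of "Dom C f"] u f by blast
      then show "w = \<zero>\<^bsub>mod_at W (Dom C f)\<^esub>" using v by simp
    next
      fix w assume w: "w \<in> carrier (mod_at W (Cod C f))"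
      then obtain v where v: "v \<in> carrier (mod_at V (Cod C f))" "w = q (Cod C f) v"
        using surj [of "Cod C f"] f by blast
      then obtain u where u: "u \<in> carrier (mod_at V (Dom C f))" "v = act V f u"
        using bV by (auto simp: bij_betw_def)
      then show "\<exists>u \<in> carrier (mod_at W (Dom C f)). act W f u = w"
        using v q.naturality [OF f(1) u(1)] q.closed f
        by (intro bexI [of _ "q (Dom C f) u"]) auto
    qed
  qed
qed

text \<open>Besides naturality, only the identity \<open>i p + j q = id\<close> enters. It makes the
  images of generators of \<open>V\<close> and \<open>W\<close> generate \<open>S\<close>, and it
  shows that \<open>i V(f)\<inverse> p + j W(f)\<inverse> q\<close> is inverse to
  \<open>S(f)\<close>. Nothing is assumed about how \<open>S\<close> is built, so the lemma applies
  directly to a relabelled sum.\<close>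

lemma tame_sum:
  assumes p: "cmap C k S V p" and q: "cmap C k S W q"
    and i: "cmap C k V S i" and j: "cmap C k W S j"
    and pq: "\<And>x u. x \<in> Ob C \<Longrightarrow> u \<in> carrier (mod_at S x) \<Longrightarrow>
      i x (p x u) \<oplus>\<^bsub>mod_at S x\<^esub> j x (q x u) = u"
    and V: "tame C k V" and W: "tame C k W"
  shows "tame C k S"
proof -
  interpret p: cmap C k S V p by fact
  interpret q: cmap C k S W q by fact
  interpret i: cmap C k V S i by fact
  interpret j: cmap C k W S j by fact
  obtain A where A: "finite A" "A \<subseteq> Ob C" "\<And>f. stable_at C A f \<Longrightarrow>
    bij_betw (act V f) (carrier (mod_at V (Dom C f))) (carrier (mod_at V (Cod C f)))"
    using V by (rule tameE) blast
  obtain B where B: "finite B" "B \<subseteq> Ob C" "\<And>f. stable_at C B f \<Longrightarrow>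
    bij_betw (act W f) (carrier (mod_at W (Dom C f))) (carrier (mod_at W (Cod C f)))"
    using W by (rule tameE) blast
  show ?thesis
  proof (rule tameI)
    fix x assume x: "x \<in> Ob C"
    interpret ix: module_hom k "mod_at V x" "mod_at S x" "i x" by (rule i.hom_at [OF x])
    interpret jx: module_hom k "mod_at W x" "mod_at S x" "j x" by (rule j.hom_at [OF x])
    obtain D where D: "finite D" "D \<subseteq> carrier (mod_at V x)"
        "carrier (mod_at V x) \<subseteq> span k (mod_at V x) D"
      using V x fin_genE [of k "mod_at V x"] unfolding tame_def by metis
    obtain E where E: "finite E" "E \<subseteq> carrier (mod_at W x)"
        "carrier (mod_at W x) \<subseteq> span k (mod_at W x) E"
      using W x fin_genE [of k "mod_at W x"] unfolding tame_def by metis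
    have "u \<in> L" if u: "u \<in> carrier (mod_at S x)"
      and L: "submodule L k (mod_at S x)" "i x ` D \<union> j x ` E \<subseteq> L" for u L
    proof -
      have "span k (mod_at V x) D \<subseteq> {v \<in> carrier (mod_at V x). i x v \<in> L}"
        using L(2) D(2) by (intro ix.M.span_minimal [OF ix.preimage_submodule [OF L(1)]]) auto
      moreover have "span k (mod_at W x) E \<subseteq> {v \<in> carrier (mod_at W x). j x v \<in> L}"
        using L(2) E(2) by (intro jx.M.span_minimal [OF jx.preimage_submodule [OF L(1)]]) auto
      ultimately have "i x (p x u) \<in> L" "j x (q x u) \<in> L"
        using D(3) E(3) p.closed [OF x u] q.closed [OF x u] by auto
      then have "i x (p x u) \<oplus>\<^bsub>mod_at S x\<^esub> j x (q x u) \<in> L"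
        by (rule ix.N.submoduleE(5) [OF L(1)])
      then show ?thesis by (simp add: pq x u)
    qed
    then have "carrier (mod_at S x) \<subseteq> span k (mod_at S x) (i x ` D \<union> j x ` E)"
      by (auto simp: span_def)
    moreover have "i x ` D \<union> j x ` E \<subseteq> carrier (mod_at S x)"
      using D(2) E(2) by auto
    ultimately show "fin_gen k (mod_at S x)"
      using D(1) E(1) unfolding fin_gen_def by (intro exI [of _ "i x ` D \<union> j x ` E"]) simp
  next
    show "finite (A \<union> B)" "A \<union> B \<subseteq> Ob C" using A B by auto
    fix f assume "stable_at C (A \<union> B) f"
    then have f: "f \<in> Arr C" "stable_at C A f" "stable_at C B f" by (auto simp: stable_at_def)
    note bV = A(3) [OF f(2)] and bW = B(3) [OF f(3)]
    interpret ix: module_hom k "mod_at V (Dom C f)" "mod_at S (Dom C f)" "i (Dom C f)"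
      using i.hom_at f by simp
    interpret jx: module_hom k "mod_at W (Dom C f)" "mod_at S (Dom C f)" "j (Dom C f)"
      using j.hom_at f by simp
    interpret fx: module_hom k "mod_at S (Dom C f)" "mod_at S (Cod C f)" "act S f"
      by (rule act_hom [OF p.source f(1)])
    show "bij_betw (act S f) (carrier (mod_at S (Dom C f))) (carrier (mod_at S (Cod C f)))"
    proof (rule act_bijI [OF p.source f(1)])
      fix u assume u: "u \<in> carrier (mod_at S (Dom C f))" "act S f u = \<zero>\<^bsub>mod_at S (Cod C f)\<^esub>"
      have "act V f (p (Dom C f) u) = \<zero>\<^bsub>mod_at V (Cod C f)\<^esub>"
        using p.naturality [OF f(1) u(1)] p.zero_at f u by simp
      then have pz: "p (Dom C f) u = \<zero>\<^bsub>mod_at V (Dom C f)\<^esub>"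
        using bV act_inj_iff [OF p.target f(1)] p.closed u f by (auto simp: bij_betw_def)
      have "act W f (q (Dom C f) u) = \<zero>\<^bsub>mod_at W (Cod C f)\<^esub>"
        using q.naturality [OF f(1) u(1)] q.zero_at f u by simp
      then have "q (Dom C f) u = \<zero>\<^bsub>mod_at W (Dom C f)\<^esub>"
        using bW act_inj_iff [OF q.target f(1)] q.closed u f by (auto simp: bij_betw_def)
      then show "u = \<zero>\<^bsub>mod_at S (Dom C f)\<^esub>"
        using pq [of "Dom C f" u] f u pz by simp
    next
      fix s assume s: "s \<in> carrier (mod_at S (Cod C f))"
      obtain v where v: "v \<in> carrier (mod_at V (Dom C f))" "act V f v = p (Cod C f) s"
        using bV p.closed [OF _ s] f unfolding bij_betw_def by (metis Cod_Ob imageE)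
      obtain w where w: "w \<in> carrier (mod_at W (Dom C f))" "act W f w = q (Cod C f) s"
        using bW q.closed [OF _ s] f unfolding bij_betw_def by (metis Cod_Ob imageE)
      have "act S f (i (Dom C f) v \<oplus>\<^bsub>mod_at S (Dom C f)\<^esub> j (Dom C f) w) = s"
        using v w f s pq [of "Cod C f" s]
        by (simp add: fx.add flip: i.naturality j.naturality)
      then show "\<exists>u \<in> carrier (mod_at S (Dom C f)). act S f u = s"
        using v w by (intro bexI) auto
    qed
  qed
qed

end


section \<open>Principal modules\<close>

text \<open>The properties of a combinatorial category in the form in which they are applied, with
  \<open>x \<le> y\<close> expressed as nonemptiness of \<open>hom_set C x y\<close>, so that
  neither the identification of the objects with sequences nor the group actions appear
  below.\<close>

locale combinatorial = cmods C k
  for C :: "('o, 'a) cat" (structure) and k :: "('k, 'r) ring_scheme" +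
  assumes finite_hom: "x \<in> Ob C \<Longrightarrow> y \<in> Ob C \<Longrightarrow> finite (hom_set C x y)"
    and Cmp_cancel: "f \<in> Arr C \<Longrightarrow> x \<in> Ob C \<Longrightarrow> g \<in> hom_set C x (Dom C f) \<Longrightarrow>
      g' \<in> hom_set C x (Dom C f) \<Longrightarrow> f \<cdot> g = f \<cdot> g' \<Longrightarrow> g = g'"
    and Cmp_factor: "f \<in> Arr C \<Longrightarrow> x \<in> Ob C \<Longrightarrow> hom_set C x (Dom C f) \<noteq> {} \<Longrightarrow>
      h \<in> hom_set C x (Cod C f) \<Longrightarrow> \<exists>g \<in> hom_set C x (Dom C f). h = f \<cdot> g"
    and join: "finite A \<Longrightarrow> A \<subseteq> Ob C \<Longrightarrow>
      \<exists>j \<in> Ob C. \<forall>y \<in> Ob C. hom_set C j y \<noteq> {} \<longleftrightarrow> (\<forall>a \<in> A. hom_set C a y \<noteq> {})"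

lemma finite_sets_Ninf_join:
  assumes "finite A" "A \<subseteq> Ninf"
  shows "\<exists>j \<in> Ninf. \<forall>y. j \<le> y \<longleftrightarrow> (\<forall>a \<in> A. a \<le> y)"
  using assms
proof (induction rule: finite_induct)
  case empty
  have "(\<lambda>_. 0) \<in> Ninf" by (simp add: Ninf_def)
  then show ?case by (auto simp: le_fun_def)
next
  case (insert a A)
  then obtain j where j: "j \<in> Ninf" "\<And>y. j \<le> y \<longleftrightarrow> (\<forall>a \<in> A. a \<le> y)" by auto
  have "{i. sup a j i \<noteq> 0} \<subseteq> {i. a i \<noteq> 0} \<union> {i. j i \<noteq> 0}" by (auto simp: sup_nat_def)
  then have "sup a j \<in> Ninf"
    using j insert.prems finite_subset by (fastforce simp: Ninf_def)
  moreover have "sup a j \<le> y \<longleftrightarrow> (\<forall>b \<in> insert a A. b \<le> y)" for y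
    unfolding le_sup_iff j(2) by simp
  ultimately show ?case by blast
qed

text \<open>All three hom-set properties come from the right action of the group at
  \<open>x\<close>. The hom set from \<open>x\<close> to \<open>y\<close> is a single orbit, hence
  finite. Arrows \<open>g\<close> and \<open>g'\<close> into \<open>Dom f\<close> differ by a group
  element \<open>h\<close>; if \<open>f g = f g'\<close>, then \<open>h\<close> fixes
  \<open>f g\<close>, and freeness gives \<open>h = id\<close>. Given some \<open>g\<close> into
  \<open>Dom f\<close>, any \<open>h\<close> into \<open>Cod f\<close> is \<open>(f g) t\<close> by
  transitivity, so it factors through \<open>f\<close>. Joins are pointwise maxima.\<close>

lemma combinatorial_category_imp:
  fixes C :: "('o, 'a) cat" and k :: "('k, 'r) ring_scheme"
  assumes C: "combinatorial_category C" and k: "field k"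
    and fin: "\<And>x. x \<in> Ob C \<Longrightarrow> finite (hom_set C x x)"
  shows "combinatorial C k"
proof -
  interpret category C
    using C by (simp add: combinatorial_category_def EI_category_def)
  interpret cmods C k by (intro cmods.intro category_axioms k)
  have free: "g = Ide C x"
    if "f \<in> hom_set C x y" "g \<in> hom_set C x x" "f \<cdot>\<^bsub>C\<^esub> g = f" "x \<in> Ob C" "y \<in> Ob C" for x y f g
    using C that unfolding combinatorial_category_def by blast
  have trans: "\<exists>g \<in> hom_set C x x. f' = f \<cdot>\<^bsub>C\<^esub> g"
    if "f \<in> hom_set C x y" "f' \<in> hom_set C x y" "x \<in> Ob C" "y \<in> Ob C" for x y f f'
    using C that unfolding combinatorial_category_def by blast
  obtain \<iota> where \<iota>: "bij_betw \<iota> Ninf (Ob C)"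
      "\<And>x y. x \<in> Ninf \<Longrightarrow> y \<in> Ninf \<Longrightarrow> hom_set C (\<iota> x) (\<iota> y) \<noteq> {} \<longleftrightarrow> x \<le> y"
    using C unfolding combinatorial_category_def by metis
  show ?thesis
  proof (unfold_locales)
    fix x y assume *: "x \<in> Ob C" "y \<in> Ob C"
    show "finite (hom_set C x y)"
    proof (cases "hom_set C x y = {}")
      case False
      then obtain f where f: "f \<in> hom_set C x y" by blast
      have "hom_set C x y \<subseteq> (\<lambda>g. f \<cdot>\<^bsub>C\<^esub> g) ` hom_set C x x"
        using trans [OF f _ *] by blast
      then show ?thesis using fin * by (meson finite_imageI finite_subset)
    qed simp
  next
    fix f x g g'
    assume f: "f \<in> Arr C" and x: "x \<in> Ob C" and g: "g \<in> hom_set C x (Dom C f)"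
      "g' \<in> hom_set C x (Dom C f)" and eq: "f \<cdot>\<^bsub>C\<^esub> g = f \<cdot>\<^bsub>C\<^esub> g'"
    have f': "f \<in> hom_set C (Dom C f) (Cod C f)" using f by (simp add: hom_set_def)
    obtain h where h: "h \<in> hom_set C x x" "g' = g \<cdot>\<^bsub>C\<^esub> h"
      using trans [OF g] x f by auto
    have "(f \<cdot>\<^bsub>C\<^esub> g) \<cdot>\<^bsub>C\<^esub> h = f \<cdot>\<^bsub>C\<^esub> g"
      using Cmp_assoc [OF h(1) g(1) f'] eq h by simp
    then have "h = Ide C x"
      using free [OF Cmp_in_hom [OF g(1) f'] h(1)] x f by simp
    then show "g = g'" using h Cmp_Ide [OF g(1)] by simp
  next
    fix f x h
    assume f: "f \<in> Arr C" and x: "x \<in> Ob C" and ne: "hom_set C x (Dom C f) \<noteq> {}"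
      and h: "h \<in> hom_set C x (Cod C f)"
    have f': "f \<in> hom_set C (Dom C f) (Cod C f)" using f by (simp add: hom_set_def)
    obtain g where g: "g \<in> hom_set C x (Dom C f)" using ne by blast
    obtain t where t: "t \<in> hom_set C x x" "h = (f \<cdot>\<^bsub>C\<^esub> g) \<cdot>\<^bsub>C\<^esub> t"
      using trans [OF Cmp_in_hom [OF g f'] h] x f by auto
    then have "h = f \<cdot>\<^bsub>C\<^esub> (g \<cdot>\<^bsub>C\<^esub> t)" using Cmp_assoc [OF t(1) g f'] by simp
    then show "\<exists>g \<in> hom_set C x (Dom C f). h = f \<cdot>\<^bsub>C\<^esub> g"
      using Cmp_in_hom [OF t(1) g] by blast
  next
    fix A assume A: "finite A" "A \<subseteq> Ob C"
    have "\<exists>B \<subseteq> Ninf. finite B \<and> A = \<iota> ` B"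
      using A \<iota>(1) by (metis bij_betw_def finite_subset_image)
    then obtain B where B: "B \<subseteq> Ninf" "finite B" "A = \<iota> ` B" by blast
    obtain j where j: "j \<in> Ninf" "\<And>y. j \<le> y \<longleftrightarrow> (\<forall>a \<in> B. a \<le> y)"
      using finite_sets_Ninf_join [OF B(2,1)] by blast
    have "hom_set C (\<iota> j) (\<iota> y) \<noteq> {} \<longleftrightarrow> (\<forall>a \<in> A. hom_set C a (\<iota> y) \<noteq> {})" if "y \<in> Ninf" for y
      using \<iota>(2) j B that by (simp add: subset_iff)
    moreover have "Ob C = \<iota> ` Ninf" using \<iota>(1) by (simp add: bij_betw_def)
    ultimately show "\<exists>j \<in> Ob C. \<forall>y \<in> Ob C. hom_set C j y \<noteq> {} \<longleftrightarrow> (\<forall>a \<in> A. hom_set C a y \<noteq> {})"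
      using j(1) by (intro bexI [of _ "\<iota> j"]) auto
  qed
qed

section \<open>Free modules\<close>

lemma (in cring) module_free_module: "module R (free_module R S)"
proof -
  let ?F = "free_module R S"
  have carrier_F: "v \<in> carrier ?F \<longleftrightarrow> (\<forall>s. v s \<in> carrier R) \<and> (\<forall>s. s \<notin> S \<longrightarrow> v s = \<zero>) \<and>
      finite {s. v s \<noteq> \<zero>}" for v
    by (auto simp: free_module_def)
  have "finite {s. u s \<oplus> v s \<noteq> \<zero>}" if "u \<in> carrier ?F" "v \<in> carrier ?F" for u v
  proof (rule finite_subset)
    show "{s. u s \<oplus> v s \<noteq> \<zero>} \<subseteq> {s. u s \<noteq> \<zero>} \<union> {s. v s \<noteq> \<zero>}" using that by auto
  qed (use that in \<open>auto simp: carrier_F\<close>)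
  moreover have "finite {s. \<ominus> u s \<noteq> \<zero>}" "finite {s. c \<otimes> u s \<noteq> \<zero>}"
    if "u \<in> carrier ?F" "c \<in> carrier R" for u c
  proof -
    have "{s. \<ominus> u s \<noteq> \<zero>} \<subseteq> {s. u s \<noteq> \<zero>}" "{s. c \<otimes> u s \<noteq> \<zero>} \<subseteq> {s. u s \<noteq> \<zero>}"
      using that by auto
    then show "finite {s. \<ominus> u s \<noteq> \<zero>}" "finite {s. c \<otimes> u s \<noteq> \<zero>}"
      using that finite_subset by (auto simp: carrier_F)
  qed
  ultimately have fin: "\<And>u v. u \<in> carrier ?F \<Longrightarrow> v \<in> carrier ?F \<Longrightarrow> finite {s. u s \<oplus> v s \<noteq> \<zero>}"
    "\<And>u. u \<in> carrier ?F \<Longrightarrow> finite {s. \<ominus> u s \<noteq> \<zero>}"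
    "\<And>u c. u \<in> carrier ?F \<Longrightarrow> c \<in> carrier R \<Longrightarrow> finite {s. c \<otimes> u s \<noteq> \<zero>}"
    using zero_closed by blast+
  have ops: "u \<oplus>\<^bsub>?F\<^esub> v = (\<lambda>s. u s \<oplus> v s)" "\<zero>\<^bsub>?F\<^esub> = (\<lambda>s. \<zero>)" "c \<odot>\<^bsub>?F\<^esub> u = (\<lambda>s. c \<otimes> u s)"
    for u v c by (simp_all add: free_module_def)
  show ?thesis
  proof (intro moduleI abelian_groupI is_cring)
    fix x assume x: "x \<in> carrier ?F"
    then have "(\<lambda>s. \<ominus> x s) \<in> carrier ?F" using fin by (auto simp: carrier_F)
    moreover have "(\<lambda>s. \<ominus> x s) \<oplus>\<^bsub>?F\<^esub> x = \<zero>\<^bsub>?F\<^esub>" using x by (auto simp: ops carrier_F l_neg)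
    ultimately show "\<exists>y \<in> carrier ?F. y \<oplus>\<^bsub>?F\<^esub> x = \<zero>\<^bsub>?F\<^esub>" by blast
  next
    fix x y assume "x \<in> carrier ?F" "y \<in> carrier ?F"
    then show "x \<oplus>\<^bsub>?F\<^esub> y \<in> carrier ?F" using fin(1) [of x y] by (auto simp: carrier_F ops)
  next
    fix c x assume "c \<in> carrier R" "x \<in> carrier ?F"
    then show "c \<odot>\<^bsub>?F\<^esub> x \<in> carrier ?F" using fin(3) [of x c] by (auto simp: carrier_F ops)
  next
    fix x y assume "x \<in> carrier ?F" "y \<in> carrier ?F"
    then show "x \<oplus>\<^bsub>?F\<^esub> y = y \<oplus>\<^bsub>?F\<^esub> x" by (simp add: carrier_F ops a_comm)
  qed (auto simp: ops carrier_F a_assoc l_distr r_distr m_assoc)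
qed

lemma (in cring) free_module_fin_gen:
  assumes "finite S"
  shows "fin_gen R (free_module R S)"
proof -
  let ?F = "free_module R S"
  let ?\<delta> = "\<lambda>t s. if s = t then \<one> else \<zero>"
  interpret F: module R ?F by (rule module_free_module)
  have "u \<in> L" if u: "u \<in> carrier ?F" and L: "submodule L R ?F" "?\<delta> ` S \<subseteq> L" for u L
  proof -
    note L' = F.submoduleE [OF L(1)]
    have uS: "\<And>s. s \<in> S \<Longrightarrow> u s \<in> carrier R" "\<And>s. s \<notin> S \<Longrightarrow> u s = \<zero>"
      using u by (auto simp: free_module_def)
    \<comment> \<open>The restriction of \<open>u\<close> to \<open>T\<close>, extended by zero, is
      built up one basis vector at a time; for \<open>T = S\<close> it is \<open>u\<close>, which
      vanishes off \<open>S\<close>.\<close>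
    have "(\<lambda>s. if s \<in> T then u s else \<zero>) \<in> L" if "T \<subseteq> S" "finite T" for T
      using that(2,1)
    proof (induction T rule: finite_induct)
      case empty
      show ?case using F.submodule_zero [OF L(1)] by (simp add: free_module_def)
    next
      case (insert t T)
      then have "u t \<odot>\<^bsub>?F\<^esub> ?\<delta> t \<oplus>\<^bsub>?F\<^esub> (\<lambda>s. if s \<in> T then u s else \<zero>) \<in> L"
        using L(2) uS by (intro L'(5) L'(4)) auto
      also have "u t \<odot>\<^bsub>?F\<^esub> ?\<delta> t \<oplus>\<^bsub>?F\<^esub> (\<lambda>s. if s \<in> T then u s else \<zero>)
          = (\<lambda>s. if s \<in> insert t T then u s else \<zero>)"
        using insert uS by (auto simp: free_module_def fun_eq_iff subset_iff)
      finally show ?case .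
    qed
    from this [OF subset_refl assms] have "(\<lambda>s. if s \<in> S then u s else \<zero>) \<in> L" .
    also have "(\<lambda>s. if s \<in> S then u s else \<zero>) = u" using uS by auto
    finally show ?thesis .
  qed
  then have "carrier ?F \<subseteq> span R ?F (?\<delta> ` S)" by (auto simp: span_def)
  moreover have "?\<delta> ` S \<subseteq> carrier ?F" by (auto simp: free_module_def)
  ultimately show ?thesis using assms unfolding fin_gen_def by (intro exI [of _ "?\<delta> ` S"]) simp
qed

section \<open>The modules \<open>P x\<close>: functoriality and tameness\<close>

context combinatorial
begin

abbreviation P :: "'o \<Rightarrow> ('o, 'a, 'k, 'a \<Rightarrow> 'k) cmodule" where
  "P x \<equiv> principal_cmodule C k x"

lemma mem_P:
  assumes "x \<in> Ob C" "y \<in> Ob C"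
  shows "v \<in> carrier (mod_at (P x) y) \<longleftrightarrow>
    (\<forall>g. v g \<in> carrier k) \<and> (\<forall>g. g \<notin> hom_set C x y \<longrightarrow> v g = \<zero>\<^bsub>k\<^esub>)"
proof -
  have "finite {g. v g \<noteq> \<zero>\<^bsub>k\<^esub>}" if "\<forall>g. g \<notin> hom_set C x y \<longrightarrow> v g = \<zero>\<^bsub>k\<^esub>"
    using finite_hom [OF assms] that by (metis (mono_tags, lifting) finite_subset mem_Collect_eq subsetI)
  then show ?thesis
    by (auto simp: principal_cmodule_def free_module_def)
qed

lemma P_ops:
  "u \<oplus>\<^bsub>mod_at (P x) y\<^esub> v = (\<lambda>g. u g \<oplus>\<^bsub>k\<^esub> v g)"
  "\<zero>\<^bsub>mod_at (P x) y\<^esub> = (\<lambda>g. \<zero>\<^bsub>k\<^esub>)"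
  "c \<odot>\<^bsub>mod_at (P x) y\<^esub> u = (\<lambda>g. c \<otimes>\<^bsub>k\<^esub> u g)"
  by (simp_all add: principal_cmodule_def free_module_def)

text \<open>By \<open>Cmp_cancel\<close> the fibre of composition with \<open>f\<close> over
  \<open>f \<cdot> g\<close> is \<open>{g}\<close>, so the defining sum has at most one term.
  Together with \<open>act_P_outside\<close> this says that \<open>f\<close> acts by extension by
  zero along the injection sending \<open>g\<close> to \<open>f \<cdot> g\<close>, a description
  that replaces the sum from here on.\<close>

lemma act_P_image:
  assumes f: "f \<in> Arr C" and x: "x \<in> Ob C" and v: "v \<in> carrier (mod_at (P x) (Dom C f))"
    and g: "g \<in> hom_set C x (Dom C f)"
  shows "act (P x) f v (f \<cdot> g) = v g"
proof -
  have "{g' \<in> hom_set C x (Dom C f). v g' \<noteq> \<zero>\<^bsub>k\<^esub> \<and> f \<cdot> g' = f \<cdot> g} = (if v g = \<zero>\<^bsub>k\<^esub> then {} else {g})"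
    using Cmp_cancel [OF f x _ g] g by auto
  moreover have "v g \<in> carrier k" using v mem_P [OF x] f by simp
  ultimately show ?thesis by (simp add: principal_cmodule_def)
qed

lemma act_P_outside:
  assumes "h \<notin> (\<lambda>g. f \<cdot> g) ` hom_set C x (Dom C f)"
  shows "act (P x) f v h = \<zero>\<^bsub>k\<^esub>"
proof -
  have "{g \<in> hom_set C x (Dom C f). v g \<noteq> \<zero>\<^bsub>k\<^esub> \<and> f \<cdot> g = h} = {}" using assms by auto
  then show ?thesis by (simp only: principal_cmodule_def cmodule.simps) simp
qed

lemma Cmp_hom:
  "f \<in> Arr C \<Longrightarrow> g \<in> hom_set C x (Dom C f) \<Longrightarrow> f \<cdot> g \<in> hom_set C x (Cod C f)"
  by (auto simp: hom_set_def)

lemma act_P_eqI: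
  assumes f: "f \<in> Arr C" and x: "x \<in> Ob C" and v: "v \<in> carrier (mod_at (P x) (Dom C f))"
    and img: "\<And>g. g \<in> hom_set C x (Dom C f) \<Longrightarrow> w (f \<cdot> g) = v g"
    and out: "\<And>h. h \<notin> (\<lambda>g. f \<cdot> g) ` hom_set C x (Dom C f) \<Longrightarrow> w h = \<zero>\<^bsub>k\<^esub>"
  shows "act (P x) f v = w"
proof
  fix h
  show "act (P x) f v h = w h"
    using act_P_image [OF f x v] act_P_outside [of h f x v] img out
    by (cases "h \<in> (\<lambda>g. f \<cdot> g) ` hom_set C x (Dom C f)") auto
qed

lemma P_is_cmodule:
  assumes x: "x \<in> Ob C"
  shows "is_cmodule C k (P x)"
  unfolding is_cmodule_def
proof (intro conjI ballI impI)
  fix y assume y: "y \<in> Ob C"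
  show "module k (mod_at (P x) y)"
    by (simp add: principal_cmodule_def k.module_free_module)
  fix u assume u: "u \<in> carrier (mod_at (P x) y)"
  have *: "Ide C y \<cdot> g = g" if "g \<in> hom_set C x y" for g using that by (rule Ide_Cmp)
  show "act (P x) (Ide C y) u = u"
    using u y by (intro act_P_eqI) (auto simp: x * mem_P image_iff)
next
  fix f assume f: "f \<in> Arr C"
  have closed: "act (P x) f u h \<in> carrier k"
    if "u \<in> carrier (mod_at (P x) (Dom C f))" for u h
    using act_P_image [OF f x that] act_P_outside [of h f x u] that f mem_P [OF x]
    by (cases "h \<in> (\<lambda>g. f \<cdot> g) ` hom_set C x (Dom C f)") auto
  have mem: "act (P x) f u \<in> carrier (mod_at (P x) (Cod C f))"
    if "u \<in> carrier (mod_at (P x) (Dom C f))" for u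
  proof -
    have "act (P x) f u h = \<zero>\<^bsub>k\<^esub>" if "h \<notin> hom_set C x (Cod C f)" for h
      using that Cmp_hom [OF f] by (intro act_P_outside) auto
    then show ?thesis using closed [OF that] f by (simp add: mem_P x)
  qed
  have carr: "u g \<in> carrier k" if "u \<in> carrier (mod_at (P x) (Dom C f))" for u g
    using that f by (simp add: mem_P x)
  interpret D: module k "mod_at (P x) (Dom C f)"
    by (simp add: principal_cmodule_def k.module_free_module)
  show "act (P x) f \<in> linear_maps k (mod_at (P x) (Dom C f)) (mod_at (P x) (Cod C f))"
  proof (rule linear_mapsI)
    fix u v assume "u \<in> carrier (mod_at (P x) (Dom C f))" "v \<in> carrier (mod_at (P x) (Dom C f))"
    then show "act (P x) f (u \<oplus>\<^bsub>mod_at (P x) (Dom C f)\<^esub> v) =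
        act (P x) f u \<oplus>\<^bsub>mod_at (P x) (Cod C f)\<^esub> act (P x) f v"
      by (intro act_P_eqI f x D.M.a_closed)
         (simp_all add: P_ops act_P_image [OF f x] act_P_outside)
  next
    fix c u assume "c \<in> carrier k" "u \<in> carrier (mod_at (P x) (Dom C f))"
    then show "act (P x) f (c \<odot>\<^bsub>mod_at (P x) (Dom C f)\<^esub> u) =
        c \<odot>\<^bsub>mod_at (P x) (Cod C f)\<^esub> act (P x) f u"
      by (intro act_P_eqI f x D.smult_closed)
         (simp_all add: P_ops act_P_image [OF f x] act_P_outside)
  qed (rule mem)
  fix g u assume g: "g \<in> Arr C" "Cod C f = Dom C g"
    and u: "u \<in> carrier (mod_at (P x) (Dom C f))"
  have assoc: "(g \<cdot> f) \<cdot> h = g \<cdot> (f \<cdot> h)" if "h \<in> hom_set C x (Dom C f)" for h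
    using Cmp_assoc [OF that, of f "Cod C f" g "Cod C g"] f g by (simp add: hom_set_def)
  show "act (P x) (g \<cdot> f) u = act (P x) g (act (P x) f u)"
  proof (rule act_P_eqI)
    fix h assume h: "h \<in> hom_set C x (Dom C (g \<cdot> f))"
    then have h': "h \<in> hom_set C x (Dom C f)" using f g by simp
    then have "f \<cdot> h \<in> hom_set C x (Dom C g)" using Cmp_hom [OF f] g by simp
    then show "act (P x) g (act (P x) f u) ((g \<cdot> f) \<cdot> h) = u h"
      using act_P_image [OF g(1) x, of "act (P x) f u"] mem [OF u] g h' assoc
        act_P_image [OF f x u] by simp
  next
    fix h assume h: "h \<notin> (\<lambda>h. (g \<cdot> f) \<cdot> h) ` hom_set C x (Dom C (g \<cdot> f))"
    show "act (P x) g (act (P x) f u) h = \<zero>\<^bsub>k\<^esub>"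
    \<comment> \<open>An \<open>h\<close> not of the form \<open>(g \<cdot> f) \<cdot> h'\<close> is
      either outside the image of \<open>g\<close>, or equal to \<open>g \<cdot> l\<close> with
      \<open>l\<close> outside the image of \<open>f\<close>; the value is zero in both
      cases.\<close>
    proof (cases "h \<in> (\<lambda>h. g \<cdot> h) ` hom_set C x (Dom C g)")
      case True
      then obtain l where l: "l \<in> hom_set C x (Dom C g)" "h = g \<cdot> l" by blast
      have "l \<notin> (\<lambda>h. f \<cdot> h) ` hom_set C x (Dom C f)"
        using h l f g assoc by (auto simp: image_iff)
      then show ?thesis
        using act_P_image [OF g(1) x, of "act (P x) f u" l] mem [OF u] g l act_P_outside by simp
    qed (rule act_P_outside)
  qed (use f g x u in auto)
qed

lemma P_tame:
  assumes x: "x \<in> Ob C"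
  shows "tame C k (P x)"
proof (rule tameI)
  fix y assume "y \<in> Ob C"
  then show "fin_gen k (mod_at (P x) y)"
    using k.free_module_fin_gen [OF finite_hom [OF x]] by (simp add: principal_cmodule_def)
next
  show "finite {x}" "{x} \<subseteq> Ob C" using x by auto
  fix f assume "stable_at C {x} f"
  then have f: "f \<in> Arr C"
    and ne: "hom_set C x (Cod C f) \<noteq> {} \<Longrightarrow> hom_set C x (Dom C f) \<noteq> {}"
    by (auto simp: stable_at_def)
  \<comment> \<open>An arrow \<open>h\<close> from \<open>x\<close> to \<open>Cod C f\<close>
    exists, so stability at \<open>x\<close> provides an arrow from \<open>x\<close> to
    \<open>Dom C f\<close>, and \<open>Cmp_factor\<close> applies. Composition with \<open>f\<close>
    is thus a bijection of hom sets, which in the extreme case are both empty.\<close>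
  have onto: "h \<in> (\<lambda>g. f \<cdot> g) ` hom_set C x (Dom C f)" if "h \<in> hom_set C x (Cod C f)" for h
    using Cmp_factor [OF f x ne that] that by blast
  show "bij_betw (act (P x) f) (carrier (mod_at (P x) (Dom C f))) (carrier (mod_at (P x) (Cod C f)))"
  proof (rule act_bijI [OF P_is_cmodule [OF x] f])
    fix u assume u: "u \<in> carrier (mod_at (P x) (Dom C f))"
      "act (P x) f u = \<zero>\<^bsub>mod_at (P x) (Cod C f)\<^esub>"
    have "u g = \<zero>\<^bsub>k\<^esub>" for g
      using u act_P_image [OF f x u(1), of g] mem_P [OF x, of "Dom C f" u] f
      by (cases "g \<in> hom_set C x (Dom C f)") (auto simp: P_ops)
    then show "u = \<zero>\<^bsub>mod_at (P x) (Dom C f)\<^esub>" by (auto simp: P_ops)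
  next
    fix w assume w: "w \<in> carrier (mod_at (P x) (Cod C f))"
    define u where "u = (\<lambda>g. if g \<in> hom_set C x (Dom C f) then w (f \<cdot> g) else \<zero>\<^bsub>k\<^esub>)"
    have u: "u \<in> carrier (mod_at (P x) (Dom C f))"
      using w f by (auto simp: mem_P x u_def)
    have "w h = \<zero>\<^bsub>k\<^esub>" if "h \<notin> (\<lambda>g. f \<cdot> g) ` hom_set C x (Dom C f)" for h
      using onto [of h] that w f mem_P [OF x, of "Cod C f" w] by auto
    then have "act (P x) f u = w"
      using u by (intro act_P_eqI f x) (auto simp: u_def)
    with u show "\<exists>u \<in> carrier (mod_at (P x) (Dom C f)). act (P x) f u = w" by blast
  qed
qed

end


section \<open>Finite direct sums and the Yoneda lemma\<close>

lemma dsum_module_simps: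
  "carrier (dsum_module n M) = (\<Pi>\<^sub>E i \<in> {..<n}. carrier (M i))"
  "\<zero>\<^bsub>dsum_module n M\<^esub> = (\<lambda>i \<in> {..<n}. \<zero>\<^bsub>M i\<^esub>)"
  "u \<oplus>\<^bsub>dsum_module n M\<^esub> v = (\<lambda>i \<in> {..<n}. u i \<oplus>\<^bsub>M i\<^esub> v i)"
  "c \<odot>\<^bsub>dsum_module n M\<^esub> u = (\<lambda>i \<in> {..<n}. c \<odot>\<^bsub>M i\<^esub> u i)"
  by (simp_all add: dsum_module_def)

lemma dsum_eqI:
  assumes "u \<in> carrier (dsum_module n M)" "v \<in> carrier (dsum_module n M)"
    and "\<And>i. i < n \<Longrightarrow> u i = v i"
  shows "u = v"
  using assms by (intro PiE_ext) (auto simp: dsum_module_simps)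

lemma (in cring) module_dsum_module:
  assumes M: "\<And>i. i < n \<Longrightarrow> module R (M i)"
  shows "module R (dsum_module n M)"
proof -
  let ?D = "dsum_module n M"
  have add: "u \<oplus>\<^bsub>?D\<^esub> v \<in> carrier ?D" if "u \<in> carrier ?D" "v \<in> carrier ?D" for u v
    using that by (auto simp: dsum_module_simps module_def[of R] abelian_group.axioms
        intro!: abelian_monoid.a_closed abelian_group.axioms(1) module.axioms(2) [OF M])
  have smult: "c \<odot>\<^bsub>?D\<^esub> u \<in> carrier ?D" if "c \<in> carrier R" "u \<in> carrier ?D" for u c
    using that by (auto simp: dsum_module_simps intro!: module.smult_closed [OF M])
  have zero: "\<zero>\<^bsub>?D\<^esub> \<in> carrier ?D"
    by (auto simp: dsum_module_simps
        intro!: abelian_monoid.zero_closed abelian_group.axioms(1) module.axioms(2) [OF M])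
  have at: "u i \<in> carrier (M i)" if "u \<in> carrier ?D" "i < n" for u i
    using that by (auto simp: dsum_module_simps)
  note group = abelian_group.axioms(1) [OF module.axioms(2) [OF M]]
  show ?thesis
  proof (intro moduleI abelian_groupI is_cring add smult zero)
    fix x assume x: "x \<in> carrier ?D"
    have y: "(\<lambda>i \<in> {..<n}. \<ominus>\<^bsub>M i\<^esub> x i) \<in> carrier ?D"
      using at [OF x] by (auto simp: dsum_module_simps intro!: abelian_group.a_inv_closed module.axioms(2) [OF M])
    have "(\<lambda>i \<in> {..<n}. \<ominus>\<^bsub>M i\<^esub> x i) \<oplus>\<^bsub>?D\<^esub> x = \<zero>\<^bsub>?D\<^esub>"
      using at [OF x] by (intro dsum_eqI [OF add [OF y x] zero])
        (simp add: dsum_module_simps abelian_group.l_neg [OF module.axioms(2) [OF M]])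
    with y show "\<exists>y \<in> carrier ?D. y \<oplus>\<^bsub>?D\<^esub> x = \<zero>\<^bsub>?D\<^esub>" by blast
  next
    fix x y z assume *: "x \<in> carrier ?D" "y \<in> carrier ?D" "z \<in> carrier ?D"
    show "x \<oplus>\<^bsub>?D\<^esub> y \<oplus>\<^bsub>?D\<^esub> z = x \<oplus>\<^bsub>?D\<^esub> (y \<oplus>\<^bsub>?D\<^esub> z)"
      using * at by (intro dsum_eqI [of _ n M] add)
        (auto simp: dsum_module_simps abelian_monoid.a_assoc [OF group])
  next
    fix x y assume *: "x \<in> carrier ?D" "y \<in> carrier ?D"
    show "x \<oplus>\<^bsub>?D\<^esub> y = y \<oplus>\<^bsub>?D\<^esub> x"
      using * at by (intro dsum_eqI [of _ n M] add)
        (simp_all add: dsum_module_simps abelian_monoid.a_comm [OF group])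
  next
    fix x assume x: "x \<in> carrier ?D"
    show "\<zero>\<^bsub>?D\<^esub> \<oplus>\<^bsub>?D\<^esub> x = x"
      using x at [OF x] by (intro dsum_eqI [OF add [OF zero x] x])
        (simp add: dsum_module_simps abelian_monoid.l_zero [OF group])
    show "\<one> \<odot>\<^bsub>?D\<^esub> x = x"
      using x at [OF x] by (intro dsum_eqI [OF smult [OF one_closed x] x])
        (simp add: dsum_module_simps module.smult_one [OF M])
  next
    fix a b x assume *: "a \<in> carrier R" "b \<in> carrier R" "x \<in> carrier ?D"
    show "(a \<oplus> b) \<odot>\<^bsub>?D\<^esub> x = a \<odot>\<^bsub>?D\<^esub> x \<oplus>\<^bsub>?D\<^esub> b \<odot>\<^bsub>?D\<^esub> x"
      using * at by (intro dsum_eqI [of _ n M] add smult)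
        (auto simp: dsum_module_simps module.smult_l_distr [OF M])
    show "a \<otimes> b \<odot>\<^bsub>?D\<^esub> x = a \<odot>\<^bsub>?D\<^esub> (b \<odot>\<^bsub>?D\<^esub> x)"
      using * at by (intro dsum_eqI [of _ n M] smult)
        (auto simp: dsum_module_simps module.smult_assoc1 [OF M])
  next
    fix a x y assume *: "a \<in> carrier R" "x \<in> carrier ?D" "y \<in> carrier ?D"
    show "a \<odot>\<^bsub>?D\<^esub> (x \<oplus>\<^bsub>?D\<^esub> y) = a \<odot>\<^bsub>?D\<^esub> x \<oplus>\<^bsub>?D\<^esub> a \<odot>\<^bsub>?D\<^esub> y"
      using * at by (intro dsum_eqI [of _ n M] add smult)
        (auto simp: dsum_module_simps module.smult_r_distr [OF M])
  qed
qed

context cmods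
begin

lemma mod_at_dsum [simp]: "mod_at (dsum_cmodule n V) x = dsum_module n (\<lambda>i. mod_at (V i) x)"
  and act_dsum: "act (dsum_cmodule n V) f u = (\<lambda>i \<in> {..<n}. act (V i) f (u i))"
  by (simp_all add: dsum_cmodule_def)

lemma dsum_is_cmodule:
  assumes V: "\<And>i. i < n \<Longrightarrow> is_cmodule C k (V i)"
  shows "is_cmodule C k (dsum_cmodule n V)"
  unfolding is_cmodule_def
proof (intro conjI ballI impI)
  fix x assume x: "x \<in> Ob C"
  show "module k (mod_at (dsum_cmodule n V) x)"
    unfolding mod_at_dsum using module_at [OF V x] by (rule k.module_dsum_module)
  show "act (dsum_cmodule n V) (Ide C x) u = u" if "u \<in> carrier (mod_at (dsum_cmodule n V) x)" for u
    using that act_Ide [OF V x]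
    by (intro PiE_ext [of _ "{..<n}" "\<lambda>i. carrier (mod_at (V i) x)"])
       (auto simp: dsum_module_simps act_dsum PiE_iff)
next
  fix f assume f: "f \<in> Arr C"
  show "act (dsum_cmodule n V) f
      \<in> linear_maps k (mod_at (dsum_cmodule n V) (Dom C f)) (mod_at (dsum_cmodule n V) (Cod C f))"
    by (intro linear_mapsI)
       (auto simp: dsum_module_simps act_dsum fun_eq_iff act_closed [OF V f] PiE_iff
          module_hom.add [OF act_hom [OF V f]] module_hom.smult [OF act_hom [OF V f]])
  show "act (dsum_cmodule n V) (g \<cdot> f) u = act (dsum_cmodule n V) g (act (dsum_cmodule n V) f u)"
    if "g \<in> Arr C" "Cod C f = Dom C g" "u \<in> carrier (mod_at (dsum_cmodule n V) (Dom C f))" for g u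
    using that f act_Cmp [OF V] by (auto simp: dsum_module_simps act_dsum fun_eq_iff PiE_iff)
qed

text \<open>Generators of the sum are the generators of the summands placed in one coordinate by the
  linear maps \<open>ins i\<close>; a submodule containing them contains every
  \<open>ins i (u i)\<close>, and these add up to \<open>u\<close>.\<close>

lemma fin_gen_dsum:
  assumes M: "\<And>i. i < n \<Longrightarrow> module k (M i)" and fg: "\<And>i. i < n \<Longrightarrow> fin_gen k (M i)"
  shows "fin_gen k (dsum_module n M)"
proof -
  let ?D = "dsum_module n M"
  interpret D: module k ?D using M by (rule k.module_dsum_module)
  have "\<exists>B. finite B \<and> B \<subseteq> carrier (M i) \<and> carrier (M i) \<subseteq> span k (M i) B" if "i < n" for i
    using fg [OF that] by (simp add: fin_gen_def)
  then obtain B where B: "\<And>i. i < n \<Longrightarrow> finite (B i)" "\<And>i. i < n \<Longrightarrow> B i \<subseteq> carrier (M i)"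
      "\<And>i. i < n \<Longrightarrow> carrier (M i) \<subseteq> span k (M i) (B i)" by metis
  define ins where "ins = (\<lambda>i b. \<lambda>j \<in> {..<n}. if j = i then b else \<zero>\<^bsub>M j\<^esub>)"
  have zero [simp]: "\<zero>\<^bsub>M j\<^esub> \<in> carrier (M j)" "\<zero>\<^bsub>M j\<^esub> \<oplus>\<^bsub>M j\<^esub> \<zero>\<^bsub>M j\<^esub> = \<zero>\<^bsub>M j\<^esub>"
    "c \<in> carrier k \<Longrightarrow> c \<odot>\<^bsub>M j\<^esub> \<zero>\<^bsub>M j\<^esub> = \<zero>\<^bsub>M j\<^esub>"
    "u \<in> carrier (M j) \<Longrightarrow> u \<oplus>\<^bsub>M j\<^esub> \<zero>\<^bsub>M j\<^esub> = u"
    "u \<in> carrier (M j) \<Longrightarrow> \<zero>\<^bsub>M j\<^esub> \<oplus>\<^bsub>M j\<^esub> u = u" if "j < n" for j c u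
  proof -
    interpret module k "M j" using M that .
    show "\<zero>\<^bsub>M j\<^esub> \<in> carrier (M j)" "\<zero>\<^bsub>M j\<^esub> \<oplus>\<^bsub>M j\<^esub> \<zero>\<^bsub>M j\<^esub> = \<zero>\<^bsub>M j\<^esub>" by simp_all
    show "c \<in> carrier k \<Longrightarrow> c \<odot>\<^bsub>M j\<^esub> \<zero>\<^bsub>M j\<^esub> = \<zero>\<^bsub>M j\<^esub>"
      "u \<in> carrier (M j) \<Longrightarrow> u \<oplus>\<^bsub>M j\<^esub> \<zero>\<^bsub>M j\<^esub> = u"
      "u \<in> carrier (M j) \<Longrightarrow> \<zero>\<^bsub>M j\<^esub> \<oplus>\<^bsub>M j\<^esub> u = u" by simp_all
  qed
  have ins: "module_hom k (M i) ?D (ins i)" if i: "i < n" for i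
  proof (intro module_hom.intro M i D.module_axioms module_hom_axioms.intro linear_mapsI)
    fix u v c assume "u \<in> carrier (M i)" "v \<in> carrier (M i)"
    then show "ins i (u \<oplus>\<^bsub>M i\<^esub> v) = ins i u \<oplus>\<^bsub>?D\<^esub> ins i v" "ins i u \<in> carrier ?D"
      by (auto simp: ins_def dsum_module_simps fun_eq_iff)
    assume "c \<in> carrier k"
    then show "ins i (c \<odot>\<^bsub>M i\<^esub> u) = c \<odot>\<^bsub>?D\<^esub> ins i u"
      by (auto simp: ins_def dsum_module_simps fun_eq_iff)
  qed
  define E where "E = (\<Union>i<n. ins i ` B i)"
  have "u \<in> L" if u: "u \<in> carrier ?D" and L: "submodule L k ?D" "E \<subseteq> L" for u L
  proof -
    have uc: "u i \<in> carrier (M i)" if "i < n" for i using u that by (auto simp: dsum_module_simps)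
    have insL: "ins i (u i) \<in> L" if i: "i < n" for i
    proof -
      interpret module_hom k "M i" ?D "ins i" by (rule ins [OF i])
      have "span k (M i) (B i) \<subseteq> {v \<in> carrier (M i). ins i v \<in> L}"
        using L(2) B(2) [OF i] i
        by (intro M.span_minimal [OF preimage_submodule [OF L(1)]]) (auto simp: E_def)
      then show ?thesis using B(3) [OF i] uc [OF i] by blast
    qed
    \<comment> \<open>The truncation of \<open>u\<close> to its first \<open>m\<close> coordinates;
      each step adds one inserted coordinate, and \<open>m = n\<close> gives back \<open>u\<close>
      because \<open>u\<close> is extensional.\<close>
    have "(\<lambda>j \<in> {..<n}. if j < m then u j else \<zero>\<^bsub>M j\<^esub>) \<in> L" if "m \<le> n" for m
      using that
    proof (induction m)
      case 0
      have "(\<lambda>j \<in> {..<n}. if j < 0 then u j else \<zero>\<^bsub>M j\<^esub>) = \<zero>\<^bsub>?D\<^esub>"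
        by (simp add: dsum_module_simps)
      then show ?case using D.submodule_zero [OF L(1)] by argo
    next
      case (Suc m)
      then have "(\<lambda>j \<in> {..<n}. if j < m then u j else \<zero>\<^bsub>M j\<^esub>) \<in> L" by linarith
      then have "(\<lambda>j \<in> {..<n}. if j < m then u j else \<zero>\<^bsub>M j\<^esub>) \<oplus>\<^bsub>?D\<^esub> ins m (u m) \<in> L"
        using Suc.prems by (intro D.submoduleE(5) [OF L(1)] insL) simp_all
      also have "(\<lambda>j \<in> {..<n}. if j < m then u j else \<zero>\<^bsub>M j\<^esub>) \<oplus>\<^bsub>?D\<^esub> ins m (u m)
          = (\<lambda>j \<in> {..<n}. if j < Suc m then u j else \<zero>\<^bsub>M j\<^esub>)"
        using uc by (auto simp: dsum_module_simps ins_def fun_eq_iff)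
      finally show ?case .
    qed
    from this [OF order_refl] have "(\<lambda>j \<in> {..<n}. if j < n then u j else \<zero>\<^bsub>M j\<^esub>) \<in> L" .
    also have "(\<lambda>j \<in> {..<n}. if j < n then u j else \<zero>\<^bsub>M j\<^esub>) = u"
      using u by (auto simp: dsum_module_simps fun_eq_iff PiE_def extensional_def)
    finally show ?thesis .
  qed
  then have "carrier ?D \<subseteq> span k ?D E" by (auto simp: span_def)
  moreover have "E \<subseteq> carrier ?D"
    using B(2) linear_maps_closed [OF module_hom.linear [OF ins]] by (auto simp: E_def)
  ultimately show ?thesis
    using B(1) unfolding fin_gen_def by (intro exI [of _ E]) (simp add: E_def)
qed

text \<open>The union of the finitely many threshold sets works for all summands at once, and the
  action on the sum is coordinatewise.\<close>

lemma dsum_tame: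
  assumes V: "\<And>i. i < n \<Longrightarrow> is_cmodule C k (V i)" and tame: "\<And>i. i < n \<Longrightarrow> tame C k (V i)"
  shows "tame C k (dsum_cmodule n V)"
proof -
  have "\<exists>A. finite A \<and> A \<subseteq> Ob C \<and> (\<forall>f. stable_at C A f \<longrightarrow>
      bij_betw (act (V i) f) (carrier (mod_at (V i) (Dom C f))) (carrier (mod_at (V i) (Cod C f))))"
    if "i < n" for i
    using tame [OF that] by (rule tameE) blast
  then obtain A where A: "\<And>i. i < n \<Longrightarrow> finite (A i)" "\<And>i. i < n \<Longrightarrow> A i \<subseteq> Ob C"
    "\<And>i f. i < n \<Longrightarrow> stable_at C (A i) f \<Longrightarrow>
      bij_betw (act (V i) f) (carrier (mod_at (V i) (Dom C f))) (carrier (mod_at (V i) (Cod C f)))"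
    by metis
  show ?thesis
  proof (rule tameI)
    show "fin_gen k (mod_at (dsum_cmodule n V) x)" if x: "x \<in> Ob C" for x
      unfolding mod_at_dsum using x tame
      by (intro fin_gen_dsum module_at [OF V]) (auto simp: tame_def)
    show "finite (\<Union>i<n. A i)" "(\<Union>i<n. A i) \<subseteq> Ob C" using A(1,2) by auto
    fix f assume st: "stable_at C (\<Union>i<n. A i) f"
    have bij: "bij_betw (act (V i) f) (carrier (mod_at (V i) (Dom C f)))
        (carrier (mod_at (V i) (Cod C f)))" if "i < n" for i
      using that st by (intro A(3)) (auto simp: stable_at_def)
    show "bij_betw (act (dsum_cmodule n V) f) (carrier (mod_at (dsum_cmodule n V) (Dom C f)))
        (carrier (mod_at (dsum_cmodule n V) (Cod C f)))"
      unfolding bij_betw_def mod_at_dsum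
    proof (intro conjI inj_onI equalityI subsetI)
      fix u v
      assume u: "u \<in> carrier (dsum_module n (\<lambda>i. mod_at (V i) (Dom C f)))"
        and v: "v \<in> carrier (dsum_module n (\<lambda>i. mod_at (V i) (Dom C f)))"
        and eq: "act (dsum_cmodule n V) f u = act (dsum_cmodule n V) f v"
      show "u = v"
      proof (rule dsum_eqI [OF u v])
        fix i assume i: "i < n"
        have "act (V i) f (u i) = act (V i) f (v i)"
          using fun_cong [OF eq, of i] i by (simp add: act_dsum)
        then show "u i = v i"
          using bij [OF i] u v i by (auto simp: bij_betw_def dsum_module_simps PiE_iff dest: inj_onD)
      qed
    next
      fix w assume w: "w \<in> carrier (dsum_module n (\<lambda>i. mod_at (V i) (Cod C f)))"
      define u where "u = (\<lambda>i \<in> {..<n}. inv_into (carrier (mod_at (V i) (Dom C f))) (act (V i) f) (w i))"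
      have wi: "w i \<in> act (V i) f ` carrier (mod_at (V i) (Dom C f))" if "i < n" for i
        using bij [OF that] w that by (auto simp: bij_betw_def dsum_module_simps PiE_iff)
      have "u \<in> carrier (dsum_module n (\<lambda>i. mod_at (V i) (Dom C f)))"
        using inv_into_into [OF wi] by (auto simp: u_def dsum_module_simps)
      moreover have "act (dsum_cmodule n V) f u = w"
        using f_inv_into_f [OF wi] w
        by (intro dsum_eqI [OF _ w]) (auto simp: act_dsum u_def dsum_module_simps PiE_iff)
      ultimately show "w \<in> act (dsum_cmodule n V) f `
          carrier (dsum_module n (\<lambda>i. mod_at (V i) (Dom C f)))" by blast
    next
      fix w assume "w \<in> act (dsum_cmodule n V) f `
          carrier (dsum_module n (\<lambda>i. mod_at (V i) (Dom C f)))"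
      then show "w \<in> carrier (dsum_module n (\<lambda>i. mod_at (V i) (Cod C f)))"
        using st act_closed [OF V]
        by (auto simp: dsum_module_simps act_dsum PiE_iff stable_at_def)
    qed
  qed
qed

lemma dsum_cmap:
  fixes W :: "nat \<Rightarrow> ('o, 'a, 'k, 'w) cmodule"
  assumes V: "is_cmodule C k V" and \<psi>: "\<And>i. i < n \<Longrightarrow> cmap C k (W i) V (\<psi> i)"
  shows "cmap C k (dsum_cmodule n W) V (\<lambda>x u. \<Oplus>\<^bsub>mod_at V x\<^esub>i \<in> {..<n}. \<psi> i x (u i))"
proof (unfold_locales)
  show "is_cmodule C k (dsum_cmodule n W)"
    using cmap.source [OF \<psi>] by (rule dsum_is_cmodule)
  have hom: "module_hom k (mod_at (W i) x) (mod_at V x) (\<psi> i x)" if "i < n" "x \<in> Ob C" for i x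
    using cmap.hom_at [OF \<psi>] that by blast
  have closed: "\<psi> i x (u i) \<in> carrier (mod_at V x)"
    if "i < n" "x \<in> Ob C" "u \<in> carrier (mod_at (dsum_cmodule n W) x)" for i x u
    using cmap.closed [OF \<psi>] that by (auto simp: dsum_module_simps)
  show "natural C k (dsum_cmodule n W) V (\<lambda>x u. \<Oplus>\<^bsub>mod_at V x\<^esub>i \<in> {..<n}. \<psi> i x (u i))"
    unfolding natural_def
  proof (intro conjI ballI linear_mapsI)
    fix x u v c assume x: "x \<in> Ob C" and u: "u \<in> carrier (mod_at (dsum_cmodule n W) x)"
    interpret M: module k "mod_at V x" by (rule module_at [OF V x])
    show "(\<Oplus>\<^bsub>mod_at V x\<^esub>i \<in> {..<n}. \<psi> i x (u i)) \<in> carrier (mod_at V x)"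
      using closed x u by (intro M.M.finsum_closed) auto
    show "(\<Oplus>\<^bsub>mod_at V x\<^esub>i \<in> {..<n}. \<psi> i x ((u \<oplus>\<^bsub>mod_at (dsum_cmodule n W) x\<^esub> v) i)) =
      (\<Oplus>\<^bsub>mod_at V x\<^esub>i \<in> {..<n}. \<psi> i x (u i)) \<oplus>\<^bsub>mod_at V x\<^esub> (\<Oplus>\<^bsub>mod_at V x\<^esub>i \<in> {..<n}. \<psi> i x (v i))"
      if v: "v \<in> carrier (mod_at (dsum_cmodule n W) x)"
    proof -
      have "(\<Oplus>\<^bsub>mod_at V x\<^esub>i \<in> {..<n}. \<psi> i x ((u \<oplus>\<^bsub>mod_at (dsum_cmodule n W) x\<^esub> v) i)) =
          (\<Oplus>\<^bsub>mod_at V x\<^esub>i \<in> {..<n}. \<psi> i x (u i) \<oplus>\<^bsub>mod_at V x\<^esub> \<psi> i x (v i))"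
        using closed x u v
        by (intro M.M.finsum_cong')
           (auto simp: dsum_module_simps PiE_iff module_hom.add [OF hom])
      then show ?thesis using closed x u v by (simp add: M.M.finsum_addf Pi_iff)
    qed
    show "(\<Oplus>\<^bsub>mod_at V x\<^esub>i \<in> {..<n}. \<psi> i x ((c \<odot>\<^bsub>mod_at (dsum_cmodule n W) x\<^esub> u) i)) =
      c \<odot>\<^bsub>mod_at V x\<^esub> (\<Oplus>\<^bsub>mod_at V x\<^esub>i \<in> {..<n}. \<psi> i x (u i))" if c: "c \<in> carrier k"
    proof -
      have "(\<Oplus>\<^bsub>mod_at V x\<^esub>i \<in> {..<n}. \<psi> i x ((c \<odot>\<^bsub>mod_at (dsum_cmodule n W) x\<^esub> u) i)) =
          (\<Oplus>\<^bsub>mod_at V x\<^esub>i \<in> {..<n}. c \<odot>\<^bsub>mod_at V x\<^esub> \<psi> i x (u i))"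
        using closed x u c
        by (intro M.M.finsum_cong')
           (auto simp: dsum_module_simps PiE_iff module_hom.smult [OF hom])
      then show ?thesis using closed x u c by (simp add: M.finsum_smult_ldistr Pi_iff)
    qed
  next
    fix f u assume f: "f \<in> Arr C" and u: "u \<in> carrier (mod_at (dsum_cmodule n W) (Dom C f))"
    interpret A: module_hom k "mod_at V (Dom C f)" "mod_at V (Cod C f)" "act V f"
      by (rule act_hom [OF V f])
    have "(\<Oplus>\<^bsub>mod_at V (Cod C f)\<^esub>i \<in> {..<n}. \<psi> i (Cod C f) (act (dsum_cmodule n W) f u i)) =
        (\<Oplus>\<^bsub>mod_at V (Cod C f)\<^esub>i \<in> {..<n}. act V f (\<psi> i (Dom C f) (u i)))"
      using closed [OF _ _ u] f u cmap.naturality [OF \<psi> f]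
      by (intro A.N.M.finsum_cong') (auto simp: act_dsum dsum_module_simps PiE_iff)
    then show "(\<Oplus>\<^bsub>mod_at V (Cod C f)\<^esub>i \<in> {..<n}. \<psi> i (Cod C f) (act (dsum_cmodule n W) f u i)) =
        act V f (\<Oplus>\<^bsub>mod_at V (Dom C f)\<^esub>i \<in> {..<n}. \<psi> i (Dom C f) (u i))"
      using closed [OF _ _ u] f by (simp add: A.finsum Pi_iff)
  qed
qed (rule V)

end

context combinatorial
begin

text \<open>The map from \<open>P x\<close> to \<open>V\<close> that corresponds to \<open>v\<close>
  under the Yoneda lemma: the linear extension of sending the basis vector at \<open>g\<close> to
  \<open>V(g) v\<close>.\<close>

definition yoneda :: "('o, 'a, 'k, 'm) cmodule \<Rightarrow> 'o \<Rightarrow> 'm \<Rightarrow> 'o \<Rightarrow> ('a \<Rightarrow> 'k) \<Rightarrow> 'm" where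
  "yoneda V x v = (\<lambda>y u. \<Oplus>\<^bsub>mod_at V y\<^esub>g \<in> hom_set C x y. u g \<odot>\<^bsub>mod_at V y\<^esub> act V g v)"

lemma yoneda_cmap:
  assumes V: "is_cmodule C k V" and x: "x \<in> Ob C" and v: "v \<in> carrier (mod_at V x)"
  shows "cmap C k (P x) V (yoneda V x v)"
proof (unfold_locales, rule P_is_cmodule [OF x], rule V, unfold natural_def, intro conjI ballI linear_mapsI)
  fix y u c w assume y: "y \<in> Ob C" and u: "u \<in> carrier (mod_at (P x) y)"
  interpret M: module k "mod_at V y" by (rule module_at [OF V y])
  have av: "act V g v \<in> carrier (mod_at V y)" if "g \<in> hom_set C x y" for g
    using act_closed [OF V, of g v] that v by (auto simp: hom_set_def)
  have uk: "u g \<in> carrier k" for g using u by (simp add: mem_P x y)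
  show "yoneda V x v y u \<in> carrier (mod_at V y)"
    using av uk by (auto simp: yoneda_def intro!: M.M.finsum_closed)
  show "yoneda V x v y (u \<oplus>\<^bsub>mod_at (P x) y\<^esub> w) = yoneda V x v y u \<oplus>\<^bsub>mod_at V y\<^esub> yoneda V x v y w"
    if w: "w \<in> carrier (mod_at (P x) y)"
  proof -
    have wk: "w g \<in> carrier k" for g using w by (simp add: mem_P x y)
    have "yoneda V x v y (u \<oplus>\<^bsub>mod_at (P x) y\<^esub> w) = (\<Oplus>\<^bsub>mod_at V y\<^esub>g \<in> hom_set C x y.
        u g \<odot>\<^bsub>mod_at V y\<^esub> act V g v \<oplus>\<^bsub>mod_at V y\<^esub> w g \<odot>\<^bsub>mod_at V y\<^esub> act V g v)"
      unfolding yoneda_def using av uk wk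
      by (intro M.M.finsum_cong') (auto simp: P_ops M.smult_l_distr)
    then show ?thesis using av uk wk by (simp add: yoneda_def M.M.finsum_addf Pi_iff)
  qed
  show "yoneda V x v y (c \<odot>\<^bsub>mod_at (P x) y\<^esub> u) = c \<odot>\<^bsub>mod_at V y\<^esub> yoneda V x v y u"
    if c: "c \<in> carrier k"
  proof -
    have "yoneda V x v y (c \<odot>\<^bsub>mod_at (P x) y\<^esub> u) = (\<Oplus>\<^bsub>mod_at V y\<^esub>g \<in> hom_set C x y.
        c \<odot>\<^bsub>mod_at V y\<^esub> (u g \<odot>\<^bsub>mod_at V y\<^esub> act V g v))"
      unfolding yoneda_def using av uk c
      by (intro M.M.finsum_cong') (auto simp: P_ops M.smult_assoc1)
    then show ?thesis
      using av uk c finite_hom [OF x y] by (simp add: yoneda_def M.finsum_smult_ldistr Pi_iff)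
  qed
next
  fix f u assume f: "f \<in> Arr C" and u: "u \<in> carrier (mod_at (P x) (Dom C f))"
  let ?y = "Dom C f" and ?z = "Cod C f"
  interpret module_hom k "mod_at V ?y" "mod_at V ?z" "act V f" by (rule act_hom [OF V f])
  have av: "act V g v \<in> carrier (mod_at V y)" if "g \<in> hom_set C x y" for g y
    using act_closed [OF V, of g v] that v by (auto simp: hom_set_def)
  have uk: "u g \<in> carrier k" for g using u f by (simp add: mem_P x)
  have fuk: "act (P x) f u h \<in> carrier k" for h
    using act_closed [OF P_is_cmodule [OF x] f u] f by (simp add: mem_P x)
  have sub: "(\<lambda>g. f \<cdot> g) ` hom_set C x ?y \<subseteq> hom_set C x ?z" using Cmp_hom [OF f] by auto
  have inj: "inj_on (\<lambda>g. f \<cdot> g) (hom_set C x ?y)"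
    using Cmp_cancel [OF f x] by (auto intro: inj_onI)
  \<comment> \<open>The vector \<open>act (P x) f u\<close> is supported on the arrows of the form
    \<open>f \<cdot> g\<close>. The sum is therefore cut down to these and then reindexed along the
    injection sending \<open>g\<close> to \<open>f \<cdot> g\<close>.\<close>
  have "yoneda V x v ?z (act (P x) f u) = (\<Oplus>\<^bsub>mod_at V ?z\<^esub>h \<in> (\<lambda>g. f \<cdot> g) ` hom_set C x ?y.
      act (P x) f u h \<odot>\<^bsub>mod_at V ?z\<^esub> act V h v)"
    unfolding yoneda_def using sub av fuk finite_hom [OF x] f act_P_outside
    by (intro N.M.add.finprod_mono_neutral_cong_right) auto
  also have "\<dots> = (\<Oplus>\<^bsub>mod_at V ?z\<^esub>g \<in> hom_set C x ?y.
      act (P x) f u (f \<cdot> g) \<odot>\<^bsub>mod_at V ?z\<^esub> act V (f \<cdot> g) v)"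
    using sub av fuk by (intro N.M.finsum_reindex inj) auto
  also have "\<dots> = (\<Oplus>\<^bsub>mod_at V ?z\<^esub>g \<in> hom_set C x ?y. act V f (u g \<odot>\<^bsub>mod_at V ?y\<^esub> act V g v))"
  proof (rule N.M.finsum_cong')
    show "(\<lambda>g. act V f (u g \<odot>\<^bsub>mod_at V ?y\<^esub> act V g v)) \<in> hom_set C x ?y \<rightarrow> carrier (mod_at V ?z)"
      using av uk by auto
    fix g assume g: "g \<in> hom_set C x ?y"
    then have "act V (f \<cdot> g) v = act V f (act V g v)"
      using act_Cmp [OF V, of g f v] f v by (auto simp: hom_set_def)
    then show "act (P x) f u (f \<cdot> g) \<odot>\<^bsub>mod_at V ?z\<^esub> act V (f \<cdot> g) v =
        act V f (u g \<odot>\<^bsub>mod_at V ?y\<^esub> act V g v)"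
      using act_P_image [OF f x u g] av [OF g] uk by (simp add: smult)
  qed simp
  also have "\<dots> = act V f (yoneda V x v ?y u)"
    unfolding yoneda_def using av uk finite_hom [OF x] f by (subst finsum) auto
  finally show "yoneda V x v ?z (act (P x) f u) = act V f (yoneda V x v ?y u)" .
qed

lemma yoneda_generator:
  assumes V: "is_cmodule C k V" and x: "x \<in> Ob C" and v: "v \<in> carrier (mod_at V x)"
  shows "v \<in> yoneda V x v x ` carrier (mod_at (P x) x)"
proof -
  interpret M: module k "mod_at V x" by (rule module_at [OF V x])
  \<comment> \<open>The basis vector at the identity of \<open>x\<close>, which the Yoneda map sends
    to \<open>v\<close>.\<close>
  define u where "u = (\<lambda>g. if g = Ide C x then \<one>\<^bsub>k\<^esub> else \<zero>\<^bsub>k\<^esub>)"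
  have I: "Ide C x \<in> hom_set C x x" using Ide_in_hom x .
  have av: "act V g v \<in> carrier (mod_at V x)" if "g \<in> hom_set C x x" for g
    using act_closed [OF V, of g v] that v by (auto simp: hom_set_def)
  have "yoneda V x v x u = (\<Oplus>\<^bsub>mod_at V x\<^esub>g \<in> hom_set C x x. if Ide C x = g then act V g v else \<zero>\<^bsub>mod_at V x\<^esub>)"
    unfolding yoneda_def using av by (intro M.M.finsum_cong') (auto simp: u_def)
  also have "\<dots> = act V (Ide C x) v"
    using av finite_hom [OF x x] by (intro M.M.finsum_singleton I) auto
  also have "\<dots> = v" by (rule act_Ide [OF V x v])
  finally have "yoneda V x v x u = v" .
  moreover have "u \<in> carrier (mod_at (P x) x)" using I by (auto simp: mem_P x u_def)
  ultimately show ?thesis by (metis imageI)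
qed

end


section \<open>Finitely presented modules are the tame ones\<close>

context cmods
begin

lemma dsum_cmap_image:
  fixes W :: "nat \<Rightarrow> ('o, 'a, 'k, 'w) cmodule"
  assumes V: "is_cmodule C k V" and \<psi>: "\<And>i. i < n \<Longrightarrow> cmap C k (W i) V (\<psi> i)"
    and i: "i < n" and x: "x \<in> Ob C" and w: "w \<in> carrier (mod_at (W i) x)"
  shows "\<psi> i x w \<in> (\<lambda>u. \<Oplus>\<^bsub>mod_at V x\<^esub>i \<in> {..<n}. \<psi> i x (u i)) ` carrier (mod_at (dsum_cmodule n W) x)"
proof -
  interpret M: module k "mod_at V x" by (rule module_at [OF V x])
  define u where "u = (\<lambda>j \<in> {..<n}. if j = i then w else \<zero>\<^bsub>mod_at (W j) x\<^esub>)"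
  have zero: "\<zero>\<^bsub>mod_at (W j) x\<^esub> \<in> carrier (mod_at (W j) x)" if "j < n" for j
    using module_at [OF cmap.source [OF \<psi> [OF that]] x]
    by (simp add: abelian_monoid.zero_closed abelian_group.axioms(1) module.axioms(2))
  have u: "u \<in> carrier (mod_at (dsum_cmodule n W) x)"
    using w zero by (auto simp: u_def dsum_module_simps)
  have ui: "\<psi> j x (u j) \<in> carrier (mod_at V x)" if "j < n" for j
    using cmap.closed [OF \<psi> x] u that by (auto simp: dsum_module_simps)
  have "(\<Oplus>\<^bsub>mod_at V x\<^esub>j \<in> {..<n}. \<psi> j x (u j)) =
      (\<Oplus>\<^bsub>mod_at V x\<^esub>j \<in> {..<n}. if i = j then \<psi> j x (u j) else \<zero>\<^bsub>mod_at V x\<^esub>)"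
  proof (rule M.M.finsum_cong')
    fix j assume "j \<in> {..<n}"
    then show "\<psi> j x (u j) = (if i = j then \<psi> j x (u j) else \<zero>\<^bsub>mod_at V x\<^esub>)"
      using cmap.zero_at [OF \<psi> x] by (auto simp: u_def)
  qed (use ui in auto)
  also have "\<dots> = \<psi> i x (u i)"
    using ui i by (intro M.M.finsum_singleton) auto
  also have "\<dots> = \<psi> i x w" using i by (simp add: u_def)
  finally show ?thesis using u by (metis (no_types, lifting) imageI)
qed

end

context combinatorial
begin

abbreviation free :: "nat \<Rightarrow> (nat \<Rightarrow> 'o) \<Rightarrow> ('o, 'a, 'k, nat \<Rightarrow> 'a \<Rightarrow> 'k) cmodule" where
  "free n X \<equiv> dsum_cmodule n (\<lambda>i. P (X i))"

lemma free_tame: "X \<in> {..<n} \<rightarrow> Ob C \<Longrightarrow> tame C k (free n X)"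
  by (intro dsum_tame P_is_cmodule P_tame) auto

lemma free_is_cmodule: "X \<in> {..<n} \<rightarrow> Ob C \<Longrightarrow> is_cmodule C k (free n X)"
  by (intro dsum_is_cmodule P_is_cmodule) auto

text \<open>Every object \<open>y\<close> receives an arrow stable at \<open>A\<close> from a join
  of a subset of \<open>A\<close>, so \<open>V(y)\<close> is the bijective image of the value of
  \<open>V\<close> at that join. A map onto \<open>V\<close> at the finitely many joins is therefore
  onto everywhere, by naturality.\<close>

lemma tame_free_cover:
  assumes V: "is_cmodule C k V" and tame: "tame C k V"
  obtains n X \<Psi> where "X \<in> {..<n} \<rightarrow> Ob C" "cmap C k (free n X) V \<Psi>"
    "\<And>x. x \<in> Ob C \<Longrightarrow> \<Psi> x ` carrier (mod_at (free n X) x) = carrier (mod_at V x)"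
proof -
  obtain A where A: "finite A" "A \<subseteq> Ob C" "\<And>f. stable_at C A f \<Longrightarrow>
    bij_betw (act V f) (carrier (mod_at V (Dom C f))) (carrier (mod_at V (Cod C f)))"
    using tame by (rule tameE) blast
  have "\<exists>j \<in> Ob C. \<forall>y \<in> Ob C. hom_set C j y \<noteq> {} \<longleftrightarrow> (\<forall>a \<in> S. hom_set C a y \<noteq> {})" if "S \<subseteq> A" for S
    using that A by (intro join) (auto intro: finite_subset)
  then obtain J where J: "\<And>S. S \<subseteq> A \<Longrightarrow> J S \<in> Ob C"
    "\<And>S y. S \<subseteq> A \<Longrightarrow> y \<in> Ob C \<Longrightarrow> hom_set C (J S) y \<noteq> {} \<longleftrightarrow> (\<forall>a \<in> S. hom_set C a y \<noteq> {})"
    by metis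
  have "\<exists>B. finite B \<and> B \<subseteq> carrier (mod_at V x) \<and> carrier (mod_at V x) \<subseteq> span k (mod_at V x) B"
    if "x \<in> Ob C" for x
    using tame that unfolding tame_def fin_gen_def by blast
  then obtain B where B: "\<And>x. x \<in> Ob C \<Longrightarrow> finite (B x)"
    "\<And>x. x \<in> Ob C \<Longrightarrow> B x \<subseteq> carrier (mod_at V x)"
    "\<And>x. x \<in> Ob C \<Longrightarrow> carrier (mod_at V x) \<subseteq> span k (mod_at V x) (B x)"
    by metis
  \<comment> \<open>One generator for each pair of a join and a member of the finite generating set
    there. After enumeration by \<open>e\<close>, the object of the \<open>i\<close>-th generator is
    \<open>X i\<close> and the element is \<open>snd (e i)\<close>.\<close>
  define G where "G = Sigma (J ` Pow A) B"
  have "finite G"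
    unfolding G_def using A(1) J(1) B(1) by (intro finite_SigmaI) auto
  then obtain e where e: "bij_betw e {0..<card G} G"
    using ex_bij_betw_nat_finite by blast
  define n where "n = card G"
  define X where "X = (\<lambda>i. fst (e i))"
  have eG: "e i \<in> G" if "i < n" for i using e that by (auto simp: n_def bij_betw_def)
  have X: "X i \<in> Ob C" if "i < n" for i using eG [OF that] J(1) by (auto simp: G_def X_def)
  have v: "snd (e i) \<in> carrier (mod_at V (X i))" if "i < n" for i
    using eG [OF that] X [OF that] B(2) by (fastforce simp: G_def X_def)
  define \<psi> where "\<psi> = (\<lambda>i. yoneda V (X i) (snd (e i)))"
  have \<psi>: "cmap C k (P (X i)) V (\<psi> i)" if "i < n" for i
    unfolding \<psi>_def using V X [OF that] v [OF that] by (rule yoneda_cmap)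
  define \<Psi> where "\<Psi> = (\<lambda>x u. \<Oplus>\<^bsub>mod_at V x\<^esub>i \<in> {..<n}. \<psi> i x (u i))"
  have \<Psi>: "cmap C k (free n X) V \<Psi>"
    unfolding \<Psi>_def using V \<psi> by (rule dsum_cmap)
  interpret \<Psi>: cmap C k "free n X" V \<Psi> by (rule \<Psi>)
  have onto_J: "carrier (mod_at V (J S)) \<subseteq> \<Psi> (J S) ` carrier (mod_at (free n X) (J S))"
    if S: "S \<subseteq> A" for S
  proof -
    let ?j = "J S"
    have j: "?j \<in> Ob C" using S by (rule J(1))
    interpret h: module_hom k "mod_at (free n X) ?j" "mod_at V ?j" "\<Psi> ?j" by (rule \<Psi>.hom_at [OF j])
    have "B ?j \<subseteq> \<Psi> ?j ` carrier (mod_at (free n X) ?j)"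
    proof
      fix b assume b: "b \<in> B ?j"
      then have "(?j, b) \<in> G" using S by (auto simp: G_def)
      then obtain i where i: "i < n" "e i = (?j, b)"
        using e unfolding n_def bij_betw_def by (metis atLeastLessThan_iff imageE)
      have Xi: "X i = ?j" "snd (e i) = b" using i by (simp_all add: X_def)
      then have "b \<in> \<psi> i ?j ` carrier (mod_at (P (X i)) ?j)"
        using yoneda_generator [OF V j, of b] B(2) [OF j] b unfolding \<psi>_def Xi by blast
      then obtain w where w: "w \<in> carrier (mod_at (P (X i)) ?j)" "\<psi> i ?j w = b" by blast
      show "b \<in> \<Psi> ?j ` carrier (mod_at (free n X) ?j)"
        unfolding \<Psi>_def w(2) [symmetric]
        by (rule dsum_cmap_image [where W = "\<lambda>i. P (X i)", OF V \<psi> i(1) j w(1)])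
    qed
    then have "span k (mod_at V ?j) (B ?j) \<subseteq> \<Psi> ?j ` carrier (mod_at (free n X) ?j)"
      by (intro h.N.span_minimal h.image_submodule h.M.carrier_is_submodule)
    with B(3) [OF j] show ?thesis by (rule subset_trans)
  qed
  have onto: "carrier (mod_at V y) \<subseteq> \<Psi> y ` carrier (mod_at (free n X) y)" if y: "y \<in> Ob C" for y
  proof
    fix w assume w: "w \<in> carrier (mod_at V y)"
    \<comment> \<open>The join of exactly those thresholds that lie below \<open>y\<close> is itself
      below \<open>y\<close>; an arrow from it to \<open>y\<close> is stable at \<open>A\<close>,
      because every threshold below \<open>y\<close> is already below the join.\<close>
    define S where "S = {a \<in> A. hom_set C a y \<noteq> {}}"
    have S: "S \<subseteq> A" by (auto simp: S_def)
    have j: "J S \<in> Ob C" using S by (rule J(1))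
    have "hom_set C (J S) y \<noteq> {}" using J(2) [OF S y] by (simp add: S_def)
    then obtain f where f: "f \<in> Arr C" "Dom C f = J S" "Cod C f = y" by (auto simp: hom_set_def)
    \<comment> \<open>The identity of \<open>J S\<close> allows the defining property of the join to
      be read at \<open>y = J S\<close>, which shows that the members of \<open>S\<close> lie below
      \<open>J S\<close>.\<close>
    have "hom_set C (J S) (J S) \<noteq> {}" using Ide_in_hom [OF j] by blast
    then have "\<forall>a \<in> S. hom_set C a (J S) \<noteq> {}" using J(2) [OF S j] by blast
    then have "stable_at C A f" using f by (auto simp: stable_at_def S_def)
    then have "w \<in> act V f ` carrier (mod_at V (J S))"
      using A(3) [of f] f w by (simp add: bij_betw_def)
    then obtain v where v: "v \<in> carrier (mod_at V (J S))" "w = act V f v" by blast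
    obtain u where u: "u \<in> carrier (mod_at (free n X) (J S))" "v = \<Psi> (J S) u"
      using subsetD [OF onto_J [OF S] v(1)] by blast
    have "w = \<Psi> y (act (free n X) f u)"
      using \<Psi>.naturality [OF f(1), of u] f v u by simp
    moreover have "act (free n X) f u \<in> carrier (mod_at (free n X) y)"
      using act_closed [OF \<Psi>.source f(1), of u] u(1) unfolding f(2,3) .
    ultimately show "w \<in> \<Psi> y ` carrier (mod_at (free n X) y)" by (rule image_eqI)
  qed
  show thesis
  proof (rule that [of X n \<Psi>])
    show "\<Psi> x ` carrier (mod_at (free n X) x) = carrier (mod_at V x)" if "x \<in> Ob C" for x
      using onto [OF that] \<Psi>.closed [OF that] by (intro equalityI image_subsetI)
  qed (use X \<Psi> in auto)
qed

text \<open>A cokernel of a map between tame free modules is tame; its elements are cosets rather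
  than elements of \<open>V\<close>, so tameness is passed to \<open>V\<close> along the
  isomorphism.\<close>

lemma finitely_presented_imp_tame:
  assumes "finitely_presented C k V"
  shows "tame C k V"
proof -
  obtain m n X Y \<phi> where X: "X \<in> {..<n} \<rightarrow> Ob C" and Y: "Y \<in> {..<m} \<rightarrow> Ob C"
    and \<phi>: "\<phi> \<in> cmodule_homs C k (free m Y) (free n X)"
    and iso: "cmodule_isomorphic C k V (coker_cmodule C (free m Y) (free n X) \<phi>)"
    and V: "is_cmodule C k V"
    using assms unfolding finitely_presented_def Let_def by blast
  interpret \<phi>: cmap C k "free m Y" "free n X" \<phi>
    by unfold_locales (rule free_is_cmodule X Y cmodule_homs_natural [OF \<phi>])+
  have tame: "tame C k (coker_cmodule C (free m Y) (free n X) \<phi>)"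
  proof (rule tame_cokernel [OF \<phi>.cmap_axioms \<phi>.coker_projection])
    fix x assume x: "x \<in> Ob C"
    show "\<phi>.coset x ` carrier (mod_at (free n X) x) =
        carrier (mod_at (coker_cmodule C (free m Y) (free n X) \<phi>) x)"
      by (rule \<phi>.coker_carrier [OF x])
    show "\<phi> x ` carrier (mod_at (free m Y) x) = {u \<in> carrier (mod_at (free n X) x).
        \<phi>.coset x u = \<zero>\<^bsub>mod_at (coker_cmodule C (free m Y) (free n X) \<phi>) x\<^esub>}"
      using \<phi>.coker_eq_zero [OF x] \<phi>.closed [OF x] by auto
  qed (rule free_tame X Y)+
  obtain \<eta> where \<eta>: "\<eta> \<in> cmodule_homs C k V (coker_cmodule C (free m Y) (free n X) \<phi>)"
    "\<And>x. x \<in> Ob C \<Longrightarrow> bij_betw (\<eta> x) (carrier (mod_at V x))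
      (carrier (mod_at (coker_cmodule C (free m Y) (free n X) \<phi>) x))"
    using iso unfolding cmodule_isomorphic_def by blast
  have "cmap C k V (coker_cmodule C (free m Y) (free n X) \<phi>) \<eta>"
    using V cmap.target [OF \<phi>.coker_projection] cmodule_homs_natural [OF \<eta>(1)]
    by unfold_locales
  then show ?thesis using tame \<eta>(2) by (rule tame_iso)
qed

text \<open>Two covers give a presentation: one of \<open>V\<close>, and one of the kernel of the
  first, which is tame by \<open>tame_kernel\<close>.\<close>

lemma tame_imp_finitely_presented:
  assumes V: "is_cmodule C k V" and tame: "tame C k V"
  shows "finitely_presented C k V"
proof -
  obtain n X \<Psi> where X: "X \<in> {..<n} \<rightarrow> Ob C" and \<Psi>: "cmap C k (free n X) V \<Psi>"
    and \<Psi>_surj: "\<And>x. x \<in> Ob C \<Longrightarrow> \<Psi> x ` carrier (mod_at (free n X) x) = carrier (mod_at V x)"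
    by (rule tame_free_cover [OF V tame], rule that)
  interpret \<Psi>: cmap C k "free n X" V \<Psi> by (rule \<Psi>)
  let ?K = \<Psi>.kernel_cmodule
  have K: "tame C k ?K"
    by (rule tame_kernel [OF \<Psi>.kernel_cmodule \<Psi> _ _ free_tame [OF X] tame])
       (auto simp: \<Psi>.kernel_carrier)
  obtain m Y \<Theta> where Y: "Y \<in> {..<m} \<rightarrow> Ob C" and \<Theta>: "cmap C k (free m Y) ?K \<Theta>"
    and \<Theta>_surj: "\<And>x. x \<in> Ob C \<Longrightarrow> \<Theta> x ` carrier (mod_at (free m Y) x) = carrier (mod_at ?K x)"
    by (rule tame_free_cover [OF cmap.source [OF \<Psi>.kernel_cmodule] K], rule that)
  \<comment> \<open>A presentation must use an extensional family; trimming changes no value on the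
    carriers.\<close>
  define \<phi> where "\<phi> = trim C (free m Y) \<Theta>"
  have "cmap C k (free m Y) (free n X) \<Theta>"
    using cmap_compose [OF \<Theta> \<Psi>.kernel_cmodule] by simp
  then have \<phi>: "\<phi> \<in> cmodule_homs C k (free m Y) (free n X)"
    unfolding \<phi>_def by (intro trim_in_homs) (auto intro: cmap.source cmap.nat)
  interpret \<phi>: cmap C k "free m Y" "free n X" \<phi>
    by unfold_locales (rule free_is_cmodule X Y cmodule_homs_natural [OF \<phi>])+
  let ?Q = "coker_cmodule C (free m Y) (free n X) \<phi>"
  have im: "\<phi> x ` carrier (mod_at (free m Y) x) =
      {u \<in> carrier (mod_at (free n X) x). \<Psi> x u = \<zero>\<^bsub>mod_at V x\<^esub>}" if "x \<in> Ob C" for x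
    using \<Theta>_surj [OF that] that by (simp add: \<phi>_def \<Psi>.kernel_carrier)
  \<comment> \<open>The cover \<open>\<Psi>\<close> and the projection to \<open>?Q\<close> have the
    same kernel. One direction makes the projection factor through \<open>\<Psi>\<close> as
    \<open>\<theta>\<close>, the other makes \<open>\<theta>\<close> injective.\<close>
  have ker: "\<phi>.coset x u = \<zero>\<^bsub>mod_at ?Q x\<^esub> \<longleftrightarrow> \<Psi> x u = \<zero>\<^bsub>mod_at V x\<^esub>"
    if "x \<in> Ob C" "u \<in> carrier (mod_at (free n X) x)" for x u
    using \<phi>.coker_eq_zero [OF that] im [OF that(1)] that by simp
  obtain \<theta> where \<theta>: "cmap C k V ?Q \<theta>"
    "\<And>x u. x \<in> Ob C \<Longrightarrow> u \<in> carrier (mod_at (free n X) x) \<Longrightarrow> \<theta> x (\<Psi> x u) = \<phi>.coset x u"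
    using factor_through_surjective [OF \<Psi> \<phi>.coker_projection \<Psi>_surj] ker by blast
  interpret \<theta>: cmap C k V ?Q \<theta> by (rule \<theta>)
  have "bij_betw (\<theta> x) (carrier (mod_at V x)) (carrier (mod_at ?Q x))" if x: "x \<in> Ob C" for x
    unfolding bij_betw_def
  proof
    interpret h: module_hom k "mod_at V x" "mod_at ?Q x" "\<theta> x" by (rule \<theta>.hom_at [OF x])
    show "inj_on (\<theta> x) (carrier (mod_at V x))"
      unfolding h.inj_on_iff using x ker [OF x] by (auto simp: \<theta>(2) simp flip: \<Psi>_surj)
    have "\<theta> x ` carrier (mod_at V x) = \<phi>.coset x ` carrier (mod_at (free n X) x)"
      unfolding \<Psi>_surj [OF x, symmetric] image_image using \<theta>(2) [OF x] by (rule image_cong [OF refl])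
    then show "\<theta> x ` carrier (mod_at V x) = carrier (mod_at ?Q x)"
      using \<phi>.coker_carrier [OF x] by simp
  qed
  then have "bij_betw (trim C V \<theta> x) (carrier (mod_at V x)) (carrier (mod_at ?Q x))"
    if "x \<in> Ob C" for x
    using that by (subst bij_betw_cong [of _ _ "\<theta> x"]) auto
  then have "cmodule_isomorphic C k V ?Q"
    unfolding cmodule_isomorphic_def using trim_in_homs [OF V \<theta>.nat] by blast
  then show ?thesis
    unfolding finitely_presented_def Let_def using V X Y \<phi> by blast
qed

lemma finitely_presented_iff:
  "finitely_presented C k V \<longleftrightarrow> is_cmodule C k V \<and> tame C k V"
  using finitely_presented_imp_tame tame_imp_finitely_presented
  unfolding finitely_presented_def by blast

end


section \<open>The abelian category\<close>

context combinatorial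
begin

abbreviation D ::
  "(('o, 'a, 'k, 'm) cmodule,
    ('o, 'a, 'k, 'm) cmodule \<times> ('o \<Rightarrow> 'm \<Rightarrow> 'm) \<times> ('o, 'a, 'k, 'm) cmodule) cat"
  where "D \<equiv> fp_cmodule_cat C k"

text \<open>Trimming is built in, so any natural family may be written in an arrow, and equality of
  parallel arrows becomes agreement on the carriers.\<close>

definition arrow ::
  "('o, 'a, 'k, 'm) cmodule \<Rightarrow> ('o, 'a, 'k, 'm) cmodule \<Rightarrow> ('o \<Rightarrow> 'm \<Rightarrow> 'm)
     \<Rightarrow> ('o, 'a, 'k, 'm) cmodule \<times> ('o \<Rightarrow> 'm \<Rightarrow> 'm) \<times> ('o, 'a, 'k, 'm) cmodule"
  where "arrow V W \<eta> = (V, trim C V \<eta>, W)"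

lemma D_sel [simp]:
  "Dom D (arrow V W \<eta>) = V" "Cod D (arrow V W \<eta>) = W" "Ide D V = arrow V V (\<lambda>x u. u)"
  by (simp_all add: fp_cmodule_cat_def full_subcategory_def cmodule_cat_def arrow_def trim_def)

lemma Ob_D: "V \<in> Ob D \<longleftrightarrow> is_cmodule C k V \<and> tame C k V"
  by (auto simp: fp_cmodule_cat_def full_subcategory_def cmodule_cat_def finitely_presented_iff)

lemma Arr_D_hom: "a \<in> Arr D \<Longrightarrow> a \<in> hom_set D (Dom D a) (Cod D a)"
  by (auto simp: hom_set_def)

lemma hom_D: "a \<in> hom_set D V W \<longleftrightarrow>
    V \<in> Ob D \<and> W \<in> Ob D \<and> (\<exists>\<eta> \<in> cmodule_homs C k V W. a = (V, \<eta>, W))"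
  by (auto simp: hom_set_def fp_cmodule_cat_def full_subcategory_def cmodule_cat_def)

lemma arrow_in_hom:
  assumes "V \<in> Ob D" "W \<in> Ob D" "cmap C k V W \<eta>"
  shows "arrow V W \<eta> \<in> hom_set D V W"
  using assms trim_in_homs [OF cmap.source cmap.nat] by (auto simp: hom_D arrow_def)

lemma arrow_in_Arr:
  assumes "V \<in> Ob D" "W \<in> Ob D" "cmap C k V W \<eta>"
  shows "arrow V W \<eta> \<in> Arr D"
  using arrow_in_hom [OF assms] by (auto simp: hom_set_def)

lemma homE:
  assumes "a \<in> hom_set D V W"
  obtains \<eta> where "cmap C k V W \<eta>" "a = arrow V W \<eta>" "V \<in> Ob D" "W \<in> Ob D"
proof -
  obtain \<eta> where \<eta>: "\<eta> \<in> cmodule_homs C k V W" "a = (V, \<eta>, W)" and Ob: "V \<in> Ob D" "W \<in> Ob D"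
    using assms by (auto simp: hom_D)
  have V: "is_cmodule C k V" and W: "is_cmodule C k W" using Ob by (auto simp: Ob_D)
  have nat: "natural C k V W \<eta>" by (rule cmodule_homs_natural [OF \<eta>(1)])
  have "cmap C k V W \<eta>" by unfold_locales (fact V W nat)+
  moreover have "trim C V \<eta> = \<eta>"
    by (rule cmodule_homs_eqI [OF trim_in_homs [OF V nat] \<eta>(1)]) simp
  ultimately show thesis using that \<eta>(2) Ob by (simp add: arrow_def)
qed

lemma ArrE:
  assumes "a \<in> Arr D"
  obtains V W \<eta> where "cmap C k V W \<eta>" "a = arrow V W \<eta>" "V \<in> Ob D" "W \<in> Ob D"
  using homE [OF Arr_D_hom [OF assms]] by blast

lemma arrow_eq_iff:
  "arrow V W \<eta> = arrow V W \<theta> \<longleftrightarrow> (\<forall>x \<in> Ob C. \<forall>u \<in> carrier (mod_at V x). \<eta> x u = \<theta> x u)"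
proof
  assume "arrow V W \<eta> = arrow V W \<theta>"
  then have "trim C V \<eta> = trim C V \<theta>" by (simp add: arrow_def)
  then show "\<forall>x \<in> Ob C. \<forall>u \<in> carrier (mod_at V x). \<eta> x u = \<theta> x u"
    by (metis trim_apply)
next
  assume "\<forall>x \<in> Ob C. \<forall>u \<in> carrier (mod_at V x). \<eta> x u = \<theta> x u"
  then show "arrow V W \<eta> = arrow V W \<theta>" by (auto simp: arrow_def trim_def fun_eq_iff)
qed

lemma arrow_cong:
  "(\<And>x u. x \<in> Ob C \<Longrightarrow> u \<in> carrier (mod_at V x) \<Longrightarrow> \<eta> x u = \<theta> x u) \<Longrightarrow>
   arrow V W \<eta> = arrow V W \<theta>"
  by (simp add: arrow_eq_iff)

lemma Cmp_arrow:
  assumes "cmap C k V W \<eta>"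
  shows "arrow W X \<theta> \<cdot>\<^bsub>D\<^esub> arrow V W \<eta> = arrow V X (\<lambda>x u. \<theta> x (\<eta> x u))"
  using cmap.closed [OF assms]
  by (auto simp: fp_cmodule_cat_def full_subcategory_def cmodule_cat_def arrow_def trim_def
      compose_def fun_eq_iff)

lemma category_D: "category (D :: (('o, 'a, 'k, 'm) cmodule, _) cat)"
proof
  fix V :: "('o, 'a, 'k, 'm) cmodule" assume "V \<in> Ob D"
  then show "Ide D V \<in> hom_set D V V"
    by (simp add: arrow_in_hom cmap_id Ob_D)
next
  fix f :: "('o, 'a, 'k, 'm) cmodule \<times> ('o \<Rightarrow> 'm \<Rightarrow> 'm) \<times> ('o, 'a, 'k, 'm) cmodule"
  assume "f \<in> Arr D"
  then show "Dom D f \<in> Ob D" "Cod D f \<in> Ob D" using Arr_D_hom hom_D by blast+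
next
  fix f g :: "('o, 'a, 'k, 'm) cmodule \<times> ('o \<Rightarrow> 'm \<Rightarrow> 'm) \<times> ('o, 'a, 'k, 'm) cmodule"
    and V W X
  assume "f \<in> hom_set D V W" "g \<in> hom_set D W X"
  then show "g \<cdot>\<^bsub>D\<^esub> f \<in> hom_set D V X"
    by (elim homE) (simp add: Cmp_arrow arrow_in_hom cmap_compose)
next
  fix f :: "('o, 'a, 'k, 'm) cmodule \<times> ('o \<Rightarrow> 'm \<Rightarrow> 'm) \<times> ('o, 'a, 'k, 'm) cmodule"
    and V W
  assume "f \<in> hom_set D V W"
  then show "f \<cdot>\<^bsub>D\<^esub> Ide D V = f" "Ide D W \<cdot>\<^bsub>D\<^esub> f = f"
    by (auto elim!: homE simp: Cmp_arrow cmap_id Ob_D)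
next
  fix f g h :: "('o, 'a, 'k, 'm) cmodule \<times> ('o \<Rightarrow> 'm \<Rightarrow> 'm) \<times> ('o, 'a, 'k, 'm) cmodule"
    and V W X Y
  assume "f \<in> hom_set D V W" "g \<in> hom_set D W X" "h \<in> hom_set D X Y"
  then show "(h \<cdot>\<^bsub>D\<^esub> g) \<cdot>\<^bsub>D\<^esub> f = h \<cdot>\<^bsub>D\<^esub> (g \<cdot>\<^bsub>D\<^esub> f)"
    by (elim homE) (simp add: Cmp_arrow cmap_compose)
qed

section \<open>Zero objects, zero arrows, kernels and cokernels\<close>

lemma zero_object_exists:
  obtains Z :: "('o, 'a, 'k, 'm) cmodule"
  where "Z \<in> Ob D" "\<And>x. carrier (mod_at Z x) = {\<zero>\<^bsub>mod_at Z x\<^esub>}"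
proof -
  define M :: "('k, 'm) module" where "M = \<lparr>carrier = {undefined}, monoid.mult = undefined,
    one = undefined, zero = undefined, add = (\<lambda>u v. undefined), smult = (\<lambda>c u. undefined)\<rparr>"
  have M: "module k M"
    by (intro moduleI abelian_groupI k.is_cring) (auto simp: M_def)
  define Z :: "('o, 'a, 'k, 'm) cmodule" where "Z = \<lparr>mod_at = (\<lambda>x. M), act = (\<lambda>f u. undefined)\<rparr>"
  have Z: "carrier (mod_at Z x) = {\<zero>\<^bsub>mod_at Z x\<^esub>}" for x by (simp add: Z_def M_def)
  have "is_cmodule C k Z"
    unfolding is_cmodule_def by (auto simp: Z_def M linear_maps_def) (auto simp: M_def)
  moreover have "tame C k Z"
  proof (rule tameI [of _ _ _ "{}"])
    interpret module k M by (rule M)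
    show "fin_gen k (mod_at Z x)" for x
      unfolding fin_gen_def
      by (intro exI [of _ "{}"]) (auto simp: Z_def M_def span_def dest: submodule_zero [unfolded M_def])
    show "bij_betw (act Z f) (carrier (mod_at Z (Dom C f))) (carrier (mod_at Z (Cod C f)))" for f
      by (auto simp: Z_def M_def bij_betw_def)
  qed auto
  ultimately show thesis using that Z by (simp add: Ob_D)
qed

lemma zero_objectI:
  fixes Z :: "('o, 'a, 'k, 'm) cmodule"
  assumes Z: "Z \<in> Ob D" and 0: "\<And>x. carrier (mod_at Z x) = {\<zero>\<^bsub>mod_at Z x\<^esub>}"
  shows "zero_object D Z"
  unfolding zero_object_def
proof (intro conjI ballI Z)
  fix V :: "('o, 'a, 'k, 'm) cmodule" assume V: "V \<in> Ob D"
  have Z': "is_cmodule C k Z" and V': "is_cmodule C k V" using Z V by (auto simp: Ob_D)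
  show "\<exists>!f. f \<in> hom_set D V Z"
  proof (rule ex1I)
    show "arrow V Z (\<lambda>x u. \<zero>\<^bsub>mod_at Z x\<^esub>) \<in> hom_set D V Z"
      using V Z V' Z' by (intro arrow_in_hom cmap_zero)
    show "f = arrow V Z (\<lambda>x u. \<zero>\<^bsub>mod_at Z x\<^esub>)" if "f \<in> hom_set D V Z" for f
      using that 0 by (auto elim!: homE intro!: arrow_cong dest: cmap.closed)
  qed
  show "\<exists>!f. f \<in> hom_set D Z V"
  proof (rule ex1I)
    show "arrow Z V (\<lambda>x u. \<zero>\<^bsub>mod_at V x\<^esub>) \<in> hom_set D Z V"
      using V Z V' Z' by (intro arrow_in_hom cmap_zero)
    show "f = arrow Z V (\<lambda>x u. \<zero>\<^bsub>mod_at V x\<^esub>)" if "f \<in> hom_set D Z V" for f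
      using that 0 by (auto elim!: homE intro!: arrow_cong dest: cmap.zero_at)
  qed
qed

text \<open>A zero arrow may factor through any zero object. Only one arrow leads from it to
  \<open>W\<close>, so the second factor is pointwise zero; conversely, the one-element module
  serves as the middle object.\<close>

lemma zero_arrow_iff:
  fixes V W :: "('o, 'a, 'k, 'm) cmodule"
  assumes f: "cmap C k V W \<eta>" "V \<in> Ob D" "W \<in> Ob D"
  shows "zero_arrow D (arrow V W \<eta>) \<longleftrightarrow>
    (\<forall>x \<in> Ob C. \<forall>u \<in> carrier (mod_at V x). \<eta> x u = \<zero>\<^bsub>mod_at W x\<^esub>)"
proof
  assume "zero_arrow D (arrow V W \<eta>)"
  then obtain Z g h where Z: "zero_object D Z" and g: "g \<in> hom_set D V Z" and h: "h \<in> hom_set D Z W"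
    and eq: "arrow V W \<eta> = h \<cdot>\<^bsub>D\<^esub> g" by (auto simp: zero_arrow_def)
  have ZO: "Z \<in> Ob D" using Z by (simp add: zero_object_def)
  have "arrow Z W (\<lambda>x u. \<zero>\<^bsub>mod_at W x\<^esub>) \<in> hom_set D Z W"
    using ZO f(3) by (auto intro!: arrow_in_hom cmap_zero simp: Ob_D)
  then have h': "h = arrow Z W (\<lambda>x u. \<zero>\<^bsub>mod_at W x\<^esub>)"
    using Z h f(3) unfolding zero_object_def by blast
  obtain \<gamma> where "cmap C k V Z \<gamma>" "g = arrow V Z \<gamma>" using g by (rule homE)
  then have "arrow V W \<eta> = arrow V W (\<lambda>x u. \<zero>\<^bsub>mod_at W x\<^esub>)"
    unfolding eq h' by (simp add: Cmp_arrow)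
  then show "\<forall>x \<in> Ob C. \<forall>u \<in> carrier (mod_at V x). \<eta> x u = \<zero>\<^bsub>mod_at W x\<^esub>"
    by (simp add: arrow_eq_iff)
next
  assume 0: "\<forall>x \<in> Ob C. \<forall>u \<in> carrier (mod_at V x). \<eta> x u = \<zero>\<^bsub>mod_at W x\<^esub>"
  obtain Z :: "('o, 'a, 'k, 'm) cmodule"
    where Z: "Z \<in> Ob D" "\<And>x. carrier (mod_at Z x) = {\<zero>\<^bsub>mod_at Z x\<^esub>}"
    by (rule zero_object_exists, rule that)
  have c: "cmap C k V Z (\<lambda>x u. \<zero>\<^bsub>mod_at Z x\<^esub>)" "cmap C k Z W (\<lambda>x u. \<zero>\<^bsub>mod_at W x\<^esub>)"
    using Z f by (auto intro!: cmap_zero simp: Ob_D)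
  have "arrow V W \<eta> = arrow Z W (\<lambda>x u. \<zero>\<^bsub>mod_at W x\<^esub>) \<cdot>\<^bsub>D\<^esub> arrow V Z (\<lambda>x u. \<zero>\<^bsub>mod_at Z x\<^esub>)"
    using 0 by (simp add: Cmp_arrow [OF c(1)] arrow_eq_iff)
  then show "zero_arrow D (arrow V W \<eta>)"
    unfolding zero_arrow_def D_sel
    using arrow_in_Arr [OF f(2,3,1)] zero_objectI [OF Z] arrow_in_hom [OF f(2) Z(1) c(1)]
      arrow_in_hom [OF Z(1) f(3) c(2)] by blast
qed

text \<open>Exactness at every object suffices for the universal property in \<open>D\<close>:
  \<open>lift_through_injective\<close> provides the factorization, and injectivity of
  \<open>i\<close> its uniqueness. As \<open>K\<close> and \<open>i\<close> are not tied to a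
  construction, the criterion also recognizes a given injective map as a kernel.\<close>

lemma is_kernelI:
  assumes f: "cmap C k V W \<eta>" and V: "V \<in> Ob D" and W: "W \<in> Ob D"
    and i: "cmap C k K V i" and K: "K \<in> Ob D"
    and inj: "\<And>x. x \<in> Ob C \<Longrightarrow> inj_on (i x) (carrier (mod_at K x))"
    and ex: "\<And>x. x \<in> Ob C \<Longrightarrow>
      i x ` carrier (mod_at K x) = {u \<in> carrier (mod_at V x). \<eta> x u = \<zero>\<^bsub>mod_at W x\<^esub>}"
  shows "is_kernel D (arrow V W \<eta>) (arrow K V i)"
  unfolding is_kernel_def D_sel
proof (intro conjI ballI impI refl)
  show "arrow V W \<eta> \<in> Arr D" "arrow K V i \<in> Arr D" by (intro arrow_in_Arr f V W i K)+
  have "\<eta> x (i x u) = \<zero>\<^bsub>mod_at W x\<^esub>" if "x \<in> Ob C" "u \<in> carrier (mod_at K x)" for x u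
    using ex [OF that(1)] that(2) by blast
  then show "zero_arrow D (arrow V W \<eta> \<cdot>\<^bsub>D\<^esub> arrow K V i)"
    unfolding Cmp_arrow [OF i] zero_arrow_iff [OF cmap_compose [OF i f] K W] by blast
  fix X g assume X: "X \<in> Ob D" and g: "g \<in> hom_set D X V"
    and 0: "zero_arrow D (arrow V W \<eta> \<cdot>\<^bsub>D\<^esub> g)"
  obtain \<gamma> where \<gamma>: "cmap C k X V \<gamma>" "g = arrow X V \<gamma>" using g by (rule homE)
  have "\<eta> x (\<gamma> x u) = \<zero>\<^bsub>mod_at W x\<^esub>" if "x \<in> Ob C" "u \<in> carrier (mod_at X x)" for x u
    using 0 that zero_arrow_iff [OF cmap_compose [OF \<gamma>(1) f] X W]
    by (simp add: \<gamma>(2) Cmp_arrow [OF \<gamma>(1)])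
  then have "\<gamma> x u \<in> i x ` carrier (mod_at K x)" if "x \<in> Ob C" "u \<in> carrier (mod_at X x)" for x u
    using ex [OF that(1)] that cmap.closed [OF \<gamma>(1) that] by simp
  then obtain h where h: "cmap C k X K h"
    "\<And>x u. x \<in> Ob C \<Longrightarrow> u \<in> carrier (mod_at X x) \<Longrightarrow> i x (h x u) = \<gamma> x u"
    using lift_through_injective [OF i \<gamma>(1) inj] by metis
  show "\<exists>!u. u \<in> hom_set D X K \<and> arrow K V i \<cdot>\<^bsub>D\<^esub> u = g"
  proof (rule ex1I)
    show "arrow X K h \<in> hom_set D X K \<and> arrow K V i \<cdot>\<^bsub>D\<^esub> arrow X K h = g"
      using arrow_in_hom [OF X K h(1)] h by (simp add: Cmp_arrow \<gamma>(2) arrow_eq_iff)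
    fix a assume a: "a \<in> hom_set D X K \<and> arrow K V i \<cdot>\<^bsub>D\<^esub> a = g"
    then obtain h' where h': "cmap C k X K h'" "a = arrow X K h'" by (auto elim: homE)
    then have "i x (h' x u) = i x (h x u)" if "x \<in> Ob C" "u \<in> carrier (mod_at X x)" for x u
      using a that h(2) by (auto simp: Cmp_arrow \<gamma>(2) arrow_eq_iff)
    then show "a = arrow X K h"
      using inj cmap.closed [OF h(1)] cmap.closed [OF h'(1)]
      unfolding h'(2) by (intro arrow_cong) (blast dest: inj_onD)
  qed
qed

text \<open>The dual criterion: \<open>factor_through_surjective\<close> provides the factorization,
  and surjectivity of \<open>q\<close> its uniqueness.\<close>

lemma is_cokernelI:
  assumes f: "cmap C k V W \<eta>" and V: "V \<in> Ob D" and W: "W \<in> Ob D"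
    and q: "cmap C k W Q q" and Q: "Q \<in> Ob D"
    and surj: "\<And>x. x \<in> Ob C \<Longrightarrow> q x ` carrier (mod_at W x) = carrier (mod_at Q x)"
    and ex: "\<And>x. x \<in> Ob C \<Longrightarrow>
      \<eta> x ` carrier (mod_at V x) = {u \<in> carrier (mod_at W x). q x u = \<zero>\<^bsub>mod_at Q x\<^esub>}"
  shows "is_cokernel D (arrow V W \<eta>) (arrow W Q q)"
  unfolding is_cokernel_def D_sel
proof (intro conjI ballI impI refl)
  show "arrow V W \<eta> \<in> Arr D" "arrow W Q q \<in> Arr D" by (intro arrow_in_Arr f V W q Q)+
  have "q x (\<eta> x u) = \<zero>\<^bsub>mod_at Q x\<^esub>" if "x \<in> Ob C" "u \<in> carrier (mod_at V x)" for x u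
    using ex [OF that(1)] that(2) by blast
  then show "zero_arrow D (arrow W Q q \<cdot>\<^bsub>D\<^esub> arrow V W \<eta>)"
    unfolding Cmp_arrow [OF f] zero_arrow_iff [OF cmap_compose [OF f q] V Q] by blast
  fix X g assume X: "X \<in> Ob D" and g: "g \<in> hom_set D W X"
    and 0: "zero_arrow D (g \<cdot>\<^bsub>D\<^esub> arrow V W \<eta>)"
  obtain \<gamma> where \<gamma>: "cmap C k W X \<gamma>" "g = arrow W X \<gamma>" using g by (rule homE)
  have 0: "\<gamma> x (\<eta> x u) = \<zero>\<^bsub>mod_at X x\<^esub>" if "x \<in> Ob C" "u \<in> carrier (mod_at V x)" for x u
    using 0 that zero_arrow_iff [OF cmap_compose [OF f \<gamma>(1)] V X]
    by (simp add: \<gamma>(2) Cmp_arrow [OF f])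
  have "\<gamma> x w = \<zero>\<^bsub>mod_at X x\<^esub>"
    if "x \<in> Ob C" "w \<in> carrier (mod_at W x)" "q x w = \<zero>\<^bsub>mod_at Q x\<^esub>" for x w
  proof -
    have "w \<in> \<eta> x ` carrier (mod_at V x)" using ex that by simp
    then show ?thesis using 0 that(1) by blast
  qed
  then obtain h where h: "cmap C k Q X h"
    "\<And>x u. x \<in> Ob C \<Longrightarrow> u \<in> carrier (mod_at W x) \<Longrightarrow> h x (q x u) = \<gamma> x u"
    using factor_through_surjective [OF q \<gamma>(1) surj] by metis
  show "\<exists>!u. u \<in> hom_set D Q X \<and> u \<cdot>\<^bsub>D\<^esub> arrow W Q q = g"
  proof (rule ex1I)
    show "arrow Q X h \<in> hom_set D Q X \<and> arrow Q X h \<cdot>\<^bsub>D\<^esub> arrow W Q q = g"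
      using arrow_in_hom [OF Q X h(1)] h by (simp add: Cmp_arrow [OF q] \<gamma>(2) arrow_eq_iff)
    fix a assume a: "a \<in> hom_set D Q X \<and> a \<cdot>\<^bsub>D\<^esub> arrow W Q q = g"
    then obtain h' where h': "cmap C k Q X h'" "a = arrow Q X h'" by (auto elim: homE)
    then have *: "h' x (q x u) = h x (q x u)" if "x \<in> Ob C" "u \<in> carrier (mod_at W x)" for x u
      using a that h(2) by (auto simp: Cmp_arrow [OF q] \<gamma>(2) arrow_eq_iff)
    show "a = arrow Q X h"
      unfolding h'(2)
    proof (rule arrow_cong)
      fix x u assume x: "x \<in> Ob C" and "u \<in> carrier (mod_at Q x)"
      then obtain w where "w \<in> carrier (mod_at W x)" "u = q x w" using surj [OF x] by blast
      then show "h' x u = h x u" using * [OF x] by simp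
    qed
  qed
qed

lemma kernel_exists:
  fixes V W :: "('o, 'a, 'k, 'm) cmodule"
  assumes f: "cmap C k V W \<eta>" and V: "V \<in> Ob D" and W: "W \<in> Ob D"
  obtains K :: "('o, 'a, 'k, 'm) cmodule" and i where "K \<in> Ob D" "cmap C k K V i"
    "\<And>x. x \<in> Ob C \<Longrightarrow> inj_on (i x) (carrier (mod_at K x))"
    "\<And>x. x \<in> Ob C \<Longrightarrow>
      i x ` carrier (mod_at K x) = {u \<in> carrier (mod_at V x). \<eta> x u = \<zero>\<^bsub>mod_at W x\<^esub>}"
proof -
  interpret cmap C k V W \<eta> by (rule f)
  have "tame C k kernel_cmodule"
    using V W by (intro tame_kernel [OF kernel_cmodule f]) (auto simp: kernel_carrier Ob_D)
  then show thesis
    using cmap.source [OF kernel_cmodule]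
    by (intro that [OF _ kernel_cmodule]) (auto simp: kernel_carrier Ob_D)
qed

lemma cokernel_exists:
  fixes V W :: "('o, 'a, 'k, 'm) cmodule"
  assumes f: "cmap C k V W \<eta>" and V: "V \<in> Ob D" and W: "W \<in> Ob D"
  obtains Q :: "('o, 'a, 'k, 'm) cmodule" and q where "Q \<in> Ob D" "cmap C k W Q q"
    "\<And>x. x \<in> Ob C \<Longrightarrow> q x ` carrier (mod_at W x) = carrier (mod_at Q x)"
    "\<And>x. x \<in> Ob C \<Longrightarrow>
      \<eta> x ` carrier (mod_at V x) = {u \<in> carrier (mod_at W x). q x u = \<zero>\<^bsub>mod_at Q x\<^esub>}"
proof -
  interpret f: cmap C k V W \<eta> by (rule f)
  let ?Q = "coker_cmodule C V W \<eta>"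
  interpret p: cmap C k W ?Q f.coset by (rule f.coker_projection)
  \<comment> \<open>the elements of \<open>?Q\<close> are cosets; representatives of them are again in \<open>'m\<close>\<close>
  define e where "e = (\<lambda>x. inv_into (carrier (mod_at W x)) (f.coset x))"
  have e_inj: "inj_on (e x) (carrier (mod_at ?Q x))" if "x \<in> Ob C" for x
    unfolding e_def by (rule inj_on_inv_into) (simp add: f.coker_carrier [OF that])
  obtain Q where e: "cmap C k ?Q Q e"
    and bij: "\<And>x. x \<in> Ob C \<Longrightarrow> bij_betw (e x) (carrier (mod_at ?Q x)) (carrier (mod_at Q x))"
    by (rule relabel [OF p.target e_inj], assumption, rule that)
  interpret e: cmap C k ?Q Q e by (rule e)
  define q where "q = (\<lambda>x u. e x (f.coset x u))"
  have q: "cmap C k W Q q" unfolding q_def by (rule cmap_compose [OF f.coker_projection e])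
  have surj: "q x ` carrier (mod_at W x) = carrier (mod_at Q x)" if x: "x \<in> Ob C" for x
  proof -
    have "q x ` carrier (mod_at W x) = e x ` f.coset x ` carrier (mod_at W x)"
      by (simp add: q_def image_image)
    then show ?thesis using bij [OF x] by (simp add: f.coker_carrier [OF x] bij_betw_def)
  qed
  have ker: "\<eta> x ` carrier (mod_at V x) = {u \<in> carrier (mod_at W x). q x u = \<zero>\<^bsub>mod_at Q x\<^esub>}"
    if x: "x \<in> Ob C" for x
  proof -
    interpret ex: module_hom k "mod_at ?Q x" "mod_at Q x" "e x" by (rule e.hom_at [OF x])
    have "q x u = \<zero>\<^bsub>mod_at Q x\<^esub> \<longleftrightarrow> u \<in> \<eta> x ` carrier (mod_at V x)" if u: "u \<in> carrier (mod_at W x)" for u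
      using ex.inj_on_iff e_inj [OF x] p.closed [OF x u] ex.zero
      unfolding q_def f.coker_eq_zero [OF x u, symmetric] by metis
    then show ?thesis using f.closed [OF x] by auto
  qed
  have "tame C k Q"
    using V W by (intro tame_cokernel [OF f q surj ker]) (auto simp: Ob_D)
  then show thesis
    using e.target by (intro that [OF _ q surj ker]) (auto simp: Ob_D)
qed

section \<open>Additive structure and biproducts\<close>

definition plus ::
  "('o, 'a, 'k, 'm) cmodule \<times> ('o \<Rightarrow> 'm \<Rightarrow> 'm) \<times> ('o, 'a, 'k, 'm) cmodule \<Rightarrow>
   ('o, 'a, 'k, 'm) cmodule \<times> ('o \<Rightarrow> 'm \<Rightarrow> 'm) \<times> ('o, 'a, 'k, 'm) cmodule \<Rightarrow>
   ('o, 'a, 'k, 'm) cmodule \<times> ('o \<Rightarrow> 'm \<Rightarrow> 'm) \<times> ('o, 'a, 'k, 'm) cmodule"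
  where "plus = (\<lambda>(V, \<eta>, W) (_, \<theta>, _). arrow V W (\<lambda>x u. \<eta> x u \<oplus>\<^bsub>mod_at W x\<^esub> \<theta> x u))"

text \<open>A single operation has to serve all hom sets, so \<open>plus\<close> is total and reads
  source and target off its first argument; this evaluates it on parallel arrows, the only case with
  a meaning.\<close>

lemma plus_arrow:
  "plus (arrow V W \<eta>) (arrow V W \<theta>) = arrow V W (\<lambda>x u. \<eta> x u \<oplus>\<^bsub>mod_at W x\<^esub> \<theta> x u)"
  unfolding plus_def arrow_def prod.case by (fold arrow_def) (rule arrow_cong, simp)

lemma hom_comm_group:
  fixes V W :: "('o, 'a, 'k, 'm) cmodule"
  assumes V: "V \<in> Ob D" and W: "W \<in> Ob D"
  shows "comm_group \<lparr>carrier = hom_set D V W, monoid.mult = plus,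
    one = arrow V W (\<lambda>x u. \<zero>\<^bsub>mod_at W x\<^esub>)\<rparr>"
proof (rule comm_groupI, unfold partial_object.simps monoid.simps)
  have W': "is_cmodule C k W" using W by (simp add: Ob_D)
  note grp = abelian_group.axioms(1) [OF module.axioms(2) [OF module_at [OF W']]]
  show "arrow V W (\<lambda>x u. \<zero>\<^bsub>mod_at W x\<^esub>) \<in> hom_set D V W"
    using V W by (intro arrow_in_hom cmap_zero) (auto simp: Ob_D)
  show "plus a b \<in> hom_set D V W" if "a \<in> hom_set D V W" "b \<in> hom_set D V W" for a b
    using that by (elim homE) (simp add: plus_arrow arrow_in_hom cmap_add)
  show "plus (plus a b) c = plus a (plus b c)"
    if "a \<in> hom_set D V W" "b \<in> hom_set D V W" "c \<in> hom_set D V W" for a b c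
    using that
    by (elim homE) (simp add: plus_arrow arrow_eq_iff cmap.closed abelian_monoid.a_assoc [OF grp])
  show "plus a b = plus b a" if "a \<in> hom_set D V W" "b \<in> hom_set D V W" for a b
    using that
    by (elim homE) (simp add: plus_arrow arrow_eq_iff cmap.closed abelian_monoid.a_comm [OF grp])
  show "plus (arrow V W (\<lambda>x u. \<zero>\<^bsub>mod_at W x\<^esub>)) a = a" if "a \<in> hom_set D V W" for a
    using that
    by (elim homE) (simp add: plus_arrow arrow_eq_iff cmap.closed abelian_monoid.l_zero [OF grp])
  fix a assume "a \<in> hom_set D V W"
  then obtain \<eta> where \<eta>: "cmap C k V W \<eta>" "a = arrow V W \<eta>" by (rule homE)
  have "plus (arrow V W (\<lambda>x u. \<ominus>\<^bsub>mod_at W x\<^esub> \<eta> x u)) a = arrow V W (\<lambda>x u. \<zero>\<^bsub>mod_at W x\<^esub>)"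
    using \<eta> by (simp add: plus_arrow arrow_eq_iff cmap.closed
        abelian_group.l_neg [OF module.axioms(2) [OF module_at [OF W']]])
  moreover have "arrow V W (\<lambda>x u. \<ominus>\<^bsub>mod_at W x\<^esub> \<eta> x u) \<in> hom_set D V W"
    by (intro arrow_in_hom V W cmap_minus \<eta>(1))
  ultimately show "\<exists>b \<in> hom_set D V W. plus b a = arrow V W (\<lambda>x u. \<zero>\<^bsub>mod_at W x\<^esub>)" by blast
qed

lemma preadditive_D: "preadditive (D :: (('o, 'a, 'k, 'm) cmodule, _) cat) plus"
  unfolding preadditive_def
proof (intro conjI ballI category_D)
  fix V W :: "('o, 'a, 'k, 'm) cmodule" assume "V \<in> Ob D" "W \<in> Ob D"
  then show "\<exists>z. comm_group \<lparr>carrier = hom_set D V W, monoid.mult = plus, one = z\<rparr>"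
    using hom_comm_group by blast
next
  fix V W X :: "('o, 'a, 'k, 'm) cmodule" and f f' g g'
  assume "f \<in> hom_set D V W" "f' \<in> hom_set D V W" "g \<in> hom_set D W X" "g' \<in> hom_set D W X"
  then obtain \<eta> \<eta>' \<theta> \<theta>' where *: "cmap C k V W \<eta>" "cmap C k V W \<eta>'" "cmap C k W X \<theta>" "cmap C k W X \<theta>'"
    "f = arrow V W \<eta>" "f' = arrow V W \<eta>'" "g = arrow W X \<theta>" "g' = arrow W X \<theta>'"
    by (elim homE)
  then show "g \<cdot>\<^bsub>D\<^esub> plus f f' = plus (g \<cdot>\<^bsub>D\<^esub> f) (g \<cdot>\<^bsub>D\<^esub> f')"
    "plus g g' \<cdot>\<^bsub>D\<^esub> f = plus (g \<cdot>\<^bsub>D\<^esub> f) (g' \<cdot>\<^bsub>D\<^esub> f)"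
    by (simp_all add: plus_arrow Cmp_arrow cmap_add arrow_eq_iff cmap.closed
        module_hom.add [OF cmap.hom_at])
qed

text \<open>The sum is first formed as \<open>?S\<close>, whose elements are functions on
  \<open>{..<2}\<close>, and then relabelled to a module \<open>T\<close> over \<open>'m\<close>.
  Its injections and projections are carried over by the relabelling \<open>E\<close> and its
  inverse \<open>r\<close>.\<close>

lemma biproduct_exists:
  fixes V W :: "('o, 'a, 'k, 'm) cmodule"
  assumes inf: "infinite (UNIV :: 'm set)" and V: "V \<in> Ob D" and W: "W \<in> Ob D"
  shows "has_biproduct D plus V W"
proof -
  have V': "is_cmodule C k V" and W': "is_cmodule C k W" using V W by (auto simp: Ob_D)
  note mV = module_at [OF V'] and mW = module_at [OF W']
  \<comment> \<open>an injection \<open>'m \<times> 'm \<rightarrow> 'm\<close> turns pairs into elements of \<open>'m\<close>\<close>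
  have "\<exists>e. bij_betw e ((UNIV :: 'm set) \<times> (UNIV :: 'm set)) (UNIV :: 'm set)"
    using card_of_Times_same_infinite [OF inf] unfolding card_of_ordIso .
  then obtain e :: "'m \<times> 'm \<Rightarrow> 'm" where e: "inj e" by (auto simp: bij_betw_def)
  let ?F = "\<lambda>i::nat. if i = 0 then V else W"
  let ?S = "dsum_cmodule 2 ?F"
  have S: "is_cmodule C k ?S" using V' W' by (intro dsum_is_cmodule) auto
  have mem: "u \<in> carrier (mod_at ?S x) \<longleftrightarrow>
      u 0 \<in> carrier (mod_at V x) \<and> u 1 \<in> carrier (mod_at W x) \<and> u \<in> extensional {..<2}" for u x
    by (auto simp: dsum_module_simps PiE_iff less_2_cases_iff)
  have lt2: "i < 2 \<longleftrightarrow> i = 0 \<or> i = 1" for i :: nat by auto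
  define i where "i = (\<lambda>x v. \<lambda>j \<in> {..<2::nat}. if j = 0 then v else \<zero>\<^bsub>mod_at W x\<^esub>)"
  define j where "j = (\<lambda>x w. \<lambda>j \<in> {..<2::nat}. if j = 0 then \<zero>\<^bsub>mod_at V x\<^esub> else w)"
  have zero: "\<zero>\<^bsub>mod_at V x\<^esub> \<in> carrier (mod_at V x)" "\<zero>\<^bsub>mod_at W x\<^esub> \<in> carrier (mod_at W x)"
    "u \<in> carrier (mod_at V x) \<Longrightarrow> u \<oplus>\<^bsub>mod_at V x\<^esub> \<zero>\<^bsub>mod_at V x\<^esub> = u"
    "w \<in> carrier (mod_at W x) \<Longrightarrow> \<zero>\<^bsub>mod_at W x\<^esub> \<oplus>\<^bsub>mod_at W x\<^esub> w = w"
    "\<zero>\<^bsub>mod_at V x\<^esub> \<oplus>\<^bsub>mod_at V x\<^esub> \<zero>\<^bsub>mod_at V x\<^esub> = \<zero>\<^bsub>mod_at V x\<^esub>"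
    "\<zero>\<^bsub>mod_at W x\<^esub> \<oplus>\<^bsub>mod_at W x\<^esub> \<zero>\<^bsub>mod_at W x\<^esub> = \<zero>\<^bsub>mod_at W x\<^esub>"
    "c \<in> carrier k \<Longrightarrow> c \<odot>\<^bsub>mod_at V x\<^esub> \<zero>\<^bsub>mod_at V x\<^esub> = \<zero>\<^bsub>mod_at V x\<^esub>"
    "c \<in> carrier k \<Longrightarrow> c \<odot>\<^bsub>mod_at W x\<^esub> \<zero>\<^bsub>mod_at W x\<^esub> = \<zero>\<^bsub>mod_at W x\<^esub>"
    if "x \<in> Ob C" for x u w c
  proof -
    interpret A: module k "mod_at V x" by (rule mV [OF that])
    interpret B: module k "mod_at W x" by (rule mW [OF that])
    show "\<zero>\<^bsub>mod_at V x\<^esub> \<in> carrier (mod_at V x)" "\<zero>\<^bsub>mod_at W x\<^esub> \<in> carrier (mod_at W x)"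
      "u \<in> carrier (mod_at V x) \<Longrightarrow> u \<oplus>\<^bsub>mod_at V x\<^esub> \<zero>\<^bsub>mod_at V x\<^esub> = u"
      "w \<in> carrier (mod_at W x) \<Longrightarrow> \<zero>\<^bsub>mod_at W x\<^esub> \<oplus>\<^bsub>mod_at W x\<^esub> w = w"
      "\<zero>\<^bsub>mod_at V x\<^esub> \<oplus>\<^bsub>mod_at V x\<^esub> \<zero>\<^bsub>mod_at V x\<^esub> = \<zero>\<^bsub>mod_at V x\<^esub>"
      "\<zero>\<^bsub>mod_at W x\<^esub> \<oplus>\<^bsub>mod_at W x\<^esub> \<zero>\<^bsub>mod_at W x\<^esub> = \<zero>\<^bsub>mod_at W x\<^esub>"
      "c \<in> carrier k \<Longrightarrow> c \<odot>\<^bsub>mod_at V x\<^esub> \<zero>\<^bsub>mod_at V x\<^esub> = \<zero>\<^bsub>mod_at V x\<^esub>"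
      "c \<in> carrier k \<Longrightarrow> c \<odot>\<^bsub>mod_at W x\<^esub> \<zero>\<^bsub>mod_at W x\<^esub> = \<zero>\<^bsub>mod_at W x\<^esub>"
      by simp_all
  qed
  have act_zero: "act V f \<zero>\<^bsub>mod_at V (Dom C f)\<^esub> = \<zero>\<^bsub>mod_at V (Cod C f)\<^esub>"
    "act W f \<zero>\<^bsub>mod_at W (Dom C f)\<^esub> = \<zero>\<^bsub>mod_at W (Cod C f)\<^esub>" if "f \<in> Arr C" for f
    using module_hom.zero [OF act_hom [OF V' that]] module_hom.zero [OF act_hom [OF W' that]] .
  have S_add: "(u \<oplus>\<^bsub>mod_at ?S x\<^esub> v) 0 = u 0 \<oplus>\<^bsub>mod_at V x\<^esub> v 0"
      "(u \<oplus>\<^bsub>mod_at ?S x\<^esub> v) 1 = u 1 \<oplus>\<^bsub>mod_at W x\<^esub> v 1"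
    and S_smult: "(c \<odot>\<^bsub>mod_at ?S x\<^esub> u) 0 = c \<odot>\<^bsub>mod_at V x\<^esub> u 0"
      "(c \<odot>\<^bsub>mod_at ?S x\<^esub> u) 1 = c \<odot>\<^bsub>mod_at W x\<^esub> u 1"
    and S_act: "act ?S f u 0 = act V f (u 0)" "act ?S f u 1 = act W f (u 1)" for x u v c f
    by (simp_all add: dsum_module_simps act_dsum)
  have p: "cmap C k ?S V (\<lambda>x u. u 0)"
    by (rule cmap.intro [OF cmods_axioms cmap_axioms.intro [OF S V']])
       (auto simp: natural_def linear_maps_def mem S_add S_smult S_act
          simp del: mod_at_dsum One_nat_def)
  have q: "cmap C k ?S W (\<lambda>x u. u 1)"
    by (rule cmap.intro [OF cmods_axioms cmap_axioms.intro [OF S W']])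
       (auto simp: natural_def linear_maps_def mem S_add S_smult S_act
          simp del: mod_at_dsum One_nat_def)
  have i: "cmap C k V ?S i"
  proof (unfold_locales, rule V', rule S, unfold natural_def, intro conjI ballI linear_mapsI)
    fix x u v c assume x: "x \<in> Ob C" and u: "u \<in> carrier (mod_at V x)"
    show "i x u \<in> carrier (mod_at ?S x)" using x u zero by (simp add: mem i_def del: mod_at_dsum)
    show "i x (u \<oplus>\<^bsub>mod_at V x\<^esub> v) = i x u \<oplus>\<^bsub>mod_at ?S x\<^esub> i x v"
      using x zero by (auto simp: i_def dsum_module_simps fun_eq_iff)
    show "i x (c \<odot>\<^bsub>mod_at V x\<^esub> u) = c \<odot>\<^bsub>mod_at ?S x\<^esub> i x u" if "c \<in> carrier k"
      using x zero that by (auto simp: i_def dsum_module_simps fun_eq_iff)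
  next
    fix f u assume "f \<in> Arr C" "u \<in> carrier (mod_at V (Dom C f))"
    then show "i (Cod C f) (act V f u) = act ?S f (i (Dom C f) u)"
      by (auto simp: i_def act_dsum act_zero fun_eq_iff)
  qed
  have j: "cmap C k W ?S j"
  proof (unfold_locales, rule W', rule S, unfold natural_def, intro conjI ballI linear_mapsI)
    fix x u v c assume x: "x \<in> Ob C" and u: "u \<in> carrier (mod_at W x)"
    show "j x u \<in> carrier (mod_at ?S x)" using x u zero by (simp add: mem j_def del: mod_at_dsum)
    show "j x (u \<oplus>\<^bsub>mod_at W x\<^esub> v) = j x u \<oplus>\<^bsub>mod_at ?S x\<^esub> j x v"
      using x zero by (auto simp: j_def dsum_module_simps fun_eq_iff)
    show "j x (c \<odot>\<^bsub>mod_at W x\<^esub> u) = c \<odot>\<^bsub>mod_at ?S x\<^esub> j x u" if "c \<in> carrier k"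
      using x zero that by (auto simp: j_def dsum_module_simps fun_eq_iff)
  next
    fix f u assume "f \<in> Arr C" "u \<in> carrier (mod_at W (Dom C f))"
    then show "j (Cod C f) (act W f u) = act ?S f (j (Dom C f) u)"
      by (auto simp: j_def act_dsum act_zero fun_eq_iff)
  qed
  have pq: "i x (u 0) \<oplus>\<^bsub>mod_at ?S x\<^esub> j x (u 1) = u" if "x \<in> Ob C" "u \<in> carrier (mod_at ?S x)" for x u
  proof -
    have "u 0 \<in> carrier (mod_at V x)" "u 1 \<in> carrier (mod_at W x)" "u \<in> extensional {..<2}"
      using that(2) unfolding mem by blast+
    then show ?thesis
      using zero [OF that(1)]
      by (auto simp: i_def j_def dsum_module_simps fun_eq_iff lt2 extensional_def)
  qed
  \<comment> \<open>A function extensional on \<open>{..<2}\<close> is determined by its values at 0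
    and 1, so coding that pair by \<open>e\<close> is injective on the carriers.\<close>
  define E where "E = (\<lambda>(x::'o) u. e (u 0, u (1::nat)))"
  have E_inj: "inj_on (E x) (carrier (mod_at ?S x))" for x
  proof (rule inj_onI)
    fix u v assume "u \<in> carrier (mod_at ?S x)" "v \<in> carrier (mod_at ?S x)" "E x u = E x v"
    then show "u = v"
      using injD [OF e] by (intro extensionalityI [of _ "{..<2}"]) (auto simp: mem E_def lt2 simp del: mod_at_dsum)
  qed
  obtain T where E: "cmap C k ?S T E"
    and bij: "\<And>x. x \<in> Ob C \<Longrightarrow> bij_betw (E x) (carrier (mod_at ?S x)) (carrier (mod_at T x))"
    by (rule relabel [OF S E_inj], rule that)
  interpret E: cmap C k ?S T E by (rule E)
  have E_surj: "E x ` carrier (mod_at ?S x) = carrier (mod_at T x)" if "x \<in> Ob C" for x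
    using bij [OF that] by (simp add: bij_betw_def)
  have E_ker: "u = \<zero>\<^bsub>mod_at ?S x\<^esub>"
    if "x \<in> Ob C" "u \<in> carrier (mod_at ?S x)" "E x u = \<zero>\<^bsub>mod_at T x\<^esub>" for x u
    using module_hom.inj_on_iff [OF E.hom_at] E_inj that by blast
  \<comment> \<open>Factoring the identity of \<open>?S\<close> through the bijective map
    \<open>E\<close> yields the inverse of \<open>E\<close> already as a natural
    transformation.\<close>
  obtain r where r: "cmap C k T ?S r"
    and rE: "\<And>x u. x \<in> Ob C \<Longrightarrow> u \<in> carrier (mod_at ?S x) \<Longrightarrow> r x (E x u) = u"
    using factor_through_surjective [OF E cmap_id [OF S] E_surj E_ker] by blast
  define p' where "p' = (\<lambda>x t. r x t 0)"
  define q' where "q' = (\<lambda>x t. r x t 1)"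
  define i' where "i' = (\<lambda>x v. E x (i x v))"
  define j' where "j' = (\<lambda>x w. E x (j x w))"
  have p': "cmap C k T V p'" and q': "cmap C k T W q'"
    unfolding p'_def q'_def using cmap_compose [OF r p] cmap_compose [OF r q] .
  have i': "cmap C k V T i'" and j': "cmap C k W T j'"
    unfolding i'_def j'_def using cmap_compose [OF i E] cmap_compose [OF j E] .
  have pq': "i' x (p' x t) \<oplus>\<^bsub>mod_at T x\<^esub> j' x (q' x t) = t"
    if x: "x \<in> Ob C" and t: "t \<in> carrier (mod_at T x)" for x t
  proof -
    obtain u where u: "u \<in> carrier (mod_at ?S x)" "t = E x u" using E_surj [OF x] t by blast
    have "i x (u 0) \<in> carrier (mod_at ?S x)" "j x (u 1) \<in> carrier (mod_at ?S x)"
      using cmap.closed [OF i x] cmap.closed [OF j x] u(1) by (simp_all add: mem del: mod_at_dsum)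
    then have "E x (i x (u 0)) \<oplus>\<^bsub>mod_at T x\<^esub> E x (j x (u 1)) = E x u"
      using module_hom.add [OF E.hom_at [OF x]] pq [OF x u(1)] by metis
    then show ?thesis using u x by (simp add: p'_def q'_def i'_def j'_def rE)
  qed
  have pi: "p' x (i' x v) = v" if "x \<in> Ob C" "v \<in> carrier (mod_at V x)" for x v
    using rE [OF that(1) cmap.closed [OF i that]] by (simp add: p'_def i'_def) (simp add: i_def)
  have qj: "q' x (j' x w) = w" if "x \<in> Ob C" "w \<in> carrier (mod_at W x)" for x w
    using rE [OF that(1) cmap.closed [OF j that]] by (simp add: q'_def j'_def) (simp add: j_def)
  have "tame C k T"
    using V W by (intro tame_sum [OF p' q' i' j' pq']) (auto simp: Ob_D)
  then have T: "T \<in> Ob D" using E.target by (simp add: Ob_D)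
  show ?thesis
    unfolding has_biproduct_def
  proof (intro bexI conjI)
    show "T \<in> Ob D" by (rule T)
    show "arrow T V p' \<in> hom_set D T V" "arrow T W q' \<in> hom_set D T W"
      "arrow V T i' \<in> hom_set D V T" "arrow W T j' \<in> hom_set D W T"
      by (intro arrow_in_hom T V W p' q' i' j')+
    show "arrow T V p' \<cdot>\<^bsub>D\<^esub> arrow V T i' = Ide D V" "arrow T W q' \<cdot>\<^bsub>D\<^esub> arrow W T j' = Ide D W"
      using pi qj by (simp_all add: Cmp_arrow i' j' arrow_eq_iff)
    show "plus (arrow V T i' \<cdot>\<^bsub>D\<^esub> arrow T V p') (arrow W T j' \<cdot>\<^bsub>D\<^esub> arrow T W q') = Ide D T"
      using pq' by (simp add: Cmp_arrow p' q' plus_arrow arrow_eq_iff)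
  qed
qed

text \<open>The kernel of \<open>f\<close> lies in \<open>D\<close>, so its inclusion and the zero
  map can be compared: \<open>f\<close> sends both to the same arrow, hence the inclusion is zero
  and \<open>f\<close> is injective at every object. By objectwise exactness \<open>f\<close> is
  then the kernel of its cokernel.\<close>

lemma monomorphism_kernel:
  fixes f :: "('o, 'a, 'k, 'm) cmodule \<times> ('o \<Rightarrow> 'm \<Rightarrow> 'm) \<times> ('o, 'a, 'k, 'm) cmodule"
  assumes mono: "monomorphism D f"
  shows "\<exists>g \<in> Arr D. is_kernel D g f"
proof -
  have "f \<in> Arr D" using mono by (simp add: monomorphism_def)
  then obtain V W \<eta> where f: "cmap C k V W \<eta>" "f = arrow V W \<eta>" "V \<in> Ob D" "W \<in> Ob D"
    by (rule ArrE)
  interpret cmap C k V W \<eta> by (rule f(1))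
  obtain K :: "('o, 'a, 'k, 'm) cmodule" and i where K: "K \<in> Ob D" and i: "cmap C k K V i"
    and "\<And>x. x \<in> Ob C \<Longrightarrow> inj_on (i x) (carrier (mod_at K x))"
    and ex: "\<And>x. x \<in> Ob C \<Longrightarrow>
      i x ` carrier (mod_at K x) = {u \<in> carrier (mod_at V x). \<eta> x u = \<zero>\<^bsub>mod_at W x\<^esub>}"
    by (rule kernel_exists [OF f(1,3,4)], rule that)
  have z: "cmap C k K V (\<lambda>x u. \<zero>\<^bsub>mod_at V x\<^esub>)"
    by (rule cmap_zero [OF cmap.source [OF i] source])
  have "\<eta> x (i x u) = \<eta> x \<zero>\<^bsub>mod_at V x\<^esub>" if "x \<in> Ob C" "u \<in> carrier (mod_at K x)" for x u
    using ex [OF that(1)] that zero_at by auto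
  then have "f \<cdot>\<^bsub>D\<^esub> arrow K V i = f \<cdot>\<^bsub>D\<^esub> arrow K V (\<lambda>x u. \<zero>\<^bsub>mod_at V x\<^esub>)"
    by (simp add: f(2) Cmp_arrow [OF i] Cmp_arrow [OF z] arrow_eq_iff)
  then have "arrow K V i = arrow K V (\<lambda>x u. \<zero>\<^bsub>mod_at V x\<^esub>)"
    using mono K arrow_in_hom [OF K f(3) i] arrow_in_hom [OF K f(3) z]
    unfolding monomorphism_def f(2) D_sel by blast
  then have i0: "i x u = \<zero>\<^bsub>mod_at V x\<^esub>" if "x \<in> Ob C" "u \<in> carrier (mod_at K x)" for x u
    using that by (simp add: arrow_eq_iff)
  have inj: "inj_on (\<eta> x) (carrier (mod_at V x))" if x: "x \<in> Ob C" for x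
    unfolding module_hom.inj_on_iff [OF hom_at [OF x]]
  proof (intro ballI impI)
    fix u assume "u \<in> carrier (mod_at V x)" "\<eta> x u = \<zero>\<^bsub>mod_at W x\<^esub>"
    then have "u \<in> i x ` carrier (mod_at K x)" using ex [OF x] by simp
    then show "u = \<zero>\<^bsub>mod_at V x\<^esub>" using i0 [OF x] by blast
  qed
  obtain Q :: "('o, 'a, 'k, 'm) cmodule" and q where Q: "Q \<in> Ob D" and q: "cmap C k W Q q"
    and "\<And>x. x \<in> Ob C \<Longrightarrow> q x ` carrier (mod_at W x) = carrier (mod_at Q x)"
    and ex': "\<And>x. x \<in> Ob C \<Longrightarrow>
      \<eta> x ` carrier (mod_at V x) = {u \<in> carrier (mod_at W x). q x u = \<zero>\<^bsub>mod_at Q x\<^esub>}"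
    by (rule cokernel_exists [OF f(1,3,4)], rule that)
  have "is_kernel D (arrow W Q q) f"
    unfolding f(2) by (rule is_kernelI [OF q f(4) Q f(1,3) inj ex'])
  then show ?thesis using arrow_in_Arr [OF f(4) Q q] by blast
qed

text \<open>Dually, the projection to the cokernel and the zero map agree after composition with
  \<open>f\<close>, so the cokernel vanishes and \<open>f\<close> is surjective at every object; it
  is then the cokernel of its kernel.\<close>

lemma epimorphism_cokernel:
  fixes f :: "('o, 'a, 'k, 'm) cmodule \<times> ('o \<Rightarrow> 'm \<Rightarrow> 'm) \<times> ('o, 'a, 'k, 'm) cmodule"
  assumes epi: "epimorphism D f"
  shows "\<exists>g \<in> Arr D. is_cokernel D g f"
proof -
  have "f \<in> Arr D" using epi by (simp add: epimorphism_def)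
  then obtain V W \<eta> where f: "cmap C k V W \<eta>" "f = arrow V W \<eta>" "V \<in> Ob D" "W \<in> Ob D"
    by (rule ArrE)
  interpret cmap C k V W \<eta> by (rule f(1))
  obtain Q :: "('o, 'a, 'k, 'm) cmodule" and q where Q: "Q \<in> Ob D" and q: "cmap C k W Q q"
    and "\<And>x. x \<in> Ob C \<Longrightarrow> q x ` carrier (mod_at W x) = carrier (mod_at Q x)"
    and ex: "\<And>x. x \<in> Ob C \<Longrightarrow>
      \<eta> x ` carrier (mod_at V x) = {u \<in> carrier (mod_at W x). q x u = \<zero>\<^bsub>mod_at Q x\<^esub>}"
    by (rule cokernel_exists [OF f(1,3,4)], rule that)
  have z: "cmap C k W Q (\<lambda>x u. \<zero>\<^bsub>mod_at Q x\<^esub>)"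
    by (rule cmap_zero [OF target cmap.target [OF q]])
  have "q x (\<eta> x u) = \<zero>\<^bsub>mod_at Q x\<^esub>" if "x \<in> Ob C" "u \<in> carrier (mod_at V x)" for x u
    using ex [OF that(1)] that by blast
  then have "arrow W Q q \<cdot>\<^bsub>D\<^esub> f = arrow W Q (\<lambda>x u. \<zero>\<^bsub>mod_at Q x\<^esub>) \<cdot>\<^bsub>D\<^esub> f"
    by (simp add: f(2) Cmp_arrow [OF f(1)] arrow_eq_iff)
  then have "arrow W Q q = arrow W Q (\<lambda>x u. \<zero>\<^bsub>mod_at Q x\<^esub>)"
    using epi Q arrow_in_hom [OF f(4) Q q] arrow_in_hom [OF f(4) Q z]
    unfolding epimorphism_def f(2) D_sel by blast
  then have q0: "q x u = \<zero>\<^bsub>mod_at Q x\<^esub>" if "x \<in> Ob C" "u \<in> carrier (mod_at W x)" for x u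
    using that by (simp add: arrow_eq_iff)
  have surj: "\<eta> x ` carrier (mod_at V x) = carrier (mod_at W x)" if x: "x \<in> Ob C" for x
    using ex [OF x] q0 [OF x] by auto
  obtain K :: "('o, 'a, 'k, 'm) cmodule" and i where K: "K \<in> Ob D" and i: "cmap C k K V i"
    and "\<And>x. x \<in> Ob C \<Longrightarrow> inj_on (i x) (carrier (mod_at K x))"
    and ex': "\<And>x. x \<in> Ob C \<Longrightarrow>
      i x ` carrier (mod_at K x) = {u \<in> carrier (mod_at V x). \<eta> x u = \<zero>\<^bsub>mod_at W x\<^esub>}"
    by (rule kernel_exists [OF f(1,3,4)], rule that)
  have "is_cokernel D (arrow K V i) f"
    unfolding f(2) by (rule is_cokernelI [OF i K f(3) f(1,4) surj ex'])
  then show ?thesis using arrow_in_Arr [OF K f(3) i] by blast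
qed

lemma abelian_D:
  assumes inf: "infinite (UNIV :: 'm set)"
  shows "abelian_category (D :: (('o, 'a, 'k, 'm) cmodule, _) cat)"
  unfolding abelian_category_def
proof (intro conjI ballI allI impI)
  show "category (D :: (('o, 'a, 'k, 'm) cmodule, _) cat)" by (rule category_D)
  show "\<exists>pl. preadditive (D :: (('o, 'a, 'k, 'm) cmodule, _) cat) pl \<and>
      (\<forall>V \<in> Ob D. \<forall>W \<in> Ob D. has_biproduct (D :: (('o, 'a, 'k, 'm) cmodule, _) cat) pl V W)"
    using preadditive_D biproduct_exists [OF inf] by blast
  show "\<exists>Z. zero_object (D :: (('o, 'a, 'k, 'm) cmodule, _) cat) Z"
    using zero_object_exists zero_objectI by metis
  fix f :: "('o, 'a, 'k, 'm) cmodule \<times> ('o \<Rightarrow> 'm \<Rightarrow> 'm) \<times> ('o, 'a, 'k, 'm) cmodule"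
  show "\<exists>g \<in> Arr D. is_kernel D g f" if "monomorphism D f" using that by (rule monomorphism_kernel)
  show "\<exists>g \<in> Arr D. is_cokernel D g f" if "epimorphism D f" using that by (rule epimorphism_cokernel)
  assume "f \<in> Arr D"
  then obtain V W \<eta> where f: "cmap C k V W \<eta>" "f = arrow V W \<eta>" "V \<in> Ob D" "W \<in> Ob D"
    by (rule ArrE)
  show "\<exists>i. is_kernel D f i"
    unfolding f(2) by (rule kernel_exists [OF f(1,3,4)], rule exI, rule is_kernelI [OF f(1,3,4)])
  show "\<exists>q. is_cokernel D f q"
    unfolding f(2) by (rule cokernel_exists [OF f(1,3,4)], rule exI, rule is_cokernelI [OF f(1,3,4)])
qed

end

theorem theorem1p1:
  fixes C :: "('o, 'a) cat"
    and k :: "('k, 'r) ring_scheme"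
  assumes "combinatorial_category C"
    and "field k"
    and "\<And>x. x \<in> Ob C \<Longrightarrow> finite (hom_set C x x)"
    and "infinite (UNIV :: 'm set)"
  shows "abelian_category (fp_cmodule_cat C k ::
    (('o, 'a, 'k, 'm) cmodule,
     ('o, 'a, 'k, 'm) cmodule \<times> ('o \<Rightarrow> 'm \<Rightarrow> 'm) \<times> ('o, 'a, 'k, 'm) cmodule) cat)"
proof -
  interpret combinatorial C k
    by (rule combinatorial_category_imp) (fact assms)+
  show ?thesis by (rule abelian_D [OF assms(4)])
qed

end
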